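(* Let $\Bbbk$ be a field and let $G$ be a graph on $n\geq 3$ vertices with edge density $\varepsilon$, triangle density $\tau$, and clique-number density $\kappa$. If $G$ is $C_4$-free and its clique complex is $2$-Leray over $\Bbbk$, then $$\tau \;\leq\; \frac{(3-\kappa^2)\,\kappa\,\varepsilon}{1+2\kappa-\kappa^2}.$$
   Context: Graphs are finite and simple. A graph is $C_4$-free if it has no induced subgraph isomorphic to the cycle on four vertices. For a graph $G=(V,E)$ on $n$ vertices: the edge density is $\varepsilon = |E|/\binom{n}{2}$; the triangle density is $\tau = (\text{number of triangles in } G)/\binom{n}{3}$; the clique number $\omega(G)$ is the order of the largest complete subgraph of $G$; the clique-number density is $\kappa=\omega(G)/n$. The clique complex $X(G)$ is the simplicial complex on vertex set $V$ whose faces are the cliques of $G$. A simplicial complex $X$ on vertex set $V$ is $2$-Leray over $\Bbbk$ if $\tilde H_p(X[W];\Bbbk)=0$ for all $p\geq 2$ and all $W\subseteq V$, where $X[W]$ is the induced subcomplex on $W$. *)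

theory Defs
  imports Complex_Main
begin

section \<open>Finite simple graphs\<close>

definition simple_graph :: "'a set \<Rightarrow> 'a set set \<Rightarrow> bool" where
  "simple_graph V E \<longleftrightarrow> finite V \<and> (\<forall>e\<in>E. e \<subseteq> V \<and> card e = 2)"

definition induced_edges :: "'a set set \<Rightarrow> 'a set \<Rightarrow> 'a set set" where
  "induced_edges E W = {e \<in> E. e \<subseteq> W}"

definition graph_isomorphic :: "'a set \<Rightarrow> 'a set set \<Rightarrow> 'b set \<Rightarrow> 'b set set \<Rightarrow> bool" where
  "graph_isomorphic V E V' E' \<longleftrightarrow>
     (\<exists>f. bij_betw f V V' \<and> (\<forall>u\<in>V. \<forall>v\<in>V. {u, v} \<in> E \<longleftrightarrow> {f u, f v} \<in> E'))"

definition C4_verts :: "nat set" where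
  "C4_verts = {0, 1, 2, 3}"

definition C4_edges :: "nat set set" where
  "C4_edges = {{0, 1}, {1, 2}, {2, 3}, {3, 0}}"

definition C4_free :: "'a set \<Rightarrow> 'a set set \<Rightarrow> bool" where
  "C4_free V E \<longleftrightarrow>
     \<not> (\<exists>W\<subseteq>V. graph_isomorphic W (induced_edges E W) C4_verts C4_edges)"

definition cliques :: "'a set \<Rightarrow> 'a set set \<Rightarrow> 'a set set" where
  "cliques V E = {K. K \<subseteq> V \<and> (\<forall>u\<in>K. \<forall>v\<in>K. u \<noteq> v \<longrightarrow> {u, v} \<in> E)}"

definition triangles :: "'a set \<Rightarrow> 'a set set \<Rightarrow> 'a set set" where
  "triangles V E = {T \<in> cliques V E. card T = 3}"

definition clique_number :: "'a set \<Rightarrow> 'a set set \<Rightarrow> nat" where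
  "clique_number V E = Max (card ` cliques V E)"

definition edge_density :: "'a set \<Rightarrow> 'a set set \<Rightarrow> real" where
  "edge_density V E = real (card E) / real (card V choose 2)"

definition triangle_density :: "'a set \<Rightarrow> 'a set set \<Rightarrow> real" where
  "triangle_density V E = real (card (triangles V E)) / real (card V choose 3)"

definition clique_number_density :: "'a set \<Rightarrow> 'a set set \<Rightarrow> real" where
  "clique_number_density V E = real (clique_number V E) / real (card V)"


section \<open>Reduced simplicial homology of finite complexes\<close>

text \<open>
  A complex is given by its set of faces, the empty face included.

  An oriented \<open>p\<close>-chain is represented by its coefficient function: \<open>c [v\<^sub>0, \<dots>, v\<^sub>p]\<close> is the
  coefficient of the oriented simplex \<open>[v\<^sub>0, \<dots>, v\<^sub>p]\<close>. Since reversing the orientation changes the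
  sign, this is an alternating function on the orderings of the \<open>p\<close>-faces, and no total order on
  the vertices has to be chosen. Distinctness is required separately because alternation does not
  imply it in characteristic 2.
\<close>

definition simplicial_chains :: "'a set set \<Rightarrow> nat \<Rightarrow> ('a list \<Rightarrow> 'k::field) set" where
  "simplicial_chains X p = {c.
     (\<forall>xs. c xs \<noteq> 0 \<longrightarrow> length xs = p + 1 \<and> distinct xs \<and> set xs \<in> X) \<and>
     (\<forall>xs u v ys. c (xs @ u # v # ys) = - c (xs @ v # u # ys))}"

text \<open>
  This is the linear map \<open>\<partial>[v\<^sub>0, \<dots>, v\<^sub>p] = (\<Sum>i\<le>p. (-1)\<^sup>i [v\<^sub>0, \<dots>, v\<^sub>i\<^sub>-\<^sub>1, v\<^sub>i\<^sub>+\<^sub>1, \<dots>, v\<^sub>p])\<close> on coefficient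
  functions: the simplices having \<open>xs\<close> in their boundary can be oriented as \<open>v # xs\<close>, and then \<open>xs\<close>
  occurs with sign \<open>+1\<close>. On 0-chains the value at \<open>[]\<close> is the augmentation, so that degree 0
  gives reduced homology as well.
\<close>

definition simplicial_boundary :: "'a set set \<Rightarrow> ('a list \<Rightarrow> 'k::field) \<Rightarrow> 'a list \<Rightarrow> 'k" where
  "simplicial_boundary X c xs = (\<Sum>v\<in>\<Union>X. c (v # xs))"

definition simplicial_cycles :: "'a set set \<Rightarrow> nat \<Rightarrow> ('a list \<Rightarrow> 'k::field) set" where
  "simplicial_cycles X p = {c \<in> simplicial_chains X p. simplicial_boundary X c = (\<lambda>_. 0)}"

definition simplicial_boundaries :: "'a set set \<Rightarrow> nat \<Rightarrow> ('a list \<Rightarrow> 'k::field) set" where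
  "simplicial_boundaries X p = simplicial_boundary X ` simplicial_chains X (p + 1)"

definition reduced_homology :: "'a set set \<Rightarrow> nat \<Rightarrow> ('a list \<Rightarrow> 'k::field) set set" where
  "reduced_homology X p =
     simplicial_cycles X p //
       {(c, d). c \<in> simplicial_cycles X p \<and> d \<in> simplicial_cycles X p \<and>
                (\<lambda>xs. c xs - d xs) \<in> simplicial_boundaries X p}"

definition induced_subcomplex :: "'a set set \<Rightarrow> 'a set \<Rightarrow> 'a set set" where
  "induced_subcomplex X W = {F \<in> X. F \<subseteq> W}"

text \<open>The zero element of the quotient is the class consisting of all boundaries.\<close>

definition Leray :: "'k::field itself \<Rightarrow> nat \<Rightarrow> 'a set \<Rightarrow> 'a set set \<Rightarrow> bool" where
  "Leray _ d V X \<longleftrightarrow>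
     (\<forall>p\<ge>d. \<forall>W\<subseteq>V.
        (reduced_homology (induced_subcomplex X W) p :: ('a list \<Rightarrow> 'k) set set) =
          {simplicial_boundaries (induced_subcomplex X W) p})"

definition clique_complex :: "'a set \<Rightarrow> 'a set set \<Rightarrow> 'a set set" where
  "clique_complex V E = cliques V E"

end

theory Submission
  imports Defs
    "HOL-Library.Function_Algebras"
    "HOL-Library.Multiset"
    "HOL-Computational_Algebra.Polynomial"
    "HOL-Computational_Algebra.Formal_Laurent_Series"
begin

text \<open>
  Let \<open>w\<close> be the clique number and \<open>A\<close> the Stanley--Reisner ring of the clique complex. Since the
  complex is 2-Leray, \<open>A\<close> has Castelnuovo--Mumford regularity at most 2, so \<open>A / (\<theta>\<^sub>1, \<dots>, \<theta>\<^sub>w)\<close>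
  vanishes in degree 3 for every linear system of parameters; a moment curve provides one in which
  any \<open>w\<close> vertices are independent. Comparing dimensions in degrees 1, 2 and 3, one vertex at a time,
  bounds the number of triangles by a sum of convex functions of the back-degrees with respect to an
  arbitrary vertex order.

  By \<open>C\<^sub>4\<close>-freeness the common neighbours of two nonadjacent vertices form a clique, so the degrees of
  nonadjacent vertices sum to at most \<open>n + w - 3\<close>. Hence the vertices of degree above half of this
  bound form a clique. The order takes this clique first and then, in effect, the remaining vertices
  at random; convexity and the degree bound give the inequality.
\<close>

text \<open>The Tor groups behind the regularity are handled as exactness of Koszul complexes in
  single internal degrees. Hochster's formula gives it for the variables in degrees at least 3;
  appending forms preserves it, and so does removing a variable, by descending induction on the
  degree. That induction starts above all face sizes, where exactness only asks that the remaining
  forms span the linear forms on each face. A moment curve needs as many scalars as there are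
  vertices, and the field may be finite, so the forms have coefficients in Laurent series.

  The constant of the theorem comes from one extreme case. In a random order the back-degree of a
  vertex outside the clique is uniform on an interval from its number of neighbours in the clique to
  its degree, which is at most (n + w - 3) / 2. The worst interval starts at w and ends there. Its
  mean cost may be at most what an initial clique of w vertices saves per remaining vertex, and this
  condition fixes the coefficient of the edge density up to lower-order terms.\<close>

section \<open>Koszul complexes\<close>

text \<open>
  A cochain gives the coefficient of each subset of the forms, encoded by its indicator list. We work
  over the graded dual of a ring, where multiplication by a form becomes an operator lowering the
  degree; so the differential lowers the internal degree \<open>m\<close> while raising the exterior degree.
\<close>

fun koszul :: "('b::ab_group_add \<Rightarrow> 'b) list \<Rightarrow> (bool list \<Rightarrow> 'b) \<Rightarrow> bool list \<Rightarrow> 'b" where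
  "koszul (f # L) c (b # bs) =
     (if b then f (c (False # bs)) - koszul L (\<lambda>x. c (True # x)) bs
      else koszul L (\<lambda>x. c (False # x)) bs)"
| "koszul _ c _ = 0"

definition cochains :: "nat \<Rightarrow> 'b::ab_group_add set \<Rightarrow> (bool list \<Rightarrow> 'b) set" where
  "cochains n B = {c. \<forall>bs. (length bs = n \<longrightarrow> c bs \<in> B) \<and> (length bs \<noteq> n \<longrightarrow> c bs = 0)}"

text \<open>All exterior degrees are treated at once. For the variables acting on the dual of a
  Stanley--Reisner ring this is the vanishing of Tor_i in degree i + m for every i, so exactness for
  all m >= 3 says that the regularity is at most 2.\<close>

definition koszul_exact :: "(nat \<Rightarrow> 'b::ab_group_add set) \<Rightarrow> ('b \<Rightarrow> 'b) list \<Rightarrow> nat \<Rightarrow> bool" where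
  "koszul_exact B L m \<longleftrightarrow>
     (\<forall>c \<in> cochains (length L) (B m). koszul L c = (\<lambda>_. 0) \<longrightarrow>
        (\<exists>u \<in> cochains (length L) (B (Suc m)). koszul L u = c))"

text \<open>Splits off the first form: \<open>x\<close> holds the subsets without it and
  \<open>y\<close> those with it. In this shape \<open>koszul (f # L)\<close> is the mapping cone of
  \<open>f\<close> on the complex of \<open>L\<close>.\<close>

definition cone :: "(bool list \<Rightarrow> 'b) \<Rightarrow> (bool list \<Rightarrow> 'b) \<Rightarrow> bool list \<Rightarrow> 'b::zero" where
  "cone x y bs = (case bs of [] \<Rightarrow> 0 | b # bs' \<Rightarrow> if b then y bs' else x bs')"

definition alt :: "bool list \<Rightarrow> 'b \<Rightarrow> 'b::ab_group_add" where
  "alt bs x = (if even (count_list bs True) then x else - x)"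

text \<open>Interior product with the \<open>k\<close>-th basis vector of the exterior algebra,
  combined with an operator \<open>S\<close> on the coefficients.\<close>

fun homotopy :: "nat \<Rightarrow> ('b::ab_group_add \<Rightarrow> 'b) \<Rightarrow> (bool list \<Rightarrow> 'b) \<Rightarrow> bool list \<Rightarrow> 'b" where
  "homotopy k S c [] = 0"
| "homotopy 0 S c (b # bs) = (if b then 0 else S (c (True # bs)))"
| "homotopy (Suc k) S c (b # bs) =
     (if b then - homotopy k S (\<lambda>x. c (True # x)) bs else homotopy k S (\<lambda>x. c (False # x)) bs)"

lemma cone_simps [simp]:
  "cone x y [] = 0" "cone x y (False # bs) = x bs" "cone x y (True # bs) = y bs"
  by (simp_all add: cone_def)

lemma koszul_length:
  assumes "\<And>f. f \<in> set L \<Longrightarrow> f 0 = 0" "\<And>bs. length bs \<noteq> length L \<Longrightarrow> c bs = 0"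
    and "length bs \<noteq> length L"
  shows "koszul L c bs = 0"
  using assms by (induction L c bs rule: koszul.induct) auto

declare koszul.simps(2) [simp del]

lemma koszul_Nil [simp]: "koszul [] c = (\<lambda>_. 0)"
  by (rule ext) (simp add: koszul.simps)

lemma koszul_empty [simp]: "koszul L c [] = 0"
  by (cases L) auto

lemma koszul_cone:
  assumes "c [] = 0"
  shows "koszul (f # L) c = cone (koszul L (\<lambda>x. c (False # x)))
           (\<lambda>bs. f (c (False # bs)) - koszul L (\<lambda>x. c (True # x)) bs)"
  by (rule ext) (auto simp: cone_def split: list.splits)

lemma cochains_Cons_iff:
  "c \<in> cochains (Suc n) B \<longleftrightarrow>
     c [] = 0 \<and> (\<lambda>x. c (False # x)) \<in> cochains n B \<and> (\<lambda>x. c (True # x)) \<in> cochains n B"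
proof
  assume R: "c [] = 0 \<and> (\<lambda>x. c (False # x)) \<in> cochains n B \<and> (\<lambda>x. c (True # x)) \<in> cochains n B"
  have "(length bs = Suc n \<longrightarrow> c bs \<in> B) \<and> (length bs \<noteq> Suc n \<longrightarrow> c bs = 0)" for bs
    using R by (cases bs; cases "hd bs") (auto simp: cochains_def)
  then show "c \<in> cochains (Suc n) B" by (simp add: cochains_def)
qed (auto simp: cochains_def)

lemma cone_cochains: "x \<in> cochains n B \<Longrightarrow> y \<in> cochains n B \<Longrightarrow> cone x y \<in> cochains (Suc n) B"
  by (simp add: cochains_Cons_iff)

lemma koszul_map:
  assumes "\<And>x y. T (x - y) = T x - T y"
    and "length L = length L'"
    and "\<And>k bs. k < length L \<Longrightarrow> T ((L ! k) (c bs)) = (L' ! k) (T (c bs))"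
  shows "koszul L' (\<lambda>bs. T (c bs)) bs = T (koszul L c bs)"
  using assms(2,3)
proof (induction L c bs arbitrary: L' rule: koszul.induct)
  have T0: "T 0 = 0" using assms(1)[of 0 0] by simp
  case (1 f L c b bs)
  from 1(3) obtain f' L'' where L': "L' = f' # L''" and len: "length L = length L''"
    by (cases L') auto
  have "T ((L ! k) (c bs)) = (L'' ! k) (T (c bs))" if "k < length L" for k bs
    using 1(4)[of "Suc k" bs] that by (simp add: L')
  moreover have "T (f (c bs)) = f' (T (c bs))" for bs
    using 1(4)[of 0 bs] by (simp add: L')
  ultimately show ?case
    using 1(1)[OF _ len] 1(2)[OF _ len] by (simp add: L' assms(1))
next
  have T0: "T 0 = 0" using assms(1)[of 0 0] by simp
  {
    case ("2_1" c bs)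
    then show ?case using T0 by simp
  next
    case ("2_2" L c)
    then show ?case using T0 by simp
  }
qed

lemma homotopy_map:
  assumes "\<And>x y. T (x - y) = T x - T y" "\<And>bs. T (S (c bs)) = S (T (c bs))"
  shows "homotopy k S (\<lambda>bs. T (c bs)) bs = T (homotopy k S c bs)"
proof -
  have T0: "T 0 = 0" using assms(1)[of 0 0] by simp
  have Tm: "T (- x) = - T x" for x using assms(1)[of 0 x] T0 by simp
  show ?thesis using assms(2)
    by (induction k S c bs rule: homotopy.induct) (auto simp: T0 Tm)
qed

lemma koszul_diff:
  assumes "\<And>f x y. f \<in> set L \<Longrightarrow> f (x - y) = f x - f y"
  shows "koszul L (\<lambda>bs. c bs - c' bs) bs = koszul L c bs - koszul L c' bs"
  using assms
  by (induction L c bs arbitrary: c' rule: koszul.induct) (auto simp: koszul.simps)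

lemma homotopy_diff:
  assumes "\<And>x y. S (x - y) = S x - S y"
  shows "homotopy k S (\<lambda>bs. c bs - c' bs) bs = homotopy k S c bs - homotopy k S c' bs"
  using assms by (induction k S c bs arbitrary: c' rule: homotopy.induct) auto

lemma alt_diff: "alt bs (x - y) = alt bs x - alt bs y"
  by (simp add: alt_def)

lemma alt_minus: "alt bs (- y) = - alt bs y"
  by (simp add: alt_def)

lemma alt_Cons [simp]: "alt (b # bs) x = (if b then - alt bs x else alt bs x)"
  by (simp add: alt_def)

lemma alt_Nil [simp]: "alt [] x = x"
  by (simp add: alt_def)

text \<open>Commutativity is asked only on the graded pieces: for \<open>act\<close> it can fail at
  a function that is nonzero outside \<open>M\<close>.\<close>

locale graded_ops =
  fixes B :: "nat \<Rightarrow> 'b::ab_group_add set" and A :: "('b \<Rightarrow> 'b) set"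
  assumes zero: "0 \<in> B m"
    and diff: "x \<in> B m \<Longrightarrow> y \<in> B m \<Longrightarrow> x - y \<in> B m"
    and op_diff: "f \<in> A \<Longrightarrow> f (x - y) = f x - f y"
    and op_mem: "f \<in> A \<Longrightarrow> x \<in> B (Suc m) \<Longrightarrow> f x \<in> B m"
    and comm: "f \<in> A \<Longrightarrow> g \<in> A \<Longrightarrow> x \<in> B m \<Longrightarrow> f (g x) = g (f x)"
begin

lemma op_zero: "f \<in> A \<Longrightarrow> f 0 = 0"
  using op_diff[of f 0 0] by simp

lemma op_minus: "f \<in> A \<Longrightarrow> f (- x) = - f x"
  using op_diff[of f 0 x] op_zero by simp

lemma minus: "x \<in> B m \<Longrightarrow> - x \<in> B m"
  using diff[OF zero, of x] by simp

lemma cochains_diff: "c \<in> cochains n (B m) \<Longrightarrow> c' \<in> cochains n (B m) \<Longrightarrow> (\<lambda>bs. c bs - c' bs) \<in> cochains n (B m)"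
  by (auto simp: cochains_def diff)

lemma cochains_zero: "(\<lambda>_. 0) \<in> cochains n (B m)"
  by (auto simp: cochains_def zero)

lemma cochains_op: "f \<in> A \<Longrightarrow> c \<in> cochains n (B (Suc m)) \<Longrightarrow> (\<lambda>bs. f (c bs)) \<in> cochains n (B m)"
  by (auto simp: cochains_def op_mem op_zero)

lemma cochains_mem: "c \<in> cochains n (B m) \<Longrightarrow> c bs \<in> B m"
  by (cases "length bs = n") (auto simp: cochains_def zero)

lemma koszul_mem:
  "set L \<subseteq> A \<Longrightarrow> c \<in> cochains (length L) (B (Suc m)) \<Longrightarrow> koszul L c \<in> cochains (length L) (B m)"
proof (induction L arbitrary: c)
  case Nil
  then show ?case using cochains_zero by simp
next
  case (Cons f L)
  let ?x = "\<lambda>x. c (False # x)" and ?y = "\<lambda>x. c (True # x)"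
  have c: "c [] = 0" "?x \<in> cochains (length L) (B (Suc m))" "?y \<in> cochains (length L) (B (Suc m))"
    using Cons.prems(2) by (simp_all add: cochains_Cons_iff)
  have "(\<lambda>bs. f (?x bs) - koszul L ?y bs) \<in> cochains (length L) (B m)"
    using Cons c by (intro cochains_diff[OF cochains_op]) auto
  then show ?case
    using Cons c by (simp add: koszul_cone cone_cochains)
qed

lemma koszul_op:
  assumes "set L \<subseteq> A" "g \<in> A" "c \<in> cochains n (B m)"
  shows "koszul L (\<lambda>bs. g (c bs)) = (\<lambda>bs. g (koszul L c bs))"
  using assms cochains_mem by (intro ext koszul_map) (auto intro!: op_diff comm dest: nth_mem)

lemma koszul_diff': "set L \<subseteq> A \<Longrightarrow> koszul L (\<lambda>bs. c bs - c' bs) = (\<lambda>bs. koszul L c bs - koszul L c' bs)"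
  using op_diff by (intro ext koszul_diff) auto

lemma koszul_zero: "set L \<subseteq> A \<Longrightarrow> koszul L (\<lambda>_. 0) = (\<lambda>_. 0)"
  using koszul_diff'[of L "\<lambda>_. 0" "\<lambda>_. 0"] by simp

lemma koszul_minus: "set L \<subseteq> A \<Longrightarrow> koszul L (\<lambda>bs. - c bs) = (\<lambda>bs. - koszul L c bs)"
  using koszul_diff'[of L "\<lambda>_. 0" c] koszul_zero by simp

lemma koszul_length':
  "set L \<subseteq> A \<Longrightarrow> c \<in> cochains (length L) C \<Longrightarrow> length bs \<noteq> length L \<Longrightarrow> koszul L c bs = 0"
  by (rule koszul_length) (auto simp: cochains_def op_zero)

lemma koszul_koszul:
  assumes "set L \<subseteq> A" "c \<in> cochains (length L) (B m)"
  shows "koszul L (koszul L c) = (\<lambda>_. 0)"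
  using assms
proof (induction L arbitrary: c)
  case (Cons f L)
  let ?x = "\<lambda>x. c (False # x)" and ?y = "\<lambda>x. c (True # x)"
  have c: "c [] = 0" "?x \<in> cochains (length L) (B m)" "?y \<in> cochains (length L) (B m)"
    using Cons.prems(2) by (simp_all add: cochains_Cons_iff)
  have L: "set L \<subseteq> A" "f \<in> A" using Cons.prems by auto
  have *: "koszul L (\<lambda>bs. f (?x bs) - koszul L ?y bs) = (\<lambda>bs. f (koszul L ?x bs))"
    using Cons.IH[OF L(1) c(3)] koszul_op[OF L c(2)] by (simp add: koszul_diff'[OF L(1)])
  show ?case
    using Cons.IH[OF L(1) c(2)] * op_zero[OF L(2)]
    by (simp add: koszul_cone c(1) fun_eq_iff cone_def split: list.splits)
qed simp

text \<open>Long exact sequence of the cone. Placed in the part with \<open>f\<close>, a cycle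
  \<open>y\<close> becomes \<open>f\<close> applied to a cycle \<open>x\<close> of degree
  \<open>Suc m\<close>, minus a boundary; exactness one degree higher makes \<open>x\<close> a
  boundary. Because of that shift the induction on the degree has to descend.\<close>

lemma koszul_exact_remove:
  assumes "set (f # L) \<subseteq> A" "koszul_exact B (f # L) m" "koszul_exact B L (Suc m)"
  shows "koszul_exact B L m"
  unfolding koszul_exact_def
proof (intro ballI impI)
  fix y assume y: "y \<in> cochains (length L) (B m)" "koszul L y = (\<lambda>_. 0)"
  have L: "set L \<subseteq> A" "f \<in> A" using assms(1) by auto
  have "cone (\<lambda>_. 0) y \<in> cochains (length (f # L)) (B m)"
    using y cochains_zero by (simp add: cone_cochains)
  moreover have "koszul (f # L) (cone (\<lambda>_. 0) y) = (\<lambda>_. 0)"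
    using y koszul_zero[OF L(1)] op_zero[OF L(2)]
    by (simp add: koszul_cone fun_eq_iff cone_def split: list.splits)
  ultimately obtain w where w: "w \<in> cochains (Suc (length L)) (B (Suc m))"
    "koszul (f # L) w = cone (\<lambda>_. 0) y"
    using assms(2) unfolding koszul_exact_def by auto
  let ?x = "\<lambda>x. w (False # x)" and ?y = "\<lambda>x. w (True # x)"
  have w': "w [] = 0" "?x \<in> cochains (length L) (B (Suc m))" "?y \<in> cochains (length L) (B (Suc m))"
    using w(1) by (simp_all add: cochains_Cons_iff)
  have "koszul L ?x bs = 0" for bs
    using fun_cong[OF w(2), of "False # bs"] by simp
  then have "koszul L ?x = (\<lambda>_. 0)" by auto
  then obtain z where z: "z \<in> cochains (length L) (B (Suc (Suc m)))" "koszul L z = ?x"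
    using assms(3) w'(2) unfolding koszul_exact_def by auto
  have "koszul L (\<lambda>bs. f (z bs) - ?y bs) = y"
  proof
    fix bs
    have "y bs = f (?x bs) - koszul L ?y bs"
      using fun_cong[OF w(2), of "True # bs"] by simp
    moreover have "koszul L (\<lambda>bs. f (z bs)) bs = f (?x bs)"
      using koszul_op[OF L z(1)] z(2) by simp
    ultimately show "koszul L (\<lambda>bs. f (z bs) - ?y bs) bs = y bs"
      by (simp add: koszul_diff'[OF L(1)])
  qed
  moreover have "(\<lambda>bs. f (z bs) - ?y bs) \<in> cochains (length L) (B (Suc m))"
    by (rule cochains_diff[OF cochains_op[OF L(2) z(1)] w'(3)])
  ultimately show "\<exists>u\<in>cochains (length L) (B (Suc m)). koszul L u = y" by auto
qed

lemma koszul_snoc: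
  assumes "length bs = length L"
  shows "koszul (L @ [t]) c (bs @ [False]) = koszul L (\<lambda>x. c (x @ [False])) bs"
    and "koszul (L @ [t]) c (bs @ [True]) = koszul L (\<lambda>x. c (x @ [True])) bs + alt bs (t (c (bs @ [False])))"
  using assms by (induction bs L arbitrary: c rule: list_induct2) (auto simp: alt_minus)

lemma koszul_alt:
  assumes "set L \<subseteq> A"
  shows "koszul L (\<lambda>bs. alt bs (x bs)) = (\<lambda>bs. - alt bs (koszul L x bs))"
proof
  fix bs
  show "koszul L (\<lambda>bs. alt bs (x bs)) bs = - alt bs (koszul L x bs)"
    using assms
  proof (induction L x bs rule: koszul.induct)
    case (1 f L c b bs)
    have "f (alt bs x) = alt bs (f x)" for x
      using 1(3) by (simp add: alt_def op_minus)
    moreover have "koszul L (\<lambda>x. - alt x (c (True # x))) = (\<lambda>bs. - koszul L (\<lambda>x. alt x (c (True # x))) bs)"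
      using 1(3) by (intro koszul_minus) simp
    ultimately show ?case using 1 by (auto simp: alt_diff)
  qed (auto simp: alt_def)
qed

text \<open>Up to the sign \<open>alt\<close>, splitting off the last form also gives a cone, and
  both parts are complexes of \<open>L\<close> in degree \<open>m\<close>: lift the part without
  \<open>t\<close>, correct the other part by the image of this lift, and lift the result. Forms
  enter at the end because the recursion removes variables at the front.\<close>

lemma koszul_exact_snoc:
  assumes "set (L @ [t]) \<subseteq> A" "koszul_exact B L m"
  shows "koszul_exact B (L @ [t]) m"
  unfolding koszul_exact_def
proof (intro ballI impI)
  let ?n = "length L"
  fix c assume c: "c \<in> cochains (length (L @ [t])) (B m)" "koszul (L @ [t]) c = (\<lambda>_. 0)"
  have L: "set L \<subseteq> A" "t \<in> A" using assms(1) by auto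
  define x y where "x = (\<lambda>bs. c (bs @ [False]))" and "y = (\<lambda>bs. c (bs @ [True]))"
  have xy: "x \<in> cochains ?n (B m)" "y \<in> cochains ?n (B m)"
    using c(1) by (auto simp: cochains_def x_def y_def)
  have "koszul L x = (\<lambda>_. 0)"
  proof
    fix bs show "koszul L x bs = 0"
      using koszul_snoc(1)[of bs L t c] fun_cong[OF c(2), of "bs @ [False]"] koszul_length'[OF L(1) xy(1), of bs]
      by (cases "length bs = ?n") (auto simp: x_def)
  qed
  then obtain x' where x': "x' \<in> cochains ?n (B (Suc m))" "koszul L x' = x"
    using assms(2) xy unfolding koszul_exact_def by auto
  define a where "a = (\<lambda>bs. alt bs (t (x' bs)))"
  have a: "a \<in> cochains ?n (B m)"
    using cochains_op[OF L(2) x'(1)] minus by (auto simp: a_def cochains_def alt_def)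
  have Da: "koszul L a = (\<lambda>bs. - alt bs (t (x bs)))"
    unfolding a_def using koszul_alt[OF L(1)] koszul_op[OF L x'(1)] x'(2) by simp
  have Dy: "koszul L y = (\<lambda>bs. - alt bs (t (x bs)))"
  proof
    fix bs show "koszul L y bs = - alt bs (t (x bs))"
    proof (cases "length bs = ?n")
      case True
      then show ?thesis
        using koszul_snoc(2)[of bs L t c] fun_cong[OF c(2), of "bs @ [True]"]
        by (simp add: x_def y_def eq_neg_iff_add_eq_0)
    next
      case False
      then show ?thesis using koszul_length'[OF L(1) xy(2), of bs] xy L op_zero by (auto simp: cochains_def alt_def)
    qed
  qed
  have "koszul L (\<lambda>bs. y bs - a bs) = (\<lambda>_. 0)"
    by (simp add: koszul_diff'[OF L(1)] Da Dy)
  then obtain y' where y': "y' \<in> cochains ?n (B (Suc m))" "koszul L y' = (\<lambda>bs. y bs - a bs)"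
    using assms(2) cochains_diff[OF xy(2) a] unfolding koszul_exact_def by auto
  define u where "u = (\<lambda>bs. if bs = [] then 0 else if last bs then y' (butlast bs) else x' (butlast bs))"
  have u: "u (bs @ [False]) = x' bs" "u (bs @ [True]) = y' bs" for bs
    by (auto simp: u_def)
  have u': "u \<in> cochains (length (L @ [t])) (B (Suc m))"
    unfolding cochains_def
  proof (intro CollectI allI)
    fix bs
    show "(length bs = length (L @ [t]) \<longrightarrow> u bs \<in> B (Suc m)) \<and> (length bs \<noteq> length (L @ [t]) \<longrightarrow> u bs = 0)"
      using x'(1) y'(1) by (cases bs rule: rev_cases) (simp_all add: cochains_def u_def)
  qed
  have "koszul (L @ [t]) u bs = c bs" for bs
  proof (cases "length bs = Suc ?n")
    case True
    then obtain bs' b where bs: "bs = bs' @ [b]" "length bs' = ?n"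
      by (cases bs rule: rev_cases) auto
    show ?thesis
    proof (cases b)
      case True
      then have "koszul (L @ [t]) u bs = koszul L y' bs' + a bs'"
        using bs by (simp add: koszul_snoc u a_def)
      then show ?thesis using y'(2) True bs by (simp add: y_def)
    next
      case False
      then show ?thesis using bs x'(2) by (simp add: koszul_snoc u x_def)
    qed
  next
    case False
    then show ?thesis using koszul_length'[OF assms(1) u', of bs] c(1) by (auto simp: cochains_def)
  qed
  then have "koszul (L @ [t]) u = c" by (rule ext)
  with u' show "\<exists>u\<in>cochains (length (L @ [t])) (B (Suc m)). koszul (L @ [t]) u = c" by blast
qed

lemma koszul_exact_append:
  "set (L @ T) \<subseteq> A \<Longrightarrow> koszul_exact B L m \<Longrightarrow> koszul_exact B (L @ T) m"
proof (induction T rule: rev_induct)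
  case (snoc t T)
  then show ?case using koszul_exact_snoc[of "L @ T" t m] by simp
qed simp

text \<open>Cartan's formula for the interior product. Allowing an \<open>S\<close> that commutes
  with the other forms covers two uses: the identity shows that each form is null-homotopic on the
  Koszul complex, and a partial inverse of a variable removes the multidegrees that are not
  squarefree.\<close>

lemma koszul_homotopy:
  assumes "set L \<subseteq> A" "k < length L" "c \<in> cochains (length L) (B m)" "length bs = length L"
    and "\<And>x y. S (x - y) = S x - S y"
    and "\<And>i x. i < length L \<Longrightarrow> i \<noteq> k \<Longrightarrow> x \<in> B m \<Longrightarrow> (L ! i) (S x) = S ((L ! i) x)"
  shows "koszul L (homotopy k S c) bs + homotopy k S (koszul L c) bs =
           (if bs ! k then (L ! k) (S (c bs)) else S ((L ! k) (c bs)))"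
  using assms(1-4,6)
proof (induction L arbitrary: k c bs)
  case (Cons f L)
  have S0: "S 0 = 0" using assms(5)[of 0 0] by simp
  let ?x = "\<lambda>x. c (False # x)" and ?y = "\<lambda>x. c (True # x)"
  have c: "c [] = 0" "?x \<in> cochains (length L) (B m)" "?y \<in> cochains (length L) (B m)"
    using Cons.prems(3) by (simp_all add: cochains_Cons_iff)
  have L: "set L \<subseteq> A" "f \<in> A" using Cons.prems by auto
  obtain b bs' where bs: "bs = b # bs'" "length bs' = length L"
    using Cons.prems(4) by (cases bs) auto
  show ?case
  proof (cases k)
    case 0
    have "(L ! i) (S x) = S ((L ! i) x)" if "i < length L" "x \<in> B m" for i x
      using Cons.prems(5)[of "Suc i" x] that 0 by auto
    then have "koszul L (\<lambda>x. S (?y x)) bs' = S (koszul L ?y bs')"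
      using cochains_mem[OF c(3)] assms(5) by (intro koszul_map) auto
    then show ?thesis
      using koszul_zero[OF L(1)] by (auto simp: 0 bs assms(5))
  next
    case (Suc k')
    have k': "k' < length L" using Cons.prems(2) Suc by simp
    have S: "(L ! i) (S x) = S ((L ! i) x)" if "i < length L" "i \<noteq> k'" "x \<in> B m" for i x
      using Cons.prems(5)[of "Suc i" x] that Suc by auto
    have fS: "f (S x) = S (f x)" if "x \<in> B m" for x
      using Cons.prems(5)[of 0 x] that Suc by auto
    have hf: "homotopy k' S (\<lambda>x. f (?x x)) bs' = f (homotopy k' S ?x bs')"
      using cochains_mem[OF c(2)] op_diff[OF L(2)] fS by (intro homotopy_map) auto
    show ?thesis
      using Cons.IH[OF L(1) k' c(2) bs(2) S] Cons.IH[OF L(1) k' c(3) bs(2) S]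
      by (auto simp: Suc bs hf homotopy_diff[OF assms(5)] koszul_minus[OF L(1)])
  qed
qed simp

end

lemma koszul_sum:
  assumes "length bs = length L"
  shows "koszul L c bs = (\<Sum>k<length L. if bs ! k then alt (take k bs) ((L ! k) (c (bs[k := False]))) else 0)"
  using assms
proof (induction L arbitrary: c bs)
  case (Cons f L)
  obtain b bs' where bs: "bs = b # bs'" "length bs' = length L"
    using Cons.prems by (cases bs) auto
  have "(\<Sum>k<length (f # L). if bs ! k then alt (take k bs) (((f # L) ! k) (c (bs[k := False]))) else 0) =
     (if b then f (c (False # bs')) else 0) +
     (\<Sum>k<length L. if bs' ! k then alt (b # take k bs') ((L ! k) (c (b # bs'[k := False]))) else 0)"
    unfolding length_Cons sum.lessThan_Suc_shift by (simp add: bs(1) cong: if_cong)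
  also have "(\<Sum>k<length L. if bs' ! k then alt (b # take k bs') ((L ! k) (c (b # bs'[k := False]))) else 0) =
     (if b then - koszul L (\<lambda>x. c (b # x)) bs' else koszul L (\<lambda>x. c (b # x)) bs')"
  proof (cases b)
    case True
    then show ?thesis
      unfolding Cons.IH[OF bs(2)] by (auto simp: sum_negf[symmetric] intro!: sum.cong)
  next
    case False
    then show ?thesis
      unfolding Cons.IH[OF bs(2)] by (auto intro!: sum.cong)
  qed
  finally show ?case by (cases b) (simp_all add: bs)
qed simp

lemma homotopy_mem:
  assumes "\<And>bs. c bs \<in> B" "\<And>x. x \<in> B \<Longrightarrow> S x \<in> C" "0 \<in> C" "\<And>x. x \<in> C \<Longrightarrow> - x \<in> C"
  shows "homotopy k S c bs \<in> C"
  using assms by (induction k S c bs rule: homotopy.induct) auto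

lemma homotopy_length:
  assumes "\<And>bs. length bs \<noteq> n \<Longrightarrow> c bs = 0" "S 0 = 0" "length bs \<noteq> n"
  shows "homotopy k S c bs = 0"
  using assms
proof (induction k S c bs arbitrary: n rule: homotopy.induct)
  case (3 k S c b bs)
  \<comment> \<open>If \<open>n = 0\<close>, then \<open>c\<close> vanishes on all nonempty lists,
    and \<open>n'\<close> may be any number other than \<open>length bs\<close>.\<close>
  define n' where "n' = (if n = 0 then Suc (length bs) else n - 1)"
  have "c (b # x) = 0" if "length x \<noteq> n'" for x b
    using 3(3)[of "b # x"] that by (auto simp: n'_def split: if_splits)
  moreover have "length bs \<noteq> n'"
    using 3(5) by (auto simp: n'_def)
  ultimately show ?case using 3(1)[of n'] 3(2)[of n'] 3(4) by auto
qed auto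

context graded_ops
begin

lemma homotopy_cochains:
  assumes "c \<in> cochains n (B m)" "\<And>x. x \<in> B m \<Longrightarrow> S x \<in> B m'" "S 0 = 0"
  shows "homotopy k S c \<in> cochains n (B m')"
proof -
  have "homotopy k S c bs \<in> B m'" for bs
    using cochains_mem[OF assms(1)] assms(2) zero minus by (rule homotopy_mem)
  moreover have "homotopy k S c bs = 0" if "length bs \<noteq> n" for bs
    using assms(1,3) that by (intro homotopy_length) (auto simp: cochains_def)
  ultimately show ?thesis by (simp add: cochains_def)
qed

lemma koszul_null:
  assumes "set L \<subseteq> A" "k < length L" "c \<in> cochains (length L) (B m)" "koszul L c = (\<lambda>_. 0)"
  shows "koszul L (homotopy k (\<lambda>x. x) c) = (\<lambda>bs. (L ! k) (c bs))"
proof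
  fix bs
  have h: "homotopy k (\<lambda>x. x) c \<in> cochains (length L) (B m)"
    by (rule homotopy_cochains[OF assms(3)]) auto
  have 0: "homotopy k (\<lambda>x. x) (\<lambda>_. 0 :: 'b) bs = 0"
    using homotopy_diff[of "\<lambda>x :: 'b. x" k "\<lambda>_. 0" "\<lambda>_. 0" bs] by simp
  show "koszul L (homotopy k (\<lambda>x. x) c) bs = (L ! k) (c bs)"
  proof (cases "length bs = length L")
    case True
    then show ?thesis using koszul_homotopy[OF assms(1-3) True, of "\<lambda>x. x"] assms(4) 0 by simp
  next
    case False
    have "(L ! k) (c bs) = 0"
      using False assms(3) op_zero[OF subsetD[OF assms(1) nth_mem[OF assms(2)]]] by (simp add: cochains_def)
    with koszul_length'[OF assms(1) h False] show ?thesis by simp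
  qed
qed

end

section \<open>Functions on sets of monomials, with linear forms acting on them\<close>

definition funs_on :: "'a multiset set \<Rightarrow> nat \<Rightarrow> ('a multiset \<Rightarrow> 'k::field) set" where
  "funs_on M m = {\<phi>. \<forall>x. \<phi> x \<noteq> 0 \<longrightarrow> x \<in> M \<and> size x = m}"

text \<open>
  Functions on a set \<open>M\<close> of monomials that is convex for divisibility form the dual of a monomial
  subquotient of the polynomial ring; \<open>act V M f\<close> is dual to multiplication by the form \<open>f\<close>.
\<close>

definition act :: "'a set \<Rightarrow> 'a multiset set \<Rightarrow> ('a \<Rightarrow> 'k) \<Rightarrow> ('a multiset \<Rightarrow> 'k::field) \<Rightarrow> 'a multiset \<Rightarrow> 'k" where
  "act V M f \<phi> x = (if x \<in> M then \<Sum>v\<in>V. f v * \<phi> (add_mset v x) else 0)"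

definition interval_closed :: "'a multiset set \<Rightarrow> bool" where
  "interval_closed M \<longleftrightarrow> (\<forall>x u v. x \<in> M \<longrightarrow> add_mset u (add_mset v x) \<in> M \<longrightarrow> add_mset v x \<in> M)"

definition acyclic_at :: "'a set \<Rightarrow> 'a multiset set \<Rightarrow> ('a \<Rightarrow> 'k::field) list \<Rightarrow> nat \<Rightarrow> bool" where
  "acyclic_at V M fs m = koszul_exact (funs_on M) (map (act V M) fs) m"

lemma act_act:
  assumes "interval_closed M" "\<phi> \<in> funs_on M m" "x \<in> M"
  shows "act V M f (act V M g \<phi>) x = (\<Sum>v\<in>V. \<Sum>u\<in>V. f v * g u * \<phi> (add_mset u (add_mset v x)))"
proof -
  have "f v * act V M g \<phi> (add_mset v x) = (\<Sum>u\<in>V. f v * g u * \<phi> (add_mset u (add_mset v x)))" for v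
  proof (cases "add_mset v x \<in> M")
    case True
    then show ?thesis by (simp add: act_def sum_distrib_left mult.assoc)
  next
    case False
    then have "\<phi> (add_mset u (add_mset v x)) = 0" for u
      using assms unfolding funs_on_def interval_closed_def by blast
    then show ?thesis using False by (simp add: act_def)
  qed
  then show ?thesis using assms(3) by (simp add: act_def[of V M f])
qed

lemma graded_ops_act:
  assumes "interval_closed M"
  shows "graded_ops (funs_on M) (range (act V M))"
proof
  fix x y :: "'a multiset \<Rightarrow> 'b" and m :: nat and f g :: "('a multiset \<Rightarrow> 'b) \<Rightarrow> 'a multiset \<Rightarrow> 'b"
  show "0 \<in> funs_on M m" by (simp add: funs_on_def)
  show "x - y \<in> funs_on M m" if "x \<in> funs_on M m" "y \<in> funs_on M m"
    using that by (auto simp: funs_on_def) (metis diff_self)+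
  assume "f \<in> range (act V M)"
  then obtain f' where f: "f = act V M f'" by auto
  show "f (x - y) = f x - f y"
    by (rule ext) (simp add: f act_def algebra_simps sum_subtractf)
  show "f x \<in> funs_on M m" if "x \<in> funs_on M (Suc m)"
    using that unfolding f funs_on_def act_def
    by (auto split: if_splits elim!: sum.not_neutral_contains_not_neutral)
  assume "g \<in> range (act V M)"
  then obtain g' where g: "g = act V M g'" by auto
  show "f (g x) = g (f x)" if "x \<in> funs_on M m"
  proof
    fix z
    show "f (g x) z = g (f x) z"
    proof (cases "z \<in> M")
      case True
      have "(\<Sum>v\<in>V. \<Sum>u\<in>V. f' v * g' u * x (add_mset u (add_mset v z))) =
            (\<Sum>v\<in>V. \<Sum>u\<in>V. g' v * f' u * x (add_mset u (add_mset v z)))"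
        by (subst sum.swap) (simp add: add_mset_commute mult.commute)
      then show ?thesis
        unfolding f g act_act[OF assms that True] .
    qed (simp add: f g act_def)
  qed
qed

text \<open>\<open>M'\<close> is closed under division inside \<open>M\<close>, so the functions on
  \<open>M'\<close> are a submodule of those on \<open>M\<close>.\<close>

lemma act_mono_lower:
  assumes "\<phi> \<in> funs_on M' m" "M' \<subseteq> M" "\<And>v x. add_mset v x \<in> M' \<Longrightarrow> x \<in> M \<Longrightarrow> x \<in> M'"
  shows "act V M f \<phi> = act V M' f \<phi>"
proof
  fix x
  have "\<phi> (add_mset v x) = 0" if "x \<in> M" "x \<notin> M'" for v
    using assms that unfolding funs_on_def by blast
  then show "act V M f \<phi> x = act V M' f \<phi> x"
    using assms(2) by (auto simp: act_def)
qed

lemma cochains_funs_on_mono: "c \<in> cochains n (funs_on M' m) \<Longrightarrow> M' \<subseteq> M \<Longrightarrow> c \<in> cochains n (funs_on M m)"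
  by (auto simp: cochains_def funs_on_def)

lemma koszul_mono_lower:
  assumes "c \<in> cochains n (funs_on M' m)" "M' \<subseteq> M" "\<And>v x. add_mset v x \<in> M' \<Longrightarrow> x \<in> M \<Longrightarrow> x \<in> M'"
  shows "koszul (map (act V M) fs) c = koszul (map (act V M') fs) c"
proof
  fix bs
  have "c bs \<in> funs_on M' m" for bs
    using assms(1) by (cases "length bs = n") (auto simp: cochains_def funs_on_def)
  then show "koszul (map (act V M) fs) c bs = koszul (map (act V M') fs) c bs"
    using assms(2,3) by (intro koszul_map[where T = "\<lambda>x. x"]) (auto intro!: act_mono_lower[symmetric])
qed

text \<open>Long exact sequence: the functions on \<open>M'\<close> are a submodule, and restriction
  to \<open>M''\<close> is the map onto the quotient.\<close>

lemma acyclic_at_Un: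
  assumes M: "interval_closed M" "M = M' \<union> M''" "M' \<inter> M'' = {}"
    and lower: "\<And>v x. add_mset v x \<in> M' \<Longrightarrow> x \<in> M \<Longrightarrow> x \<in> M'"
    and ex: "acyclic_at V M' fs m" "acyclic_at V M'' fs m"
  shows "acyclic_at V M fs m"
  unfolding acyclic_at_def koszul_exact_def
proof (intro ballI impI)
  interpret graded_ops "funs_on M" "range (act V M)" by (rule graded_ops_act[OF M(1)])
  let ?K = "\<lambda>M. koszul (map (act V M) fs)" and ?n = "length fs"
  have L: "set (map (act V M) fs) \<subseteq> range (act V M)" by auto
  have sub: "M' \<subseteq> M" "M'' \<subseteq> M" using M by auto
  fix c assume "c \<in> cochains (length (map (act V M) fs)) (funs_on M m)" and Dc: "?K M c = (\<lambda>_. 0)"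
  then have c: "c \<in> cochains ?n (funs_on M m)" by simp
  define r where "r = (\<lambda>(\<phi> :: 'a multiset \<Rightarrow> 'b) x. if x \<in> M'' then \<phi> x else 0)"
  have r_act: "r (act V M f \<phi>) = act V M'' f (r \<phi>)" if "\<phi> \<in> funs_on M k" for f \<phi> k
  proof
    fix x
    show "r (act V M f \<phi>) x = act V M'' f (r \<phi>) x"
    proof (cases "x \<in> M''")
      case True
      then have "\<phi> (add_mset v x) = r \<phi> (add_mset v x)" for v
      proof (cases "add_mset v x \<in> M''")
        case False
        have "add_mset v x \<notin> M"
          using False True lower[of v x] M(2,3) by blast
        then show ?thesis using False that by (auto simp: funs_on_def r_def)
      qed (simp add: r_def)
      with True sub show ?thesis by (auto simp: r_def act_def)
    qed (simp add: r_def act_def)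
  qed
  have Kr: "?K M'' (\<lambda>bs. r (d bs)) bs = r (?K M d bs)" if "d \<in> cochains ?n (funs_on M k)" for d k bs
  proof (rule koszul_map[where T = r and c = d])
    show "r (x - y) = r x - r y" for x y by (auto simp: r_def)
    show "r ((map (act V M) fs ! k) (d bs)) = (map (act V M'') fs ! k) (r (d bs))"
      if "k < length (map (act V M) fs)" for k bs
      using that r_act[OF cochains_mem[OF \<open>d \<in> _\<close>]] by simp
  qed simp
  have "(\<lambda>bs. r (c bs)) \<in> cochains ?n (funs_on M'' m)"
    using c by (auto simp: cochains_def funs_on_def r_def)
  moreover have "?K M'' (\<lambda>bs. r (c bs)) = (\<lambda>_. 0)"
  proof
    fix bs
    show "?K M'' (\<lambda>bs. r (c bs)) bs = 0"
      using Kr[OF c, of bs] fun_cong[OF Dc, of bs] by (simp add: r_def fun_eq_iff)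
  qed
  ultimately obtain u'' where u'': "u'' \<in> cochains ?n (funs_on M'' (Suc m))" "?K M'' u'' = (\<lambda>bs. r (c bs))"
    using ex(2) unfolding acyclic_at_def koszul_exact_def by auto
  have u''M: "u'' \<in> cochains ?n (funs_on M (Suc m))"
    using cochains_funs_on_mono u''(1) sub by blast
  \<comment> \<open>Extended by zero, \<open>u''\<close> solves the equation on \<open>M''\<close>;
    the remaining defect \<open>c'\<close> is a cycle supported on \<open>M'\<close>.\<close>
  define c' where "c' = (\<lambda>bs. c bs - ?K M u'' bs)"
  have KuM: "?K M u'' \<in> cochains ?n (funs_on M m)"
    using koszul_mem[OF L] u''M by simp
  have c'M: "c' \<in> cochains ?n (funs_on M m)"
    unfolding c'_def by (rule cochains_diff[OF c KuM])
  have ru: "(\<lambda>bs. r (u'' bs)) = u''"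
  proof (intro ext)
    fix bs x
    show "r (u'' bs) x = u'' bs x"
      using u''(1) by (cases "length bs = ?n") (auto simp: cochains_def funs_on_def r_def)
  qed
  have "r (c' bs) = 0" for bs
  proof -
    have "r (c' bs) = r (c bs) - r (?K M u'' bs)"
      by (auto simp: r_def c'_def)
    also have "r (?K M u'' bs) = r (c bs)"
      using Kr[OF u''M, of bs] u''(2) ru by simp
    finally show ?thesis by (simp add: fun_eq_iff)
  qed
  then have z: "c' bs x = 0" if "x \<in> M''" for bs x
    using that by (metis r_def zero_fun_apply)
  have c'M': "c' \<in> cochains ?n (funs_on M' m)"
  proof -
    have "x \<in> M'" if "c' bs x \<noteq> 0" for bs x
      using cochains_mem[OF c'M, of bs] that z[of x bs] M(2) by (auto simp: funs_on_def)
    then show ?thesis using c'M by (simp add: cochains_def funs_on_def)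
  qed
  have "?K M c' = (\<lambda>_. 0)"
    using koszul_diff'[OF L, of c "?K M u''"] koszul_koszul[OF L, of u'' "Suc m"] u''M Dc
    by (simp add: c'_def)
  then have "?K M' c' = (\<lambda>_. 0)"
    using koszul_mono_lower[OF c'M' sub(1) lower, where fs = fs and V = V] by simp
  then obtain u' where u': "u' \<in> cochains ?n (funs_on M' (Suc m))" "?K M' u' = c'"
    using ex(1) c'M' unfolding acyclic_at_def koszul_exact_def by auto
  have u'M: "u' \<in> cochains ?n (funs_on M (Suc m))"
    using cochains_funs_on_mono u'(1) sub by blast
  have Ku': "?K M u' = c'"
    using koszul_mono_lower[OF u'(1) sub(1) lower, where fs = fs and V = V] u'(2) by simp
  have mem: "(\<lambda>bs. u' bs - (0 - u'' bs)) \<in> cochains ?n (funs_on M (Suc m))"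
    by (rule cochains_diff[OF u'M cochains_diff[OF cochains_zero u''M]])
  moreover have "?K M (\<lambda>bs. u' bs - (0 - u'' bs)) = c"
    using koszul_diff'[OF L, of u' "\<lambda>bs. 0 - u'' bs"] koszul_diff'[OF L, of "\<lambda>_. 0" u'']
      koszul_zero[OF L] Ku' by (simp add: c'_def)
  ultimately show "\<exists>u\<in>cochains (length (map (act V M) fs)) (funs_on M (Suc m)). ?K M u = c"
    by (intro bexI[of _ "\<lambda>bs. u' bs - (0 - u'' bs)"]) simp_all
qed

text \<open>
  The variable \<open>v\<close> acts surjectively with kernel the functions on \<open>N\<close>. Being a combination of the forms,
  it is null-homotopic, so acyclicity of the kernel suffices.
\<close>

lemma acyclic_at_kernel:
  assumes M: "interval_closed M" "finite V" "v \<in> V" "\<And>x. x \<in> M \<Longrightarrow> add_mset v x \<in> M"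
    and N: "N = {x \<in> M. \<forall>y \<in> M. x \<noteq> add_mset v y}"
      "\<And>w x. add_mset w x \<in> N \<Longrightarrow> x \<in> M \<Longrightarrow> x \<in> N"
    and comb: "\<And>\<phi> k x. \<phi> \<in> funs_on M k \<Longrightarrow>
       act V M (\<lambda>u. if u = v then 1 else 0) \<phi> x = (\<Sum>i<length fs. a i * act V M (fs ! i) \<phi> x)"
    and ex: "acyclic_at V N fs m"
  shows "acyclic_at V M fs m"
  unfolding acyclic_at_def koszul_exact_def
proof (intro ballI impI)
  interpret graded_ops "funs_on M" "range (act V M)" by (rule graded_ops_act[OF M(1)])
  let ?K = "\<lambda>M. koszul (map (act V M) fs)" and ?n = "length fs"
  have L: "set (map (act V M) fs) \<subseteq> range (act V M)" by auto
  have sub: "N \<subseteq> M" using N(1) by auto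
  fix c assume "c \<in> cochains (length (map (act V M) fs)) (funs_on M m)" and Dc: "?K M c = (\<lambda>_. 0)"
  then have c: "c \<in> cochains ?n (funs_on M m)" by simp
  let ?X = "act V M (\<lambda>u. if u = v then 1 else 0)"
  have X: "?X \<phi> x = (if x \<in> M then \<phi> (add_mset v x) else 0)" for \<phi> x
  proof -
    have "(\<Sum>u\<in>V. (if u = v then 1 else 0) * \<phi> (add_mset u x)) = \<phi> (add_mset v x)"
      using M(2,3) by (subst sum.mono_neutral_cong_right[of _ "{v}" _ "\<lambda>_. \<phi> (add_mset v x)"]) auto
    then show ?thesis by (simp add: act_def)
  qed
  \<comment> \<open>A right inverse of \<open>?X\<close>, since \<open>M\<close> is closed under
    adding \<open>v\<close>. It need not commute with the forms, so the lift \<open>c'\<close> of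
    \<open>c\<close> need not be a cycle.\<close>
  define s where "s = (\<lambda>(\<phi> :: 'a multiset \<Rightarrow> 'b) x. if v \<in># x \<and> x - {#v#} \<in> M then \<phi> (x - {#v#}) else 0)"
  define c' where "c' = (\<lambda>bs. s (c bs))"
  have s_mem: "s \<phi> \<in> funs_on M (Suc k)" if "\<phi> \<in> funs_on M k" for \<phi> k
    unfolding funs_on_def
  proof (intro CollectI allI impI)
    fix x assume "s \<phi> x \<noteq> 0"
    then have x: "v \<in># x" "x - {#v#} \<in> M" "\<phi> (x - {#v#}) \<noteq> 0" by (auto simp: s_def split: if_splits)
    then show "x \<in> M \<and> size x = Suc k"
      using that M(4)[OF x(2)] by (auto simp: funs_on_def insert_DiffM size_Suc_Diff1)
  qed
  have c': "c' \<in> cochains ?n (funs_on M (Suc m))"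
    using c s_mem unfolding cochains_def c'_def by (auto simp: s_def fun_eq_iff)
  have Xc': "?X (c' bs) = c bs" for bs
  proof
    fix x
    have "c bs x = 0" if "x \<notin> M"
      using cochains_mem[OF c, of bs] that by (auto simp: funs_on_def)
    then show "?X (c' bs) x = c bs x" by (simp add: X c'_def s_def)
  qed
  have K1: "?K M (\<lambda>bs. ?X (d bs)) = (\<lambda>bs. ?X (?K M d bs))" if "d \<in> cochains ?n (funs_on M k)" for d k
    by (rule koszul_op[OF L _ that]) auto
  \<comment> \<open>The defect of \<open>c'\<close>. It is killed by \<open>?X\<close>, hence a
    cycle on \<open>N\<close>; subtracting a preimage \<open>u\<close> there gives a cycle
    \<open>d\<close> that \<open>?X\<close> still maps to \<open>c\<close>.\<close>
  define e where "e = ?K M c'"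
  have e: "e \<in> cochains ?n (funs_on M m)"
    unfolding e_def using koszul_mem[OF L, of c' m] c' by simp
  have Xe: "?X (e bs) = 0" for bs
    using fun_cong[OF K1[OF c'], of bs] Dc Xc' by (simp add: e_def)
  have eN: "e \<in> cochains ?n (funs_on N m)"
  proof -
    have "x \<in> N" if "e bs x \<noteq> 0" for bs x
    proof -
      have "x \<in> M" using cochains_mem[OF e, of bs] that by (auto simp: funs_on_def)
      moreover have "x \<noteq> add_mset v y" if "y \<in> M" for y
        using fun_cong[OF Xe[of bs], of y] that \<open>e bs x \<noteq> 0\<close> by (auto simp: X)
      ultimately show ?thesis by (auto simp: N(1))
    qed
    then show ?thesis using e by (simp add: cochains_def funs_on_def)
  qed
  have "?K M e = (\<lambda>_. 0)"
    unfolding e_def using koszul_koszul[OF L, of c'] c' by simp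
  then have "?K N e = (\<lambda>_. 0)"
    using koszul_mono_lower[OF eN sub N(2), where fs = fs and V = V] by simp
  then obtain u where u: "u \<in> cochains ?n (funs_on N (Suc m))" "?K N u = e"
    using ex eN unfolding acyclic_at_def koszul_exact_def by auto
  have uM: "u \<in> cochains ?n (funs_on M (Suc m))"
    using cochains_funs_on_mono u(1) sub by blast
  have KuM: "?K M u = e"
    using koszul_mono_lower[OF u(1) sub N(2), where fs = fs and V = V] u(2) by simp
  define d where "d = (\<lambda>bs. c' bs - u bs)"
  have d: "d \<in> cochains ?n (funs_on M (Suc m))"
    unfolding d_def by (rule cochains_diff[OF c' uM])
  have Dd: "?K M d = (\<lambda>_. 0)"
    unfolding d_def by (simp add: koszul_diff'[OF L] KuM e_def)
  have Xd: "?X (d bs) = c bs" for bs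
  proof -
    have "u bs (add_mset v x) = 0" if "x \<in> M" for x
      using u(1) that by (cases "length bs = ?n") (auto simp: cochains_def funs_on_def N(1))
    moreover have "?X (d bs) x = ?X (c' bs) x - ?X (u bs) x" for x
      by (simp add: X d_def)
    ultimately show ?thesis using Xc'[of bs] by (auto simp: X fun_eq_iff)
  qed
  \<comment> \<open>On the cycle \<open>d\<close> each form yields a boundary by
    \<open>koszul_null\<close>. Weighted with the coefficients of \<open>?X\<close> these boundaries
    add up to \<open>c\<close>.\<close>
  define h where "h = (\<lambda>i bs x. a i * homotopy i (\<lambda>x. x) d bs x)"
  have hi: "h i \<in> cochains ?n (funs_on M (Suc m))" for i
    using homotopy_cochains[OF d, of "\<lambda>x. x" "Suc m" i]
    by (auto simp: h_def cochains_def funs_on_def fun_eq_iff)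
  have Khi: "?K M (h i) = (\<lambda>bs x. a i * act V M (fs ! i) (d bs) x)" if "i < ?n" for i
  proof
    fix bs
    have "?K M (\<lambda>bs x. a i * homotopy i (\<lambda>x. x) d bs x) bs = (\<lambda>x. a i * ?K M (homotopy i (\<lambda>x. x) d) bs x)"
      by (rule koszul_map[where T = "\<lambda>\<phi> x. a i * \<phi> x"])
        (auto simp: fun_eq_iff algebra_simps act_def sum_distrib_left)
    moreover have "?K M (homotopy i (\<lambda>x. x) d) = (\<lambda>bs. act V M (fs ! i) (d bs))"
      using koszul_null[OF L, of i d "Suc m"] d Dd that by simp
    ultimately show "?K M (h i) bs = (\<lambda>x. a i * act V M (fs ! i) (d bs) x)"
      by (simp add: h_def)
  qed
  have "\<exists>w\<in>cochains ?n (funs_on M (Suc m)). ?K M w = (\<lambda>bs x. \<Sum>i<j. a i * act V M (fs ! i) (d bs) x)"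
    if "j \<le> ?n" for j
    using that
  proof (induction j)
    case 0
    then show ?case using cochains_zero koszul_zero[OF L] by (auto simp: zero_fun_def)
  next
    case (Suc j)
    then obtain w where w: "w \<in> cochains ?n (funs_on M (Suc m))"
      "?K M w = (\<lambda>bs x. \<Sum>i<j. a i * act V M (fs ! i) (d bs) x)" by auto
    show ?case
    proof (rule bexI)
      show "(\<lambda>bs. w bs - (0 - h j bs)) \<in> cochains ?n (funs_on M (Suc m))"
        by (rule cochains_diff[OF w(1) cochains_diff[OF cochains_zero hi]])
      show "?K M (\<lambda>bs. w bs - (0 - h j bs)) = (\<lambda>bs x. \<Sum>i<Suc j. a i * act V M (fs ! i) (d bs) x)"
        using koszul_diff'[OF L, of w "\<lambda>bs. 0 - h j bs"] koszul_diff'[OF L, of "\<lambda>_. 0" "h j"]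
          koszul_zero[OF L] w(2) Khi[of j] Suc.prems by (simp add: fun_eq_iff)
    qed
  qed
  from this[of ?n] obtain w where w: "w \<in> cochains ?n (funs_on M (Suc m))"
    "?K M w = (\<lambda>bs x. \<Sum>i<?n. a i * act V M (fs ! i) (d bs) x)" by auto
  have "(\<Sum>i<?n. a i * act V M (fs ! i) (d bs) x) = c bs x" for bs x
    using comb[OF cochains_mem[OF d], of bs x] Xd[of bs] by simp
  then have "?K M w = c" using w(2) by simp
  with w(1) show "\<exists>u\<in>cochains (length (map (act V M) fs)) (funs_on M (Suc m)). ?K M u = c" by auto
qed

section \<open>Monomials supported on faces, and exactness above the face sizes\<close>

definition face_monomials :: "'a set set \<Rightarrow> 'a multiset set" where
  "face_monomials X = {x. set_mset x \<in> X}"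

lemma interval_closed_face_monomials:
  "(\<And>F G. F \<in> X \<Longrightarrow> G \<subseteq> F \<Longrightarrow> G \<in> X) \<Longrightarrow> interval_closed (face_monomials X)"
  unfolding interval_closed_def face_monomials_def by (auto simp: subset_insertI)

text \<open>The criterion for forms to contain a linear system of parameters of the Stanley--Reisner
  ring: restricted to each face they span all linear forms there.\<close>

definition spans_faces :: "('a \<Rightarrow> 'k::field) list \<Rightarrow> 'a set set \<Rightarrow> bool" where
  "spans_faces fs X \<longleftrightarrow> (\<forall>F\<in>X. \<forall>v\<in>F. \<exists>a. \<forall>u\<in>F. (\<Sum>i<length fs. a i * (fs ! i) u) = (if u = v then 1 else 0))"

text \<open>The monomials with support exactly \<open>F\<close> are a shifted polynomial ring in the
  variables of \<open>F\<close>, and over spanning forms its Koszul homology lives in the degree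
  \<open>card F\<close> of the generator. \<open>D\<close> is the set of variables whose exponent is
  still free; once it is empty only the generator remains, and its degree is below
  \<open>m\<close>.\<close>

lemma acyclic_at_support:
  assumes "finite V" "F \<subseteq> V" "spans_faces fs {F}" "D \<subseteq> F" "card F < m"
  shows "acyclic_at V {x. set_mset x = F \<and> (\<forall>v\<in>F - D. count x v = 1)} fs m"
  using finite_subset[OF assms(4) finite_subset[OF assms(2,1)]] assms(4)
proof (induction D rule: finite_induct)
  case empty
  define M where "M = {x. set_mset x = F \<and> (\<forall>v\<in>F - {}. count x v = 1)}"
  have size: "size x = card F" if "x \<in> M" for x
    using that by (simp add: M_def size_multiset_overloaded_eq)
  have f0: "\<phi> = 0" if "\<phi> \<in> funs_on M m" for \<phi> :: "'a multiset \<Rightarrow> 'b"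
  proof
    fix x
    show "\<phi> x = 0 x"
      using that size[of x] assms(5) by (cases "\<phi> x = 0") (auto simp: funs_on_def)
  qed
  have "interval_closed M"
    unfolding interval_closed_def
  proof (intro allI impI)
    fix x u v assume "x \<in> M" "add_mset u (add_mset v x) \<in> M"
    from this[THEN size] show "add_mset v x \<in> M" by simp
  qed
  then interpret graded_ops "funs_on M :: nat \<Rightarrow> ('a multiset \<Rightarrow> 'b) set" "range (act V M)"
    by (rule graded_ops_act)
  have "koszul_exact (funs_on M) (map (act V M) fs) m"
    unfolding koszul_exact_def
  proof (intro ballI impI)
    fix c :: "bool list \<Rightarrow> 'a multiset \<Rightarrow> 'b"
    assume c: "c \<in> cochains (length (map (act V M) fs)) (funs_on M m)"
    have c0: "(\<lambda>_. 0) = c"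
    proof
      fix bs
      show "0 = c bs" using f0[OF cochains_mem[OF c]] by (rule sym)
    qed
    have "koszul (map (act V M) fs) (\<lambda>_. 0) = (\<lambda>_. 0)"
      by (rule koszul_zero) auto
    note eq = trans[OF this c0]
    show "\<exists>u\<in>cochains (length (map (act V M) fs)) (funs_on M (Suc m)). koszul (map (act V M) fs) u = c"
    proof (rule bexI)
      show "koszul (map (act V M) fs) (\<lambda>_. 0) = c" by (rule eq)
      show "(\<lambda>_. 0 :: 'a multiset \<Rightarrow> 'b) \<in> cochains (length (map (act V M) fs)) (funs_on M (Suc m))"
        by (rule cochains_zero)
    qed
  qed
  then show ?case
    unfolding acyclic_at_def M_def .
next
  case (insert v D)
  let ?M = "{x. set_mset x = F \<and> (\<forall>v\<in>F - insert v D. count x v = 1)}"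
  let ?N = "{x. set_mset x = F \<and> (\<forall>v\<in>F - D. count x v = 1)}"
  have v: "v \<in> F" "v \<notin> D" using insert.hyps insert.prems by auto
  have "\<exists>a. \<forall>u\<in>F. (\<Sum>i<length fs. a i * (fs ! i) u) = (if u = v then 1 else 0)"
    using assms(3) v(1) by (simp add: spans_faces_def)
  then obtain a where a: "\<And>u. u \<in> F \<Longrightarrow> (\<Sum>i<length fs. a i * (fs ! i) u) = (if u = v then 1 else 0)"
    by metis
  show ?case
  proof (rule acyclic_at_kernel[where v = v and a = a and N = ?N])
    show "interval_closed ?M"
      unfolding interval_closed_def
    proof (intro allI impI)
      fix x u w assume x: "x \<in> ?M" and y: "add_mset u (add_mset w x) \<in> ?M"
      show "add_mset w x \<in> ?M"
      proof (intro CollectI conjI ballI)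
        have "set_mset x = F" "set_mset (add_mset u (add_mset w x)) = F" using x y by blast+
        then show "set_mset (add_mset w x) = F" by auto
        fix z assume z: "z \<in> F - insert v D"
        have "count x z \<le> count (add_mset w x) z" "count (add_mset w x) z \<le> count (add_mset u (add_mset w x)) z"
          by auto
        moreover have "count x z = 1" "count (add_mset u (add_mset w x)) z = 1" using x y z by blast+
        ultimately show "count (add_mset w x) z = 1" by linarith
      qed
    qed
    show "?N = {x \<in> ?M. \<forall>y\<in>?M. x \<noteq> add_mset v y}"
    proof (intro set_eqI iffI)
      fix x assume x: "x \<in> ?N"
      have "x \<noteq> add_mset v y" if "y \<in> ?M" for y
      proof
        assume "x = add_mset v y"
        have "v \<in># y" using that v(1) by blast
        then have "count y v \<noteq> 0" by (metis count_eq_zero_iff)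
        moreover have "count x v = Suc (count y v)" using \<open>x = add_mset v y\<close> by simp
        moreover have "count x v = 1" using x v by blast
        ultimately show False by linarith
      qed
      moreover have "x \<in> ?M" using x by blast
      ultimately show "x \<in> {x \<in> ?M. \<forall>y\<in>?M. x \<noteq> add_mset v y}" by blast
    next
      fix x assume x: "x \<in> {x \<in> ?M. \<forall>y\<in>?M. x \<noteq> add_mset v y}"
      have "count x v = 1"
      proof (rule ccontr)
        assume n: "count x v \<noteq> 1"
        have vx: "v \<in># x" using x v(1) by blast
        then have "count x v \<noteq> 0" by (metis count_eq_zero_iff)
        with n have "Suc 0 < count x v" by linarith
        then have "v \<in># x - {#v#}" by (simp add: in_diff_count)
        then have "set_mset (x - {#v#}) = set_mset x"
          using vx by (metis insert_DiffM insert_absorb set_mset_add_mset_insert)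
        moreover have "set_mset x = F" "\<forall>z\<in>F - insert v D. count x z = 1" using x by blast+
        ultimately have "x - {#v#} \<in> ?M" by (simp, blast)
        moreover have "x = add_mset v (x - {#v#})" using vx by simp
        ultimately show False using x by blast
      qed
      then show "x \<in> ?N" using x by blast
    qed
    show "x \<in> ?N" if "add_mset w x \<in> ?N" "x \<in> ?M" for w x
    proof -
      have "count x v \<le> count (add_mset w x) v" by simp
      moreover have "count (add_mset w x) v = 1" using that v by blast
      moreover have "v \<in># x" using that(2) v(1) by blast
      then have "count x v \<noteq> 0" by (metis count_eq_zero_iff)
      ultimately have "count x v = 1" by linarith
      then show ?thesis using that by blast
    qed
    show "add_mset v x \<in> ?M" if "x \<in> ?M" for x using that v by auto
    show "v \<in> V" using v assms by auto
    fix \<phi> :: "'a multiset \<Rightarrow> 'b" and k x assume \<phi>: "\<phi> \<in> funs_on ?M k"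
    show "act V ?M (\<lambda>u. if u = v then 1 else 0) \<phi> x = (\<Sum>i<length fs. a i * act V ?M (fs ! i) \<phi> x)"
    proof (cases "x \<in> ?M")
      case True
      have "(\<Sum>i<length fs. a i * act V ?M (fs ! i) \<phi> x) =
            (\<Sum>u\<in>V. (\<Sum>i<length fs. a i * (fs ! i) u) * \<phi> (add_mset u x))"
        using True by (simp add: act_def sum_distrib_left sum_distrib_right mult.assoc) (rule sum.swap)
      \<comment> \<open>Only the values of the forms on \<open>F\<close> matter, since adding a
        vertex outside \<open>F\<close> changes the support.\<close>
      also have "\<dots> = (\<Sum>u\<in>V. (if u = v then 1 else 0) * \<phi> (add_mset u x))"
      proof (rule sum.cong)
        fix u
        show "(\<Sum>i<length fs. a i * (fs ! i) u) * \<phi> (add_mset u x) = (if u = v then 1 else 0) * \<phi> (add_mset u x)"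
        proof (cases "u \<in> F")
          case False
          then have "add_mset u x \<notin> ?M" by auto
          then have "\<phi> (add_mset u x) = 0" using \<phi> unfolding funs_on_def by blast
          then show ?thesis by simp
        qed (simp add: a)
      qed simp
      finally show ?thesis using True by (simp add: act_def)
    next
      case False
      then have "act V ?M f \<phi> x = 0" for f by (simp only: act_def if_False)
      then show ?thesis by simp
    qed
  qed (rule assms(1), rule insert.IH, use insert.prems in simp)
qed

text \<open>Filtration by support: a face of maximal size can be split off, because its monomials
  divide only monomials with the same support.\<close>

lemma acyclic_at_high:
  assumes "finite V" "finite X" "\<And>F G. F \<in> X \<Longrightarrow> G \<subseteq> F \<Longrightarrow> G \<in> X" "\<And>F. F \<in> X \<Longrightarrow> F \<subseteq> V"
    and "spans_faces fs X" "\<And>F. F \<in> X \<Longrightarrow> card F < m"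
  shows "acyclic_at V (face_monomials X) fs m"
  using assms(2-6)
proof (induction "card X" arbitrary: X)
  case 0
  then have X: "face_monomials X = {}" by (auto simp: face_monomials_def)
  interpret graded_ops "funs_on {} :: nat \<Rightarrow> ('a multiset \<Rightarrow> 'b) set" "range (act V {})"
    by (rule graded_ops_act) (simp add: interval_closed_def)
  have "c = (\<lambda>_. 0)" if "c \<in> cochains n (funs_on {} m)" for n and c :: "bool list \<Rightarrow> 'a multiset \<Rightarrow> 'b"
    using that by (auto simp: cochains_def funs_on_def fun_eq_iff)
  moreover have "koszul (map (act V {}) fs) (\<lambda>_. 0) = (\<lambda>_. 0)"
    by (rule koszul_zero) auto
  ultimately show ?case
    unfolding acyclic_at_def koszul_exact_def X by (metis cochains_zero)
next
  case (Suc k)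
  then have "X \<noteq> {}" by auto
  then have "Max (card ` X) \<in> card ` X" using Suc.prems(1) by (intro Max_in) auto
  then obtain F where "F \<in> X" "card F = Max (card ` X)" by auto
  then have F: "F \<in> X" "\<And>G. G \<in> X \<Longrightarrow> card G \<le> card F"
    using Suc.prems(1) by auto
  let ?S = "{x. set_mset x = F \<and> (\<forall>v\<in>F - F. count x v = 1)}"
  have fin: "finite G" if "G \<in> X" for G using Suc.prems(3)[OF that] assms(1) finite_subset by blast
  have max: "G = F" if "G \<in> X" "F \<subseteq> G" for G
    using card_subset_eq[OF fin[OF that(1)] that(2)] F(2)[OF that(1)] card_mono[OF fin[OF that(1)] that(2)] by simp
  show ?case
  proof (rule acyclic_at_Un)
    show "interval_closed (face_monomials X)"
      using Suc.prems(2) by (rule interval_closed_face_monomials)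
    show "face_monomials X = face_monomials (X - {F}) \<union> ?S"
      using F(1) by (auto simp: face_monomials_def)
    show "face_monomials (X - {F}) \<inter> ?S = {}"
      by (auto simp: face_monomials_def)
    show "x \<in> face_monomials (X - {F})" if "add_mset v x \<in> face_monomials (X - {F})" "x \<in> face_monomials X" for v x
      using that max[of "insert v (set_mset x)"] by (auto simp: face_monomials_def)
    show "acyclic_at V (face_monomials (X - {F})) fs m"
    proof (rule Suc.hyps(1))
      show "k = card (X - {F})" using Suc F by simp
      show "G \<in> X - {F}" if "F' \<in> X - {F}" "G \<subseteq> F'" for F' G
        using that max[of F'] Suc.prems(2)[of F' G] by auto
    qed (use Suc.prems in \<open>auto simp: spans_faces_def\<close>)
    show "acyclic_at V ?S fs m"
      by (rule acyclic_at_support) (use assms(1) Suc.prems F(1) in \<open>auto simp: spans_faces_def\<close>)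
  qed
qed

section \<open>The Koszul complex of the variables\<close>

definition var :: "'a \<Rightarrow> 'a \<Rightarrow> 'k::field" where
  "var v u = (if u = v then 1 else 0)"

definition count_below :: "('a \<Rightarrow> nat) \<Rightarrow> 'a set \<Rightarrow> 'a \<Rightarrow> nat" where
  "count_below pos S v = card {u \<in> S. pos u < pos v}"

text \<open>The simplicial boundary of the induced subcomplex on \<open>W\<close>, with faces
  oriented by \<open>pos\<close>. Functions on sets match the subsets that index the Koszul complex,
  unlike alternating functions on lists.\<close>

definition set_boundary :: "('a \<Rightarrow> nat) \<Rightarrow> 'a set \<Rightarrow> ('a set \<Rightarrow> 'k::field) \<Rightarrow> 'a set \<Rightarrow> 'k" where
  "set_boundary pos W z F = (\<Sum>v\<in>W - F. (-1) ^ count_below pos F v * z (insert v F))"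

definition set_chains :: "'a set set \<Rightarrow> 'a set \<Rightarrow> nat \<Rightarrow> ('a set \<Rightarrow> 'k::field) set" where
  "set_chains X W m = {z. \<forall>F. z F \<noteq> 0 \<longrightarrow> F \<in> X \<and> F \<subseteq> W \<and> card F = m}"

text \<open>Here \<open>m\<close> counts vertices, so this is acyclicity in homological degree
  \<open>m - 1\<close>.\<close>

definition set_acyclic :: "'k::field itself \<Rightarrow> ('a \<Rightarrow> nat) \<Rightarrow> 'a set set \<Rightarrow> 'a set \<Rightarrow> nat \<Rightarrow> bool" where
  "set_acyclic _ pos X W m \<longleftrightarrow>
     (\<forall>z \<in> set_chains X W m. (\<forall>F\<subseteq>W. set_boundary pos W z F = (0::'k)) \<longrightarrow>
        (\<exists>y \<in> set_chains X W (Suc m). \<forall>F\<subseteq>W. set_boundary pos W y F = z F))"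

lemma act_var:
  assumes "finite V" "v \<in> V"
  shows "act V M (var v) \<phi> x = (if x \<in> M then \<phi> (add_mset v x) else 0)"
proof -
  have "(\<Sum>u\<in>V. var v u * \<phi> (add_mset u x)) = (\<Sum>u\<in>{v}. \<phi> (add_mset u x))"
    using assms by (intro sum.mono_neutral_cong_right) (auto simp: var_def)
  then show ?thesis by (simp add: act_def)
qed

text \<open>A partial inverse of the variable \<open>v\<close>. With exponent at least 2 the
  division by \<open>v\<close> does not change the support, hence neither membership in the face
  monomials; this is what makes it commute with the other variables.\<close>

definition shift :: "'a \<Rightarrow> ('a multiset \<Rightarrow> 'k) \<Rightarrow> 'a multiset \<Rightarrow> 'k::field" where
  "shift v \<phi> x = (if 2 \<le> count x v then \<phi> (x - {#v#}) else 0)"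

lemma set_mset_remove1: "2 \<le> count x v \<Longrightarrow> set_mset (x - {#v#}) = set_mset x"
proof -
  assume a: "2 \<le> count x v"
  have "v \<in># x" using a by (metis count_eq_zero_iff not_numeral_le_zero)
  moreover have "v \<in># x - {#v#}" using a by (simp add: in_diff_count)
  ultimately show ?thesis by (metis insert_DiffM insert_absorb set_mset_add_mset_insert)
qed

lemma alt_fun: "alt bs \<phi> x = (-1) ^ count_list bs True * (\<phi> x :: 'k::field)"
  by (simp add: alt_def)

locale variable_koszul =
  fixes V :: "'a set" and vs :: "'a list" and pos :: "'a \<Rightarrow> nat" and X :: "'a set set"
    and K :: "'k::field itself"
  assumes vs: "distinct vs" "set vs = V" and pos: "k < length vs \<Longrightarrow> pos (vs ! k) = k"
    and X_sub: "F \<in> X \<Longrightarrow> F \<subseteq> V" and X_down: "F \<in> X \<Longrightarrow> G \<subseteq> F \<Longrightarrow> G \<in> X"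
begin

abbreviation "M \<equiv> face_monomials X"
abbreviation "vars \<equiv> map var vs :: ('a \<Rightarrow> 'k) list"
definition L :: "(('a multiset \<Rightarrow> 'k) \<Rightarrow> 'a multiset \<Rightarrow> 'k) list" where
  "L = map (act V M) vars"

lemma finite_V: "finite V" using vs by auto

lemma length_L [simp]: "length L = length vs" by (simp add: L_def)

sublocale graded_ops "funs_on M :: nat \<Rightarrow> ('a multiset \<Rightarrow> 'k) set" "range (act V M)"
  by (rule graded_ops_act) (rule interval_closed_face_monomials, rule X_down)

lemma L_sub: "set L \<subseteq> range (act V M)" by (auto simp: L_def)

lemma L_nth: "k < length vs \<Longrightarrow> (L ! k) \<phi> x = (if x \<in> M then \<phi> (add_mset (vs ! k) x) else 0)"
  using act_var[OF finite_V, of "vs ! k" M \<phi> x] nth_mem[of k vs] vs(2) by (simp add: L_def)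

lemma shift_mem:
  assumes "\<phi> \<in> funs_on M m"
  shows "shift v \<phi> \<in> funs_on M (Suc m)"
  unfolding funs_on_def
proof (intro CollectI allI impI)
  fix x assume "shift v \<phi> x \<noteq> 0"
  then have c: "2 \<le> count x v" and n: "\<phi> (x - {#v#}) \<noteq> 0" by (auto simp: shift_def split: if_splits)
  have "v \<in># x" using c by (metis count_eq_zero_iff not_numeral_le_zero)
  then have "size x = Suc (size (x - {#v#}))" by (simp add: size_Suc_Diff1)
  moreover have "x - {#v#} \<in> M" "size (x - {#v#}) = m" using n assms by (auto simp: funs_on_def)
  ultimately show "x \<in> M \<and> size x = Suc m"
    using set_mset_remove1[OF c] by (simp add: face_monomials_def)
qed

lemma shift_L:
  assumes "i < length vs" "vs ! i \<noteq> v"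
  shows "(L ! i) (shift v \<phi>) = shift v ((L ! i) \<phi>)"
proof
  fix x
  have "x \<in> M \<longleftrightarrow> x - {#v#} \<in> M" if "2 \<le> count x v"
    using set_mset_remove1[OF that] by (simp add: face_monomials_def)
  moreover have "add_mset (vs ! i) x - {#v#} = add_mset (vs ! i) (x - {#v#})"
    using assms(2) by (metis diff_add_mset_swap set_mset_single singletonD)
  moreover have "count (add_mset (vs ! i) x) v = count x v"
    using assms(2) by simp
  ultimately show "(L ! i) (shift v \<phi>) x = shift v ((L ! i) \<phi>) x"
    unfolding L_nth[OF assms(1)] shift_def by simp
qed

text \<open>The Koszul complex is graded by multidegree, which multiplies the monomial by the
  variables in the subset. Variable \<open>k\<close> and its \<open>shift\<close> cancel exactly
  where its exponent in the multidegree is at least 2, so Cartan's formula gives the projection onto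
  those multidegrees.\<close>

lemma remove_repeated:
  assumes c: "c \<in> cochains (length vs) (funs_on M m)" "koszul L c = (\<lambda>_. 0)" and k: "k < length vs"
  shows "koszul L (homotopy k (shift (vs ! k)) c) bs x =
           (if 2 \<le> count x (vs ! k) + (if bs ! k then 1 else 0) then c bs x else 0)"
proof (cases "length bs = length vs")
  case True
  let ?v = "vs ! k" and ?S = "shift (vs ! k) :: ('a multiset \<Rightarrow> 'k) \<Rightarrow> _"
  have Sd: "?S (x - y) = ?S x - ?S y" for x y by (rule ext) (simp add: shift_def)
  have "koszul L (homotopy k ?S c) bs + homotopy k ?S (koszul L c) bs =
      (if bs ! k then (L ! k) (?S (c bs)) else ?S ((L ! k) (c bs)))"
  proof (rule koszul_homotopy[where m = m])
    show "set L \<subseteq> range (act V M)" by (rule L_sub)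
    show "k < length L" "c \<in> cochains (length L) (funs_on M m)" "length bs = length L"
      using k c True by simp_all
    show "(L ! i) (?S y) = ?S ((L ! i) y)" if "i < length L" "i \<noteq> k" for i y
      using that k vs(1) by (intro shift_L) (simp_all add: nth_eq_iff_index_eq)
  qed (rule Sd)
  moreover have "homotopy k ?S (\<lambda>_. 0) bs = 0"
    using homotopy_diff[OF Sd, of k "\<lambda>_. 0" "\<lambda>_. 0" bs] by simp
  ultimately have "koszul L (homotopy k ?S c) bs x =
      (if bs ! k then (L ! k) (?S (c bs)) x else ?S ((L ! k) (c bs)) x)"
    using c(2) by simp
  moreover have "(L ! k) (?S (c bs)) x = (if 1 \<le> count x ?v then c bs x else 0)"
  proof -
    have "c bs x = 0" if "x \<notin> M" using cochains_mem[OF c(1), of bs] that by (auto simp: funs_on_def)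
    moreover have "1 \<le> count x ?v \<longleftrightarrow> 2 \<le> count (add_mset ?v x) ?v" by simp
    ultimately show ?thesis unfolding L_nth[OF k] shift_def by (simp del: count_add_mset)
  qed
  moreover have "?S ((L ! k) (c bs)) x = (if 2 \<le> count x ?v then c bs x else 0)"
  proof (cases "2 \<le> count x ?v")
    case t: True
    have "?v \<in># x" using t by (metis count_eq_zero_iff not_numeral_le_zero)
    then have e: "add_mset ?v (x - {#?v#}) = x" by simp
    have "x - {#?v#} \<in> M \<longleftrightarrow> x \<in> M" using set_mset_remove1[OF t] by (simp add: face_monomials_def)
    moreover have "c bs x = 0" if "x \<notin> M" using cochains_mem[OF c(1), of bs] that by (auto simp: funs_on_def)
    ultimately show ?thesis using t e by (simp add: L_nth[OF k] shift_def)
  qed (simp add: shift_def)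
  ultimately show ?thesis by simp
next
  case False
  have "homotopy k (shift (vs ! k)) c \<in> cochains (length vs) (funs_on M (Suc m))"
    by (rule homotopy_cochains[OF c(1) shift_mem]) (auto simp: shift_def fun_eq_iff)
  then have "koszul L (homotopy k (shift (vs ! k)) c) bs = 0"
    using koszul_length'[OF L_sub, of "homotopy k (shift (vs ! k)) c" _ bs] False by simp
  moreover have "c bs = 0" using c(1) False by (auto simp: cochains_def)
  ultimately show ?thesis by simp
qed

text \<open>What is subtracted in each step is a restriction of the current cochain, so repeated
  exponents removed earlier do not come back.\<close>

lemma squarefree_reduction:
  assumes "c \<in> cochains (length vs) (funs_on M m)" "koszul L c = (\<lambda>_. 0)" "k \<le> length vs"
  shows "\<exists>u \<in> cochains (length vs) (funs_on M (Suc m)).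
           \<forall>bs x. c bs x - koszul L u bs x \<noteq> 0 \<longrightarrow> (\<forall>j<k. count x (vs ! j) + (if bs ! j then 1 else 0) < 2)"
  using assms(3)
proof (induction k)
  case 0
  show ?case by (rule bexI[where x = "\<lambda>_. 0"]) (auto intro: cochains_zero)
next
  case (Suc k)
  from Suc.IH[OF Suc_leD[OF Suc.prems]]
  obtain u where u1: "u \<in> cochains (length vs) (funs_on M (Suc m))"
    and u2: "\<forall>bs x. c bs x - koszul L u bs x \<noteq> 0 \<longrightarrow> (\<forall>j<k. count x (vs ! j) + (if bs ! j then 1 else 0) < 2)"
    by (elim bexE)
  note u = u1 u2[rule_format]
  define c' where "c' = (\<lambda>bs. c bs - koszul L u bs)"
  have Ku: "koszul L u \<in> cochains (length vs) (funs_on M m)"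
    using koszul_mem[OF L_sub, of u m] u(1) by simp
  have c': "c' \<in> cochains (length vs) (funs_on M m)"
    unfolding c'_def by (rule cochains_diff[OF assms(1) Ku])
  have Kc': "koszul L c' = (\<lambda>_. 0)"
    using koszul_diff'[OF L_sub, of c "koszul L u"] koszul_koszul[OF L_sub, of u "Suc m"] u(1) assms(2)
    by (simp add: c'_def)
  define h where "h = homotopy k (shift (vs ! k)) c'"
  have h: "h \<in> cochains (length vs) (funs_on M (Suc m))"
    unfolding h_def by (rule homotopy_cochains[OF c' shift_mem]) (auto simp: shift_def fun_eq_iff)
  define w where "w = (\<lambda>bs. u bs - (0 - h bs))"
  have w: "w \<in> cochains (length vs) (funs_on M (Suc m))"
    unfolding w_def by (rule cochains_diff[OF u(1) cochains_diff[OF cochains_zero h]])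
  have "koszul L w = (\<lambda>bs. koszul L u bs + koszul L h bs)"
    using koszul_diff'[OF L_sub, of u "\<lambda>bs. 0 - h bs"] koszul_diff'[OF L_sub, of "\<lambda>_. 0" h] koszul_zero[OF L_sub]
    unfolding w_def by simp
  then have eq: "c bs x - koszul L w bs x = c' bs x - koszul L h bs x" for bs x
    by (simp add: c'_def)
  have "count x (vs ! j) + (if bs ! j then 1 else 0) < 2"
    if "c bs x - koszul L w bs x \<noteq> 0" "j < Suc k" for bs x j
  proof (cases "2 \<le> count x (vs ! k) + (if bs ! k then 1 else 0)")
    case True
    then have "koszul L h bs x = c' bs x"
      using remove_repeated[OF c' Kc', of k bs x] Suc.prems unfolding h_def by simp
    then have "c bs x - koszul L w bs x = 0" using eq[of bs x] by simp
    with that(1) show ?thesis by (rule notE)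
  next
    case False
    then have "koszul L h bs x = 0"
      using remove_repeated[OF c' Kc', of k bs x] Suc.prems unfolding h_def by simp
    then have "c bs x - koszul L u bs x \<noteq> 0"
      using that(1) eq[of bs x] by (simp add: c'_def)
    then show ?thesis using u(2)[of bs x j] False that(2) by (cases "j = k") auto
  qed
  then have "\<forall>bs x. c bs x - koszul L w bs x \<noteq> 0 \<longrightarrow> (\<forall>j<Suc k. count x (vs ! j) + (if bs ! j then 1 else 0) < 2)"
    by (intro allI impI)
  from this w show ?case by (rule bexI)
qed

section \<open>Hochster's formula: squarefree multidegrees and induced subcomplexes\<close>

definition ind :: "'a set \<Rightarrow> bool list" where
  "ind T = map (\<lambda>v. v \<in> T) vs"

lemma length_ind [simp]: "length (ind T) = length vs" by (simp add: ind_def)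

lemma ind_surj: "length bs = length vs \<Longrightarrow> \<exists>T\<subseteq>V. bs = ind T"
proof (intro exI conjI)
  assume l: "length bs = length vs"
  let ?T = "{vs ! k | k. k < length vs \<and> bs ! k}"
  show "?T \<subseteq> V" using vs(2) by auto
  show "bs = ind ?T"
  proof (rule nth_equalityI)
    fix i assume i: "i < length bs"
    then have "vs ! i \<in> ?T \<longleftrightarrow> bs ! i"
      using vs(1) l by (auto simp: nth_eq_iff_index_eq)
    then show "bs ! i = ind ?T ! i" using i l by (simp add: ind_def)
  qed (simp add: l)
qed

lemma count_list_ind:
  assumes "T \<subseteq> V" "k < length vs"
  shows "count_list (take k (ind T)) True = count_below pos T (vs ! k)"
proof -
  have "count_list (take k (ind T)) True = length (filter (\<lambda>v. v \<in> T) (take k vs))"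
    by (simp add: ind_def take_map count_list_eq_length_filter filter_map comp_def)
  also have "\<dots> = card (set (filter (\<lambda>v. v \<in> T) (take k vs)))"
    using vs(1) by (simp add: distinct_card[symmetric])
  also have "set (filter (\<lambda>v. v \<in> T) (take k vs)) = {u \<in> T. pos u < pos (vs ! k)}"
  proof (intro set_eqI iffI)
    fix u assume "u \<in> set (filter (\<lambda>v. v \<in> T) (take k vs))"
    then have "u \<in> T" "\<exists>j<k. u = vs ! j" using assms(2) by (auto simp: in_set_conv_nth)
    then show "u \<in> {u \<in> T. pos u < pos (vs ! k)}" using pos assms(2) by auto
  next
    fix u assume u: "u \<in> {u \<in> T. pos u < pos (vs ! k)}"
    then have "u \<in> set vs" using assms(1) vs(2) by auto
    then obtain j where j: "j < length vs" "u = vs ! j" by (auto simp: in_set_conv_nth)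
    then have "j < k" using u pos assms(2) by auto
    then have "u \<in> set (take k vs)" using j by (auto simp: in_set_conv_nth intro!: exI[of _ j])
    then show "u \<in> set (filter (\<lambda>v. v \<in> T) (take k vs))" using u by auto
  qed
  finally show ?thesis by (simp add: count_below_def)
qed

lemma koszul_ind:
  assumes "T \<subseteq> V" "x \<in> M"
  shows "koszul L c (ind T) x =
           (\<Sum>v\<in>T. (-1) ^ count_below pos T v * c (ind (T - {v})) (add_mset v x))"
proof -
  let ?f = "\<lambda>v. if v \<in> T then (-1) ^ count_below pos T v * c (ind (T - {v})) (add_mset v x) else 0"
  have upd: "(ind T)[k := False] = ind (T - {vs ! k})" if "k < length vs" for k
    using that vs(1)
    by (intro nth_equalityI) (simp_all add: ind_def nth_list_update nth_eq_iff_index_eq)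
  have K: "koszul L c (ind T) = (\<Sum>k<length L. if ind T ! k then alt (take k (ind T)) ((L ! k) (c ((ind T)[k := False]))) else 0)"
    by (rule koszul_sum) simp
  have "koszul L c (ind T) x = (\<Sum>k<length L. (if ind T ! k then alt (take k (ind T)) ((L ! k) (c ((ind T)[k := False]))) else 0) x)"
    unfolding K by (induction rule: infinite_finite_induct) auto
  also have "\<dots> = (\<Sum>k<length vs. ?f (vs ! k))"
  proof (rule sum.cong)
    fix k assume "k \<in> {..<length vs}"
    then have k: "k < length vs" by simp
    show "(if ind T ! k then alt (take k (ind T)) ((L ! k) (c ((ind T)[k := False]))) else 0) x = ?f (vs ! k)"
      using k count_list_ind[OF assms(1) k] L_nth[OF k] upd[OF k] assms(2)
      by (simp add: alt_fun) (simp add: ind_def)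
  qed simp
  also have "\<dots> = (\<Sum>v\<in>V. ?f v)"
    using vs by (intro sum.reindex_bij_betw) (auto simp: bij_betw_def inj_on_nth set_conv_nth)
  also have "\<dots> = (\<Sum>v\<in>T. ?f v)"
    using assms(1) finite_V by (intro sum.mono_neutral_right) auto
  finally show ?thesis by simp
qed

text \<open>Translates between two sign rules: the Koszul sign counts the vertices of
  \<open>W - F\<close> below \<open>v\<close>, the simplicial sign those of \<open>F\<close>, and
  the two counts add up to the count in \<open>W\<close>.\<close>

definition sgn_face :: "'a set \<Rightarrow> 'a set \<Rightarrow> 'k" where
  "sgn_face W F = (\<Prod>v\<in>F. (-1) ^ count_below pos W v)"

lemma sgn_face_square: "sgn_face W F * (sgn_face W F * a) = a"
proof -
  have "sgn_face W F * sgn_face W F = 1"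
    unfolding sgn_face_def prod.distrib[symmetric]
    by (rule prod.neutral) (simp add: power_add[symmetric] flip: mult_2)
  then show ?thesis by (metis mult.assoc mult.left_neutral)
qed

lemma sgn_face_insert:
  assumes "W \<subseteq> V" "F \<subseteq> W" "v \<in> W - F"
  shows "(-1) ^ count_below pos F v * sgn_face W (insert v F) = sgn_face W F * (-1) ^ count_below pos (W - F) v"
proof -
  have fin: "finite W" using assms(1) finite_V finite_subset by auto
  have F: "finite F" using assms(2) fin finite_subset by auto
  have "{u \<in> W. pos u < pos v} = {u \<in> F. pos u < pos v} \<union> {u \<in> W - F. pos u < pos v}"
    using assms(2) by auto
  then have "count_below pos W v = count_below pos F v + count_below pos (W - F) v"
    unfolding count_below_def using fin F by (simp add: card_Un_disjoint disjoint_iff)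
  then have "(-1) ^ count_below pos F v * (-1 :: 'k) ^ count_below pos W v = (-1) ^ count_below pos (W - F) v"
    by (simp add: power_add mult.assoc[symmetric] flip: power_mult_distrib)
  then show ?thesis using assms(3) F by (simp add: sgn_face_def algebra_simps)
qed

text \<open>In a squarefree multidegree \<open>W\<close> a cochain is a function of the support
  \<open>F\<close> of the monomial, the subset being \<open>W - F\<close>. After the sign change
  \<open>sgn_face\<close> the differential is the boundary of the induced subcomplex on
  \<open>W\<close>, so the equation can be solved for each \<open>W\<close> separately.\<close>

lemma squarefree_solution:
  assumes c: "c \<in> cochains (length vs) (funs_on M m)" "koszul L c = (\<lambda>_. 0)"
    and sqf: "\<And>bs x j. c bs x \<noteq> 0 \<Longrightarrow> j < length vs \<Longrightarrow> count x (vs ! j) + (if bs ! j then 1 else 0) < 2"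
    and acyclic: "\<And>W. W \<subseteq> V \<Longrightarrow> set_acyclic K pos X W m"
  shows "\<exists>u \<in> cochains (length vs) (funs_on M (Suc m)). koszul L u = c"
proof -
  have fin: "finite W" if "W \<subseteq> V" for W using that finite_V finite_subset by auto
  define z where "z = (\<lambda>W F. if F \<in> X \<and> F \<subseteq> W \<and> card F = m then sgn_face W F * c (ind (W - F)) (mset_set F) else 0)"
  have ex_y: "\<exists>y. y \<in> set_chains X W (Suc m) \<and> (\<forall>F\<subseteq>W. set_boundary pos W y F = z W F)" if W: "W \<subseteq> V" for W
  proof -
    have "z W \<in> set_chains X W m" by (auto simp: set_chains_def z_def)
    moreover have "set_boundary pos W (z W) F = 0" if F: "F \<subseteq> W" for F
    proof (cases "F \<in> X \<and> Suc (card F) = m")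
      case True
      have finF: "finite F" using F W fin by auto
      have x: "mset_set F \<in> M" using True finF by (simp add: face_monomials_def)
      have "set_boundary pos W (z W) F =
          (\<Sum>v\<in>W - F. sgn_face W F * ((-1) ^ count_below pos (W - F) v * c (ind (W - F - {v})) (add_mset v (mset_set F))))"
        unfolding set_boundary_def
      proof (rule sum.cong)
        fix v assume v: "v \<in> W - F"
        have e: "mset_set (insert v F) = add_mset v (mset_set F)" "W - insert v F = W - F - {v}"
          using v finF by auto
        have "z W (insert v F) = sgn_face W (insert v F) * c (ind (W - F - {v})) (add_mset v (mset_set F))"
        proof (cases "insert v F \<in> X")
          case True
          then show ?thesis using v F finF \<open>F \<in> X \<and> _\<close> e by (auto simp: z_def)
        next
          case False
          then have "add_mset v (mset_set F) \<notin> M" using finF by (simp add: face_monomials_def)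
          then have "c (ind (W - F - {v})) (add_mset v (mset_set F)) = 0"
            using cochains_mem[OF c(1), of "ind (W - F - {v})"] by (auto simp: funs_on_def)
          then show ?thesis using False by (simp add: z_def)
        qed
        then show "(-1) ^ count_below pos F v * z W (insert v F) =
          sgn_face W F * ((-1) ^ count_below pos (W - F) v * c (ind (W - F - {v})) (add_mset v (mset_set F)))"
          using sgn_face_insert[OF W F v] by (metis mult.assoc)
      qed simp
      also have "\<dots> = sgn_face W F * koszul L c (ind (W - F)) (mset_set F)"
        using koszul_ind[of "W - F" "mset_set F" c] x W
        by (simp add: sum_distrib_left subset_iff)
      finally show ?thesis using c(2) by simp
    next
      case False
      have "z W (insert v F) = 0" if "v \<in> W - F" for v
        using that False F fin[OF W] X_down[of "insert v F" F] finite_subset[OF F] by (auto simp: z_def)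
      then show ?thesis by (simp add: set_boundary_def)
    qed
    ultimately show ?thesis using acyclic[OF W] by (simp add: set_acyclic_def Bex_def)
  qed
  define y where "y = (\<lambda>W. SOME y. y \<in> set_chains X W (Suc m) \<and> (\<forall>F\<subseteq>W. set_boundary pos W y F = z W F))"
  have y: "y W \<in> set_chains X W (Suc m)" "F \<subseteq> W \<Longrightarrow> set_boundary pos W (y W) F = z W F" if "W \<subseteq> V" for W F
    using someI_ex[OF ex_y[OF that]] unfolding y_def by simp_all
  define supp where "supp = (\<lambda>bs. {vs ! k | k. k < length vs \<and> bs ! k})"
  have supp_ind: "supp (ind T) = T" if T: "T \<subseteq> V" for T
  proof (intro set_eqI iffI)
    fix x assume "x \<in> T"
    then have "x \<in> set vs" using T vs(2) by auto
    then obtain i where "i < length vs" "x = vs ! i" by (auto simp: in_set_conv_nth)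
    then show "x \<in> supp (ind T)" using \<open>x \<in> T\<close> by (auto simp: supp_def ind_def)
  qed (auto simp: supp_def ind_def)
  \<comment> \<open>The solutions \<open>y W\<close> are put together again. The equation
    \<open>mset_set (set_mset x) = x\<close> says that \<open>x\<close> is squarefree, and with
    disjointness the multidegree is the set \<open>set_mset x \<union> supp bs\<close>.\<close>
  define u where "u = (\<lambda>bs x. if length bs = length vs \<and> mset_set (set_mset x) = x \<and> set_mset x \<inter> supp bs = {}
     \<and> set_mset x \<in> X \<and> size x = Suc m then sgn_face (set_mset x \<union> supp bs) (set_mset x) * y (set_mset x \<union> supp bs) (set_mset x) else 0)"
  have u: "u \<in> cochains (length vs) (funs_on M (Suc m))"
    by (auto simp: cochains_def funs_on_def u_def face_monomials_def fun_eq_iff)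
  have "koszul L u bs x = c bs x" for bs x
  proof (cases "length bs = length vs \<and> x \<in> M")
    case False
    then have "koszul L u bs x = 0"
      using koszul_length'[OF L_sub, of u _ bs] u cochains_mem[OF koszul_mem[OF L_sub, of u m], of bs]
      by (auto simp: funs_on_def)
    moreover have "c bs x = 0"
      using False c(1) cochains_mem[OF c(1), of bs] by (auto simp: funs_on_def cochains_def)
    ultimately show ?thesis by simp
  next
    case True
    then obtain T where T: "T \<subseteq> V" "bs = ind T" using ind_surj[of bs] by auto
    have x: "x \<in> M" using True by simp
    let ?F = "set_mset x"
    have F: "?F \<in> X" "?F \<subseteq> V" using x X_sub by (auto simp: face_monomials_def)
    have Ku: "koszul L u bs x = (\<Sum>v\<in>T. (-1) ^ count_below pos T v * u (ind (T - {v})) (add_mset v x))"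
      unfolding T(2) by (rule koszul_ind[OF T(1) x])
    show ?thesis
    proof (cases "mset_set ?F = x \<and> ?F \<inter> T = {} \<and> size x = m")
      case sq: True
      define W where "W = ?F \<union> T"
      have W: "W \<subseteq> V" "?F \<subseteq> W" "W - ?F = T" using F T(1) sq by (auto simp: W_def)
      have cardF: "card ?F = m" using sq by (metis size_mset_set)
      have "(-1) ^ count_below pos T v * u (ind (T - {v})) (add_mset v x) =
          sgn_face W ?F * ((-1) ^ count_below pos ?F v * y W (insert v ?F))" if v: "v \<in> T" for v
      proof -
        have vF: "v \<notin> ?F" using v sq by auto
        have sI: "set_mset (add_mset v x) \<union> supp (ind (T - {v})) = W"
          using supp_ind[of "T - {v}"] T(1) v by (auto simp: W_def)
        have "mset_set (insert v ?F) = add_mset v (mset_set ?F)" using vF by simp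
        then have sq': "mset_set (set_mset (add_mset v x)) = add_mset v x" using sq by simp
        have dj: "set_mset (add_mset v x) \<inter> supp (ind (T - {v})) = {}"
          using supp_ind[of "T - {v}"] T(1) sq by auto
        have "u (ind (T - {v})) (add_mset v x) = sgn_face W (insert v ?F) * y W (insert v ?F)"
        proof (cases "insert v ?F \<in> X")
          case True
          have "u (ind (T - {v})) (add_mset v x) =
            sgn_face (set_mset (add_mset v x) \<union> supp (ind (T - {v}))) (set_mset (add_mset v x)) *
            y (set_mset (add_mset v x) \<union> supp (ind (T - {v}))) (set_mset (add_mset v x))"
            unfolding u_def using sq' dj True sq by (intro if_P) auto
          then show ?thesis unfolding sI by simp
        next
          case False
          then have "y W (insert v ?F) = 0" using y(1)[OF W(1)] by (auto simp: set_chains_def)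
          then show ?thesis using False by (simp add: u_def)
        qed
        moreover have "(-1) ^ count_below pos T v * sgn_face W (insert v ?F) = sgn_face W ?F * (-1) ^ count_below pos ?F v"
        proof -
          have a: "(-1) ^ count_below pos ?F v * sgn_face W (insert v ?F) = sgn_face W ?F * (-1) ^ count_below pos T v"
            using sgn_face_insert[OF W(1,2), of v] v vF by (simp add: W)
          have sq1: "(-1 :: 'k) ^ n * ((-1) ^ n * b) = b" for n b
            by (simp add: mult.assoc[symmetric] flip: power_mult_distrib)
          have "sgn_face W (insert v ?F) = (-1) ^ count_below pos ?F v * (sgn_face W ?F * (-1) ^ count_below pos T v)"
            unfolding a[symmetric] sq1 ..
          then show ?thesis using sq1[of "count_below pos T v"] by (simp add: mult.left_commute mult.commute)
        qed
        ultimately show ?thesis by (simp only: mult.assoc[symmetric])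
      qed
      then have "koszul L u bs x = sgn_face W ?F * set_boundary pos W (y W) ?F"
        unfolding Ku by (simp add: set_boundary_def W(3) sum_distrib_left)
      also have "\<dots> = sgn_face W ?F * z W ?F" using y(2)[OF W(1,2)] by simp
      also have "\<dots> = c bs x"
        using F W sq cardF sgn_face_square T(2) by (simp add: z_def)
      finally show ?thesis .
    next
      case nsq: False
      have "u (ind (T - {v})) (add_mset v x) = 0" if v: "v \<in> T" for v
      proof (rule ccontr)
        assume "u (ind (T - {v})) (add_mset v x) \<noteq> 0"
        then have a: "mset_set (set_mset (add_mset v x)) = add_mset v x" "set_mset (add_mset v x) \<inter> supp (ind (T - {v})) = {}"
          "size (add_mset v x) = Suc m"
          by (auto simp: u_def split: if_splits)
        have cnt: "count (add_mset v x) w \<le> 1" for w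
          using a(1) by (metis count_mset_set' le_numeral_extra(4) zero_le_one)
        have "count x v = 0" using cnt[of v] by simp
        then have vF: "v \<notin> ?F" by (simp add: count_eq_zero_iff)
        have "mset_set (set_mset (add_mset v x)) = add_mset v (mset_set ?F)" using vF by simp
        then have "mset_set ?F = x" using a(1) by simp
        moreover have "?F \<inter> T = {}" using a(2) supp_ind[of "T - {v}"] T(1) vF by auto
        ultimately show False using nsq a(3) by simp
      qed
      then have "koszul L u bs x = 0" unfolding Ku by simp
      moreover have "c bs x = 0"
      proof (rule ccontr)
        assume n: "c bs x \<noteq> 0"
        then have sz: "size x = m" using cochains_mem[OF c(1), of bs] by (auto simp: funs_on_def)
        have cnt: "count x v + (if v \<in> T then 1 else 0) < 2" if "v \<in> V" for v
        proof -
          obtain j where j: "j < length vs" "v = vs ! j" using \<open>v \<in> V\<close> vs(2) by (auto simp: in_set_conv_nth)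
          then show ?thesis using sqf[OF n, of j] T(2) by (simp add: ind_def)
        qed
        have "?F \<inter> T = {}"
        proof (rule ccontr)
          assume "?F \<inter> T \<noteq> {}"
          then obtain v where v: "v \<in># x" "v \<in> T" by auto
          have "count x v \<noteq> 0" using v(1) by (metis count_eq_zero_iff)
          moreover have "v \<in> V" using v(2) T(1) by (rule subsetD[rotated])
          then have "count x v + 1 < 2" using cnt[of v] v(2) by (simp only: if_True)
          ultimately show False by linarith
        qed
        moreover have "mset_set ?F = x"
        proof (rule multiset_eqI)
          fix v
          show "count (mset_set ?F) v = count x v"
          proof (cases "v \<in># x")
            case True
            then have "count x v \<noteq> 0" by (metis count_eq_zero_iff)
            moreover have "count x v < 2" using cnt[of v] True F by (metis add_lessD1 subsetD)
            ultimately have "count x v = 1" by linarith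
            then show ?thesis using True by simp
          qed (simp add: not_in_iff)
        qed
        ultimately show False using nsq sz by simp
      qed
      ultimately show ?thesis by simp
    qed
  qed
  then have "koszul L u = c" by (intro ext)
  from this u show ?thesis by (rule bexI)
qed

lemma acyclic_at_vars:
  assumes "\<And>W. W \<subseteq> V \<Longrightarrow> set_acyclic K pos X W m"
  shows "acyclic_at V M vars m"
  unfolding acyclic_at_def koszul_exact_def L_def[symmetric]
proof (intro ballI impI)
  fix c assume "c \<in> cochains (length L) (funs_on M m)" and Kc: "koszul L c = (\<lambda>_. 0)"
  then have c: "c \<in> cochains (length vs) (funs_on M m)" by simp
  from squarefree_reduction[OF c Kc order_refl]
  obtain u where u1: "u \<in> cochains (length vs) (funs_on M (Suc m))"
    and u2: "\<forall>bs x. c bs x - koszul L u bs x \<noteq> 0 \<longrightarrow> (\<forall>j<length vs. count x (vs ! j) + (if bs ! j then 1 else 0) < 2)"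
    by (elim bexE)
  note u = u1 u2[rule_format]
  define c' where "c' = (\<lambda>bs. c bs - koszul L u bs)"
  have Ku: "koszul L u \<in> cochains (length vs) (funs_on M m)"
    using koszul_mem[OF L_sub, of u m] u(1) by simp
  have c': "c' \<in> cochains (length vs) (funs_on M m)"
    unfolding c'_def by (rule cochains_diff[OF c Ku])
  have Kc': "koszul L c' = (\<lambda>_. 0)"
    using koszul_diff'[OF L_sub, of c "koszul L u"] koszul_koszul[OF L_sub, of u "Suc m"] u(1) Kc
    by (simp add: c'_def)
  have sqf: "count x (vs ! j) + (if bs ! j then 1 else 0) < 2" if "c' bs x \<noteq> 0" "j < length vs" for bs x j
    using u(2)[of bs x j] that by (simp add: c'_def)
  have "\<exists>w \<in> cochains (length vs) (funs_on M (Suc m)). koszul L w = c'"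
    by (rule squarefree_solution[OF c' Kc']) (rule sqf, assumption+, rule assms)
  then obtain w where w: "w \<in> cochains (length vs) (funs_on M (Suc m))" "koszul L w = c'"
    by (elim bexE)
  show "\<exists>u\<in>cochains (length L) (funs_on M (Suc m)). koszul L u = c"
  proof (rule bexI)
    show "koszul L (\<lambda>bs. u bs - (0 - w bs)) = c"
      using koszul_diff'[OF L_sub, of u "\<lambda>bs. 0 - w bs"] koszul_diff'[OF L_sub, of "\<lambda>_. 0" w] koszul_zero[OF L_sub] w(2)
      by (simp add: c'_def)
    show "(\<lambda>bs. u bs - (0 - w bs)) \<in> cochains (length L) (funs_on M (Suc m))"
      using cochains_diff[OF u(1) cochains_diff[OF cochains_zero w(1)]] by simp
  qed
qed

end

section \<open>Leray complexes\<close>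

text \<open>The sign of the permutation that sorts the list by \<open>pos\<close>, computed from its
  inversions.\<close>

fun list_sgn :: "('a \<Rightarrow> nat) \<Rightarrow> 'a list \<Rightarrow> 'k::field" where
  "list_sgn pos [] = 1"
| "list_sgn pos (v # xs) = (-1) ^ count_below pos (set xs) v * list_sgn pos xs"

lemma list_sgn_square: "list_sgn pos xs * (list_sgn pos xs * a) = (a :: 'k::field)"
proof (induction xs arbitrary: a)
  case (Cons v xs)
  have "(-1 :: 'k) ^ n * ((-1) ^ n * b) = b" for n b
    by (simp add: mult.assoc[symmetric] flip: power_mult_distrib)
  then show ?case using Cons by (simp add: mult.assoc mult.left_commute)
qed simp

lemma list_sgn_swap:
  assumes "distinct (xs @ u # v # ys)" "pos u \<noteq> pos v"
  shows "list_sgn pos (xs @ u # v # ys) = - (list_sgn pos (xs @ v # u # ys) :: 'k::field)"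
  using assms
proof (induction xs)
  case Nil
  have "count_below pos (insert v (set ys)) u = count_below pos (set ys) u + (if pos v < pos u then 1 else 0)"
    if "v \<notin> set ys" for u v
  proof -
    have "{w \<in> insert v (set ys). pos w < pos u} =
        (if pos v < pos u then insert v {w \<in> set ys. pos w < pos u} else {w \<in> set ys. pos w < pos u})"
      by auto
    then show ?thesis using that by (simp add: count_below_def)
  qed
  then show ?case using Nil by (auto simp: algebra_simps)
next
  case (Cons x xs)
  have "set (xs @ u # v # ys) = set (xs @ v # u # ys)" by auto
  then show ?case using Cons by (simp del: set_append)
qed

text \<open>Adjacent transpositions generate all rearrangements. It is applied to an alternating
  function times \<open>list_sgn\<close>, which therefore depends only on the set of
  entries.\<close>

lemma symmetric_list_fun:
  assumes "\<And>xs u v ys. g (xs @ u # v # ys) = g (xs @ v # u # ys)" "mset xs = mset ys"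
  shows "g xs = g ys"
  using assms
proof (induction xs arbitrary: g ys)
  case (Cons v xs)
  have front: "g (as @ v # bs) = g (v # as @ bs)" for as bs
  proof (induction as arbitrary: bs rule: rev_induct)
    case (snoc a as)
    have "g (as @ a # v # bs) = g (as @ v # a # bs)" by (rule Cons.prems(1))
    then show ?case using snoc[of "a # bs"] by simp
  qed simp
  have "v \<in> set ys" using Cons.prems(2) by (metis list.set_intros(1) set_mset_mset)
  then obtain as bs where ys: "ys = as @ v # bs" by (meson split_list)
  have "g (v # xs) = g (v # as @ bs)"
  proof (rule Cons.IH[where g = "\<lambda>l. g (v # l)"])
    show "g (v # xs @ u # w # ys) = g (v # xs @ w # u # ys)" for xs u w ys
      using Cons.prems(1)[of "v # xs"] by simp
    show "mset xs = mset (as @ bs)" using Cons.prems(2) ys by simp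
  qed
  then show ?case using front ys by simp
qed simp

text \<open>The only homology class is the set of boundaries, and a cycle belongs to its own class
  because 0 is a boundary.\<close>

lemma Leray_cycle_boundary:
  assumes "Leray TYPE('k::field) d V X" "d \<le> p" "W \<subseteq> V"
    and "(c :: 'a list \<Rightarrow> 'k) \<in> simplicial_cycles (induced_subcomplex X W) p"
  shows "c \<in> simplicial_boundaries (induced_subcomplex X W) p"
proof -
  let ?Y = "induced_subcomplex X W"
  let ?R = "{(c, d). c \<in> simplicial_cycles ?Y p \<and> d \<in> simplicial_cycles ?Y p \<and>
                (\<lambda>xs. c xs - d xs) \<in> (simplicial_boundaries ?Y p :: ('a list \<Rightarrow> 'k) set)}"
  have "(reduced_homology ?Y p :: ('a list \<Rightarrow> 'k) set set) = {simplicial_boundaries ?Y p}"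
    using assms(1-3) unfolding Leray_def by blast
  moreover have "?R `` {c} \<in> reduced_homology ?Y p"
    unfolding reduced_homology_def using assms(4) by (rule quotientI)
  ultimately have "?R `` {c} = simplicial_boundaries ?Y p" by simp
  moreover have "(\<lambda>_. 0) \<in> (simplicial_boundaries ?Y p :: ('a list \<Rightarrow> 'k) set)"
    unfolding simplicial_boundaries_def
    by (rule image_eqI[where x = "\<lambda>_. 0"]) (auto simp: simplicial_boundary_def simplicial_chains_def)
  then have "c \<in> ?R `` {c}" using assms(4) by simp
  ultimately show ?thesis by simp
qed

text \<open>Multiplication by \<open>list_sgn\<close> turns functions on sets into alternating
  functions on lists and back, and \<open>list_sgn (v # xs)\<close> differs from
  \<open>list_sgn xs\<close> by the sign in \<open>set_boundary\<close>. A face of dimension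
  \<open>p\<close> has \<open>Suc p\<close> vertices, which explains the shift.\<close>

lemma Leray_set_acyclic:
  assumes L: "Leray TYPE('k::field) 2 V X"
    and X: "\<And>F. F \<in> X \<Longrightarrow> F \<subseteq> V" "\<And>v. v \<in> V \<Longrightarrow> {v} \<in> X" and fin: "finite V"
    and pos: "inj_on pos V" and W: "W \<subseteq> V" and p: "2 \<le> p"
    and z: "(z :: 'a set \<Rightarrow> 'k) \<in> set_chains X W (Suc p)"
      "\<And>F. F \<subseteq> W \<Longrightarrow> set_boundary pos W z F = 0"
  shows "\<exists>y \<in> set_chains X W (Suc (Suc p)). \<forall>F\<subseteq>W. set_boundary pos W y F = z F"
proof -
  let ?Y = "induced_subcomplex X W"
  have UY: "\<Union>?Y = W" using X W by (auto simp: induced_subcomplex_def)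
  have finW: "finite W" using W fin finite_subset by auto
  define c where "c = (\<lambda>xs. if distinct xs \<and> set xs \<subseteq> W then list_sgn pos xs * z (set xs) else 0)"
  have bd: "(\<Sum>v\<in>W. if v \<in> F then 0 else f v) = (\<Sum>v\<in>W - F. f v)" for F and f :: "'a \<Rightarrow> 'k"
    using finW by (simp add: sum.If_cases Diff_eq)
  have "c \<in> simplicial_chains ?Y p"
    unfolding simplicial_chains_def
  proof (intro CollectI conjI allI impI)
    fix xs assume "c xs \<noteq> 0"
    then have "distinct xs" "set xs \<subseteq> W" "z (set xs) \<noteq> 0" by (auto simp: c_def split: if_splits)
    moreover from this(3) have "set xs \<in> X" "card (set xs) = Suc p"
      using z(1) by (auto simp: set_chains_def)
    ultimately show "length xs = p + 1" "distinct xs" "set xs \<in> ?Y"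
      by (simp_all add: induced_subcomplex_def distinct_card)
  next
    fix xs u v ys
    show "c (xs @ u # v # ys) = - c (xs @ v # u # ys)"
    proof (cases "distinct (xs @ u # v # ys) \<and> set (xs @ u # v # ys) \<subseteq> W")
      case True
      then have "pos u \<noteq> pos v" using pos W by (auto dest: inj_onD)
      moreover have "set (xs @ u # v # ys) = set (xs @ v # u # ys)" by auto
      moreover have "distinct (xs @ v # u # ys)" using True by auto
      ultimately show ?thesis
        using True list_sgn_swap[of xs u v ys pos, where 'k = 'k] unfolding c_def by simp
    next
      case False
      moreover have "distinct (xs @ u # v # ys) = distinct (xs @ v # u # ys)" by auto
      moreover have "set (xs @ u # v # ys) = set (xs @ v # u # ys)" by auto
      ultimately show ?thesis unfolding c_def by (simp only: if_False) simp
    qed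
  qed
  moreover have "simplicial_boundary ?Y c xs = 0" for xs
  proof (cases "distinct xs \<and> set xs \<subseteq> W")
    case True
    have "simplicial_boundary ?Y c xs =
        (\<Sum>v\<in>W. if v \<in> set xs then 0 else list_sgn pos xs * ((-1) ^ count_below pos (set xs) v * z (insert v (set xs))))"
      unfolding simplicial_boundary_def UY by (rule sum.cong) (use True in \<open>auto simp: c_def\<close>)
    also have "\<dots> = list_sgn pos xs * set_boundary pos W z (set xs)"
      unfolding bd set_boundary_def by (simp add: sum_distrib_left)
    finally show ?thesis using z(2) True by simp
  next
    case False
    then show ?thesis unfolding simplicial_boundary_def by (intro sum.neutral) (auto simp: c_def)
  qed
  ultimately have "c \<in> simplicial_cycles ?Y p" by (simp add: simplicial_cycles_def fun_eq_iff)
  from Leray_cycle_boundary[OF L p W this]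
  obtain w where "c = simplicial_boundary ?Y w" "w \<in> simplicial_chains ?Y (p + 1)"
    unfolding simplicial_boundaries_def by (rule imageE)
  note w = this(2,1)
  have w_supp: "length xs = Suc (Suc p) \<and> distinct xs \<and> set xs \<in> X \<and> set xs \<subseteq> W" if "w xs \<noteq> 0" for xs
  proof -
    have "length xs = p + 1 + 1 \<and> distinct xs \<and> set xs \<in> ?Y"
      using w(1) that unfolding simplicial_chains_def by blast
    then show ?thesis by (simp add: induced_subcomplex_def)
  qed
  have w_alt: "w (xs @ u # v # ys) = - w (xs @ v # u # ys)" for xs u v ys
    using w(1) unfolding simplicial_chains_def by blast
  have sym: "list_sgn pos (xs @ u # v # ys) * w (xs @ u # v # ys) =
      list_sgn pos (xs @ v # u # ys) * w (xs @ v # u # ys)" for xs u v ys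
  proof (cases "w (xs @ u # v # ys) = 0")
    case True
    then show ?thesis using w_alt[of xs u v ys] by simp
  next
    case False
    then have d: "distinct (xs @ u # v # ys)" "set (xs @ u # v # ys) \<subseteq> W"
      using w_supp by blast+
    then have "pos u \<noteq> pos v" using pos W by (auto dest: inj_onD)
    then show ?thesis using list_sgn_swap[OF d(1), where 'k = 'k] w_alt[of xs u v ys] by simp
  qed
  define y where "y = (\<lambda>F. if finite F then let l = (SOME l. set l = F \<and> distinct l) in list_sgn pos l * w l else 0)"
  have y: "y (set xs) = list_sgn pos xs * w xs" if "distinct xs" for xs
  proof -
    define l where "l = (SOME l. set l = set xs \<and> distinct l)"
    have "set l = set xs \<and> distinct l"
      unfolding l_def by (rule someI[where x = xs]) (simp add: that)
    then have "mset l = mset xs" using that by (metis set_eq_iff_mset_eq_distinct)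
    then have "list_sgn pos l * w l = list_sgn pos xs * w xs"
      using sym by (rule symmetric_list_fun[where g = "\<lambda>l. list_sgn pos l * w l", rotated])
    then show ?thesis by (simp add: y_def l_def)
  qed
  have mem: "y \<in> set_chains X W (Suc (Suc p))"
    unfolding set_chains_def
  proof (intro CollectI allI impI)
    fix F assume n: "y F \<noteq> 0"
    then have "finite F" by (auto simp: y_def split: if_splits)
    then obtain xs where xs: "set xs = F" "distinct xs" using finite_distinct_list by auto
    then have "w xs \<noteq> 0" using n y[of xs] by auto
    then show "F \<in> X \<and> F \<subseteq> W \<and> card F = Suc (Suc p)"
      using w_supp[of xs] xs by (auto simp: distinct_card)
  qed
  have "set_boundary pos W y F = z F" if F: "F \<subseteq> W" for F
  proof -
    have "finite F" using F finW finite_subset by auto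
    then obtain xs where xs: "set xs = F" "distinct xs" using finite_distinct_list by auto
    have "set_boundary pos W y F = (\<Sum>v\<in>W - F. list_sgn pos xs * w (v # xs))"
      unfolding set_boundary_def
    proof (rule sum.cong)
      fix v assume v: "v \<in> W - F"
      have "y (insert v F) = list_sgn pos (v # xs) * w (v # xs)"
        using y[of "v # xs"] xs v by simp
      moreover have "(-1 :: 'k) ^ n * ((-1) ^ n * b) = b" for n b
        by (simp add: mult.assoc[symmetric] flip: power_mult_distrib)
      ultimately show "(-1) ^ count_below pos F v * y (insert v F) = list_sgn pos xs * w (v # xs)"
        by (simp add: xs mult.assoc)
    qed simp
    also have "\<dots> = list_sgn pos xs * (\<Sum>v\<in>W - F. w (v # xs))" by (simp add: sum_distrib_left)
    also have "(\<Sum>v\<in>W - F. w (v # xs)) = (\<Sum>v\<in>W. w (v # xs))"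
    proof (rule sum.mono_neutral_left)
      show "\<forall>v\<in>W - (W - F). w (v # xs) = 0"
        using w_supp[of "_ # xs"] xs by auto
    qed (use finW in auto)
    also have "\<dots> = c xs" unfolding w(2) simplicial_boundary_def UY ..
    also have "\<dots> = list_sgn pos xs * z F" using xs F by (simp add: c_def)
    finally show ?thesis by (simp add: list_sgn_square)
  qed
  then have "\<forall>F\<subseteq>W. set_boundary pos W y F = z F" by blast
  from this mem show ?thesis by (rule bexI)
qed

lemma fls_nth_set_boundary:
  "fls_nth (set_boundary pos W z F) i = set_boundary pos W (\<lambda>F. fls_nth (z F) i) F"
proof -
  have "fls_nth ((-1) ^ n * a) i = (-1) ^ n * fls_nth a i" for n and a :: "'a fls"
    by (cases "even n") auto
  then show ?thesis by (simp add: set_boundary_def fls_nth_sum)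
qed

text \<open>The coefficientwise argument makes the scalars infinite while keeping acyclicity.\<close>

lemma Leray_set_acyclic_fls:
  assumes L: "Leray TYPE('k::field) 2 V X"
    and X: "\<And>F. F \<in> X \<Longrightarrow> F \<subseteq> V" "\<And>v. v \<in> V \<Longrightarrow> {v} \<in> X" and fin: "finite V"
    and pos: "inj_on pos V" and W: "W \<subseteq> V" and m: "3 \<le> m"
  shows "set_acyclic TYPE('k fls) pos X W m"
  unfolding set_acyclic_def
proof (intro ballI impI)
  fix z :: "'a set \<Rightarrow> 'k fls"
  assume z: "z \<in> set_chains X W m" "\<forall>F\<subseteq>W. set_boundary pos W z F = 0"
  have finW: "finite W" using W fin finite_subset by auto
  obtain p where p: "m = Suc p" "2 \<le> p" using m by (cases m) auto
  have ex: "\<exists>y. y \<in> set_chains X W (Suc m) \<and> (\<forall>F\<subseteq>W. set_boundary pos W y F = fls_nth (z F) i)" for i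
  proof -
    have zi: "(\<lambda>F. fls_nth (z F) i) \<in> set_chains X W (Suc p)"
      unfolding set_chains_def
    proof (intro CollectI allI impI)
      fix F assume "fls_nth (z F) i \<noteq> 0"
      then have "z F \<noteq> 0" by auto
      then show "F \<in> X \<and> F \<subseteq> W \<and> card F = Suc p" using z(1) p(1) unfolding set_chains_def by blast
    qed
    have "set_boundary pos W (\<lambda>F. fls_nth (z F) i) F = 0" if "F \<subseteq> W" for F
      using z(2) that by (simp flip: fls_nth_set_boundary)
    from Leray_set_acyclic[OF L X fin pos W p(2) zi this] show ?thesis
      unfolding p(1) Bex_def .
  qed
  \<comment> \<open>The preimages chosen for the single exponents form a Laurent series only if they
    vanish below some exponent. Below \<open>N\<close>, the least order over the finitely many
    subsets, the coefficients of \<open>z\<close> vanish and zero is chosen.\<close>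
  define N where "N = Min ((\<lambda>F. fls_subdegree (z F)) ` Pow W)"
  have N: "fls_nth (z F) i = 0" if "i < N" for F i
  proof (cases "F \<subseteq> W")
    case True
    then have "N \<le> fls_subdegree (z F)" unfolding N_def using finW by (intro Min_le) auto
    then show ?thesis using that by (simp add: fls_eq0_below_subdegree)
  next
    case False
    then have "z F = 0" using z(1) by (auto simp: set_chains_def)
    then show ?thesis by simp
  qed
  define y where "y = (\<lambda>i. if i < N then (\<lambda>_. 0) else
    (SOME y. y \<in> set_chains X W (Suc m) \<and> (\<forall>F\<subseteq>W. set_boundary pos W y F = fls_nth (z F) i)))"
  have y: "y i \<in> set_chains X W (Suc m)" "F \<subseteq> W \<Longrightarrow> set_boundary pos W (y i) F = fls_nth (z F) i" for i F
  proof -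
    have "y i \<in> set_chains X W (Suc m) \<and> (\<forall>F\<subseteq>W. set_boundary pos W (y i) F = fls_nth (z F) i)"
    proof (cases "i < N")
      case True
      then show ?thesis by (simp add: y_def N) (simp add: set_chains_def set_boundary_def)
    next
      case False
      then have e: "y i = (SOME y. y \<in> set_chains X W (Suc m) \<and> (\<forall>F\<subseteq>W. set_boundary pos W y F = fls_nth (z F) i))"
        by (simp add: y_def)
      show ?thesis unfolding e by (rule someI_ex[OF ex[of i]])
    qed
    then show "y i \<in> set_chains X W (Suc m)" "F \<subseteq> W \<Longrightarrow> set_boundary pos W (y i) F = fls_nth (z F) i" by blast+
  qed
  define Y where "Y = (\<lambda>F. Abs_fls (\<lambda>i. y i F))"
  have Y: "fls_nth (Y F) i = y i F" for F i
    unfolding Y_def by (rule nth_Abs_fls_lower_bound[of N]) (simp add: y_def)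
  show "\<exists>y\<in>set_chains X W (Suc m). \<forall>F\<subseteq>W. set_boundary pos W y F = z F"
  proof (intro bexI[of _ Y] allI impI)
    show "set_boundary pos W Y F = z F" if "F \<subseteq> W" for F
      by (rule fls_eqI) (simp add: fls_nth_set_boundary Y y(2)[OF that])
    have "F \<in> X \<and> F \<subseteq> W \<and> card F = Suc m" if n: "Y F \<noteq> 0" for F
    proof -
      obtain i where "y i F \<noteq> 0" using n Y by (metis fls_eqI fls_zero_nth)
      then show ?thesis using y(1)[of i] by (auto simp: set_chains_def)
    qed
    then show "Y \<in> set_chains X W (Suc m)" by (simp add: set_chains_def)
  qed
qed

section \<open>Vanishing in degree three and the triangle count\<close>

lemma spans_faces_append: "spans_faces fs X \<Longrightarrow> spans_faces (gs @ fs) X"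
  unfolding spans_faces_def
proof (intro ballI)
  fix F v assume a: "\<forall>F\<in>X. \<forall>v\<in>F. \<exists>a. \<forall>u\<in>F. (\<Sum>i<length fs. a i * (fs ! i) u) = (if u = v then 1 else 0)"
    "F \<in> X" "v \<in> F"
  from bspec[OF bspec[OF a(1,2)] a(3)]
  have "\<exists>a. \<forall>u\<in>F. (\<Sum>i<length fs. a i * (fs ! i) u) = (if u = v then 1 else 0)" .
  then obtain a where a: "\<forall>u\<in>F. (\<Sum>i<length fs. a i * (fs ! i) u) = (if u = v then 1 else 0)" ..
  define a' where "a' = (\<lambda>i. if i < length gs then 0 else a (i - length gs))"
  have "(\<Sum>i<length (gs @ fs). a' i * ((gs @ fs) ! i) u) = (\<Sum>i<length fs. a i * (fs ! i) u)" for u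
  proof -
    have "(\<Sum>i<length (gs @ fs). a' i * ((gs @ fs) ! i) u) =
       (\<Sum>i\<in>{length gs..<length gs + length fs}. a' i * ((gs @ fs) ! i) u)"
      by (rule sum.mono_neutral_right) (auto simp: a'_def)
    also have "\<dots> = (\<Sum>i\<in>{0..<length fs}. a' (i + length gs) * ((gs @ fs) ! (i + length gs)) u)"
      using sum.shift_bounds_nat_ivl[of "\<lambda>i. a' i * ((gs @ fs) ! i) u" 0 "length gs" "length fs"]
      by (simp add: add.commute)
    finally show ?thesis by (simp add: a'_def nth_append lessThan_atLeast0)
  qed
  then have "\<forall>u\<in>F. (\<Sum>i<length (gs @ fs). a' i * ((gs @ fs) ! i) u) = (if u = v then 1 else 0)"
    using a by simp
  then show "\<exists>a. \<forall>u\<in>F. (\<Sum>i<length (gs @ fs). a i * ((gs @ fs) ! i) u) = (if u = v then 1 else 0)"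
    by (rule exI[where x = a'])
qed

context variable_koszul
begin

text \<open>Regularity can be computed from any forms over which the ring is finite. All forms are
  appended to the variables, which are then dropped from the front. For each dropped variable the
  degree descends from \<open>Suc (card V)\<close>; exactness there needs the surviving list to span
  on the faces, and its tail \<open>fs\<close> ensures this.\<close>

lemma acyclic_at_forms:
  fixes fs :: "('a \<Rightarrow> 'k) list"
  assumes acyclic: "\<And>W m. W \<subseteq> V \<Longrightarrow> 3 \<le> m \<Longrightarrow> set_acyclic K pos X W m"
    and spans: "spans_faces fs X"
  shows "3 \<le> m \<Longrightarrow> acyclic_at V M (drop j vars @ fs) m"
proof (induction j arbitrary: m)
  case 0
  have "koszul_exact (funs_on M) (L @ map (act V M) fs) m"
  proof (rule koszul_exact_append)
    show "set (L @ map (act V M) fs) \<subseteq> range (act V M)" by (auto simp: L_def)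
    have "acyclic_at V M vars m" using acyclic[OF _ 0] by (rule acyclic_at_vars)
    then show "koszul_exact (funs_on M) L m" by (simp add: acyclic_at_def L_def)
  qed
  then show ?case by (simp add: acyclic_at_def L_def)
next
  case (Suc j)
  show ?case
  proof (cases "j < length vars")
    case False
    then show ?thesis using Suc.IH[OF Suc.prems] by simp
  next
    case True
    let ?fs = "drop (Suc j) vars @ fs"
    have X: "finite X" using X_sub finite_V by (meson Pow_iff finite_Pow_iff finite_subset subsetI)
    have step: "acyclic_at V M ?fs k" if "3 \<le> k" "acyclic_at V M ?fs (Suc k)" for k
    proof -
      have "koszul_exact (funs_on M) (map (act V M) ?fs) k"
      proof (rule koszul_exact_remove[where f = "act V M (vars ! j)"])
        show "set (act V M (vars ! j) # map (act V M) ?fs) \<subseteq> range (act V M)" by auto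
        have "act V M (vars ! j) # map (act V M) ?fs = map (act V M) (drop j vars @ fs)"
          using True by (simp add: Cons_nth_drop_Suc[symmetric])
        then show "koszul_exact (funs_on M) (act V M (vars ! j) # map (act V M) ?fs) k"
          using Suc.IH[OF that(1)] by (simp only: acyclic_at_def)
        show "koszul_exact (funs_on M) (map (act V M) ?fs) (Suc k)"
          using that(2) by (simp only: acyclic_at_def)
      qed
      then show ?thesis by (simp only: acyclic_at_def)
    qed
    have high: "acyclic_at V M ?fs k" if "card V < k" for k
    proof (rule acyclic_at_high)
      show "card F < k" if "F \<in> X" for F
        using card_mono[OF finite_V X_sub[OF that]] \<open>card V < k\<close> by simp
      show "spans_faces ?fs X" using spans by (rule spans_faces_append)
    qed (use X finite_V X_sub X_down in blast)+
    have "3 \<le> k \<Longrightarrow> acyclic_at V M ?fs k" if "k \<le> Suc (card V)" for k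
      using that
    proof (induction k rule: inc_induct)
      case base
      show ?case by (rule high) simp
    next
      case (step n)
      then show ?case using \<open>\<And>k. 3 \<le> k \<Longrightarrow> acyclic_at V M ?fs (Suc k) \<Longrightarrow> acyclic_at V M ?fs k\<close>[of n] by simp
    qed
    then show ?thesis using high[of m] Suc.prems by (cases "m \<le> Suc (card V)") auto
  qed
qed

text \<open>Dually, the quotient of the Stanley--Reisner ring by the forms vanishes in degree three.\<close>

lemma degree_3_vanishing:
  fixes fs :: "('a \<Rightarrow> 'k) list"
  assumes acyclic: "\<And>W m. W \<subseteq> V \<Longrightarrow> 3 \<le> m \<Longrightarrow> set_acyclic K pos X W m"
    and spans: "spans_faces fs X"
    and \<phi>: "\<phi> \<in> funs_on M 3" "\<And>f. f \<in> set fs \<Longrightarrow> act V M f \<phi> = 0"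
  shows "\<phi> = 0"
proof -
  let ?L = "map (act V M) fs"
  have L: "set ?L \<subseteq> range (act V M)" by auto
  have ex: "koszul_exact (funs_on M) ?L 3"
    using acyclic_at_forms[OF acyclic spans order_refl, of "length vars"] by (simp add: acyclic_at_def)
  \<comment> \<open>A function killed by all forms is a cycle at the empty subset \<open>r\<close>,
    where every boundary vanishes.\<close>
  define r where "r = replicate (length fs) False"
  define c where "c = (\<lambda>bs. if bs = r then \<phi> else 0)"
  have c: "c \<in> cochains (length ?L) (funs_on M 3)"
    using \<phi>(1) zero by (auto simp: c_def r_def cochains_def)
  have "koszul ?L c bs = 0" for bs
  proof (cases "length bs = length ?L")
    case True
    have "koszul ?L c bs = (\<Sum>k<length ?L. if bs ! k then alt (take k bs) ((?L ! k) (c (bs[k := False]))) else 0)"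
      by (rule koszul_sum[OF True])
    also have "\<dots> = 0"
    proof (rule sum.neutral, intro ballI)
      fix k assume "k \<in> {..<length ?L}"
      then have k: "k < length fs" by simp
      have "act V M (fs ! k) 0 = 0" by (rule op_zero) auto
      then have "(?L ! k) (c (bs[k := False])) = 0"
        using \<phi>(2)[OF nth_mem[OF k]] k by (simp add: c_def)
      then show "(if bs ! k then alt (take k bs) ((?L ! k) (c (bs[k := False]))) else 0) = 0"
        by (simp add: alt_def)
    qed
    finally show ?thesis .
  next
    case False
    then show ?thesis by (rule koszul_length'[OF L c])
  qed
  then have "koszul ?L c = (\<lambda>_. 0)" by (rule ext)
  then have "\<exists>u\<in>cochains (length ?L) (funs_on M (Suc 3)). koszul ?L u = c"
    using ex c unfolding koszul_exact_def by blast
  then obtain u where u: "koszul ?L u = c" by (elim bexE)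
  have "koszul ?L u r = (\<Sum>k<length ?L. if r ! k then alt (take k r) ((?L ! k) (u (r[k := False]))) else 0)"
    by (rule koszul_sum) (simp add: r_def)
  also have "\<dots> = 0" by (rule sum.neutral) (simp add: r_def)
  finally show ?thesis using u by (simp add: c_def)
qed

end

section \<open>Linear algebra, interpolation and counting of pairs\<close>

lemma exists_nonzero_solution_matrix:
  fixes A :: "'i \<Rightarrow> 'b \<Rightarrow> 'k::field"
  assumes "finite I" "finite S" "card I < card S"
  shows "\<exists>\<phi>. (\<exists>s. \<phi> s \<noteq> 0) \<and> (\<forall>s. \<phi> s \<noteq> 0 \<longrightarrow> s \<in> S) \<and> (\<forall>i\<in>I. (\<Sum>s\<in>S. A i s * \<phi> s) = 0)"
  using assms
proof (induction I arbitrary: A S rule: finite_induct)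
  case empty
  then obtain s where s: "s \<in> S" by fastforce
  show ?case by (rule exI[where x = "\<lambda>t. if t = s then 1 else 0"]) (use s in auto)
next
  case (insert i I)
  show ?case
  proof (cases "\<forall>s\<in>S. A i s = 0")
    case True
    have "\<exists>\<phi>. (\<exists>s. \<phi> s \<noteq> 0) \<and> (\<forall>s. \<phi> s \<noteq> 0 \<longrightarrow> s \<in> S) \<and> (\<forall>i\<in>I. (\<Sum>s\<in>S. A i s * \<phi> s) = 0)"
      using insert by (intro insert.IH) auto
    then obtain \<phi> where "(\<exists>s. \<phi> s \<noteq> 0) \<and> (\<forall>s. \<phi> s \<noteq> 0 \<longrightarrow> s \<in> S) \<and> (\<forall>i\<in>I. (\<Sum>s\<in>S. A i s * \<phi> s) = 0)" ..
    then show ?thesis using True by (intro exI[where x = \<phi>]) simp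
  next
    case False
    then obtain b where b: "b \<in> S" "A i b \<noteq> 0" by auto
    let ?S = "S - {b}"
    \<comment> \<open>Gaussian elimination: equation \<open>i\<close> expresses the unknown at
      \<open>b\<close> through the others.\<close>
    define A' where "A' = (\<lambda>j s. A j s - A j b * A i s / A i b)"
    have "\<exists>\<phi>. (\<exists>s. \<phi> s \<noteq> 0) \<and> (\<forall>s. \<phi> s \<noteq> 0 \<longrightarrow> s \<in> ?S) \<and> (\<forall>i\<in>I. (\<Sum>s\<in>?S. A' i s * \<phi> s) = 0)"
      using insert b by (intro insert.IH) auto
    then obtain \<phi> where "(\<exists>s. \<phi> s \<noteq> 0) \<and> (\<forall>s. \<phi> s \<noteq> 0 \<longrightarrow> s \<in> ?S) \<and> (\<forall>i\<in>I. (\<Sum>s\<in>?S. A' i s * \<phi> s) = 0)" ..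
    note \<phi> = this[THEN conjunct1] this[THEN conjunct2, THEN conjunct1] this[THEN conjunct2, THEN conjunct2]
    define t where "t = (\<Sum>s\<in>?S. A i s * \<phi> s)"
    define \<psi> where "\<psi> = \<phi>(b := - t / A i b)"
    have sum: "(\<Sum>s\<in>S. A j s * \<psi> s) = - A j b * t / A i b + (\<Sum>s\<in>?S. A j s * \<phi> s)" for j
      using sum.remove[OF insert.prems(1) b(1), of "\<lambda>s. A j s * \<psi> s"] by (simp add: \<psi>_def)
    have "(\<Sum>s\<in>S. A j s * \<psi> s) = 0" if "j \<in> insert i I" for j
    proof (cases "j = i")
      case True
      then show ?thesis using b(2) sum[of i] by (simp add: t_def)
    next
      case False
      have "(\<Sum>s\<in>?S. A' j s * \<phi> s) = (\<Sum>s\<in>?S. A j s * \<phi> s) - A j b / A i b * t"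
        unfolding t_def sum_distrib_left sum_subtractf[symmetric]
        by (rule sum.cong) (simp_all add: A'_def algebra_simps)
      then show ?thesis using \<phi>(3) that False sum[of j] by simp
    qed
    moreover have "\<exists>s. \<psi> s \<noteq> 0" using \<phi>(1,2) by (auto simp: \<psi>_def)
    moreover have "\<forall>s. \<psi> s \<noteq> 0 \<longrightarrow> s \<in> S" using \<phi>(2) b(1) by (auto simp: \<psi>_def)
    ultimately show ?thesis by (intro exI[where x = \<psi>] conjI ballI)
  qed
qed

lemma exists_nonzero_solution:
  fixes g :: "'i \<Rightarrow> 'c \<Rightarrow> 'k::field"
  assumes "finite I" "finite S" "finite V" "card I < card S"
  shows "\<exists>\<phi>. (\<exists>s. \<phi> s \<noteq> 0) \<and> (\<forall>s. \<phi> s \<noteq> 0 \<longrightarrow> s \<in> S) \<and> (\<forall>i\<in>I. (\<Sum>v\<in>V. g i v * \<phi> (h i v)) = 0)"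
proof -
  \<comment> \<open>Different \<open>v\<close> may give the same \<open>h i v\<close>, so their
    coefficients are collected in one matrix entry.\<close>
  let ?A = "\<lambda>i s. \<Sum>v\<in>V. if h i v = s then g i v else 0"
  from exists_nonzero_solution_matrix[OF assms(1,2,4), of ?A]
  obtain \<phi> where "(\<exists>s. \<phi> s \<noteq> 0) \<and> (\<forall>s. \<phi> s \<noteq> 0 \<longrightarrow> s \<in> S) \<and> (\<forall>i\<in>I. (\<Sum>s\<in>S. ?A i s * \<phi> s) = 0)" ..
  note \<phi> = this[THEN conjunct1] this[THEN conjunct2, THEN conjunct1] this[THEN conjunct2, THEN conjunct2]
  have "(\<Sum>s\<in>S. ?A i s * \<phi> s) = (\<Sum>v\<in>V. g i v * \<phi> (h i v))" for i
  proof -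
    have "(\<Sum>s\<in>S. ?A i s * \<phi> s) = (\<Sum>v\<in>V. \<Sum>s\<in>S. (if h i v = s then g i v else 0) * \<phi> s)"
      by (subst sum.swap) (simp add: sum_distrib_right)
    also have "\<dots> = (\<Sum>v\<in>V. g i v * \<phi> (h i v))"
    proof (rule sum.cong)
      fix v
      have "(\<Sum>s\<in>S. (if h i v = s then g i v else 0) * \<phi> s) = (\<Sum>s\<in>S. if h i v = s then g i v * \<phi> s else 0)"
        by (rule sum.cong) auto
      also have "\<dots> = g i v * \<phi> (h i v)" using \<phi>(2) assms(2) by (auto simp: sum.delta')
      finally show "(\<Sum>s\<in>S. (if h i v = s then g i v else 0) * \<phi> s) = g i v * \<phi> (h i v)" .
    qed simp
    finally show ?thesis .
  qed
  then show ?thesis using \<phi> by (intro exI[where x = \<phi>]) simp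
qed

text \<open>The coefficients of the Lagrange basis polynomial at \<open>p\<close>. Hence any
  \<open>w\<close> points of the moment curve in dimension \<open>w\<close> are independent.\<close>

lemma lagrange_form:
  fixes a :: "'a \<Rightarrow> 'k::field"
  assumes "finite P" "inj_on a P" "p \<in> P" "card P \<le> w"
  shows "\<exists>g. \<forall>u\<in>P. (\<Sum>i<w. g i * a u ^ i) = (if u = p then 1 else 0)"
proof -
  define f where "f = (\<Prod>q\<in>P - {p}. smult (inverse (a p - a q)) [:- a q, 1:])"
  have "degree f \<le> (\<Sum>q\<in>P - {p}. degree (smult (inverse (a p - a q)) [:- a q, 1:]))"
    unfolding f_def using degree_prod_sum_le[of "P - {p}" "\<lambda>q. smult (inverse (a p - a q)) [:- a q, 1:]"] assms(1)
    by (simp add: comp_def)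
  also have "\<dots> \<le> (\<Sum>q\<in>P - {p}. 1)" by (rule sum_mono) (simp add: degree_smult_le)
  also have "\<dots> < w" using assms(1,3,4) card_gt_0_iff[of P] by (auto simp: card_Diff_singleton)
  finally have deg: "degree f < w" .
  have poly: "(\<Sum>i<w. coeff f i * x ^ i) = poly f x" for x
    unfolding poly_altdef using deg by (intro sum.mono_neutral_right) (auto simp: coeff_eq_0)
  have "poly f (a u) = (if u = p then 1 else 0)" if "u \<in> P" for u
  proof (cases "u = p")
    case True
    have ne: "a p - a q \<noteq> 0" if "q \<in> P - {p}" for q
      using assms(2,3) that by (auto dest: inj_onD)
    have "poly (smult (inverse (a p - a q)) [:- a q, 1:]) (a u) = 1" if "q \<in> P - {p}" for q
    proof -
      have "poly (smult (inverse (a p - a q)) [:- a q, 1:]) (a u) = inverse (a p - a q) * (a p - a q)"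
        unfolding poly_smult using True by simp
      then show ?thesis using ne[OF that] by simp
    qed
    then show ?thesis using True unfolding f_def poly_prod by (simp add: prod.neutral)
  next
    case False
    then show ?thesis using that assms(1) by (auto simp: f_def poly_prod intro!: prod_zero bexI[of _ u])
  qed
  then show ?thesis by (intro exI[where x = "coeff f"]) (simp add: poly)
qed

lemma card_ordered_pairs:
  assumes "finite P" "inj_on pos P"
  shows "2 * card {(p, q). p \<in> P \<and> q \<in> P \<and> pos p \<le> (pos q :: nat)} = card P * Suc (card P)"
proof -
  let ?A = "{(p, q). p \<in> P \<and> q \<in> P \<and> pos p \<le> pos q}"
  let ?B = "{(p, q). p \<in> P \<and> q \<in> P \<and> pos q \<le> pos p}"
  have fin: "finite ?A" "finite ?B" using assms(1) by (auto intro: finite_subset[of _ "P \<times> P"])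
  have "?B = prod.swap ` ?A" by (auto simp: image_iff)
  then have "card ?B = card ?A" by (simp add: card_image inj_on_def)
  moreover have "?A \<union> ?B = P \<times> P" by auto
  moreover have "?A \<inter> ?B = (\<lambda>p. (p, p)) ` P"
    using inj_onD[OF assms(2)] by (fastforce simp: image_iff)
  then have "card (?A \<inter> ?B) = card P" by (simp add: card_image inj_on_def)
  ultimately show ?thesis using card_Un_Int[OF fin] by (simp add: card_cartesian_product)
qed

lemma pair_mset_eq:
  assumes "{#u, u, v#} = {#u', u', v'#}" "u \<noteq> v"
  shows "u = u' \<and> v = v'"
proof -
  have "u = u'"
    using arg_cong[OF assms(1), of "\<lambda>x. count x u"] assms(2) by (auto split: if_splits)
  then show ?thesis using assms(1) by simp
qed

context variable_koszul
begin

text \<open>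
  If there were fewer functionals than monomials of degree three, some \<open>\<phi> \<noteq> 0\<close> would satisfy them all.
  Going through the vertices from last to first, the symmetry of \<open>(f, g) \<mapsto> f \<cdot> (g \<cdot> \<phi>)\<close> then forces all
  \<open>f \<cdot> \<phi>\<close> to vanish.
\<close>

lemma triangle_count:
  fixes a :: "'a \<Rightarrow> 'k" and E :: "'a set set" and w :: nat
  assumes G: "simple_graph V E" and X: "X = cliques V E" and a: "inj_on a V"
    and acyclic: "\<And>W m. W \<subseteq> V \<Longrightarrow> 3 \<le> m \<Longrightarrow> set_acyclic K pos X W m"
    and w: "\<And>F. F \<in> X \<Longrightarrow> card F \<le> w"
  defines "N k \<equiv> {u \<in> set (take k vs). {u, vs ! k} \<in> E}"
  shows "2 * (card (triangles V E) + length vs + 2 * (\<Sum>k<length vs. card (N k))) \<le>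
    (\<Sum>k<length vs. 2 * (w * (Suc (card (N k)) - min w (Suc (card (N k))))) +
       min w (Suc (card (N k))) * Suc (min w (Suc (card (N k)))))"
proof -
  let ?n = "length vs"
  have V_nth: "vs ! k \<in> V" if "k < ?n" for k using that vs(2) by auto
  have N_V: "N k \<subseteq> V" for k using vs(2) set_take_subset[of k vs] by (auto simp: N_def)
  have N_pos: "pos u < k" if "k < ?n" "u \<in> N k" for u k
    using that pos by (auto simp: N_def in_set_conv_nth)
  have finN: "finite (N k)" for k by (simp add: N_def)
  have inj_pos: "inj_on pos V"
  proof (rule inj_onI)
    fix x y assume "x \<in> V" "y \<in> V" and e: "pos x = pos y"
    then obtain i j where "i < ?n" "x = vs ! i" "j < ?n" "y = vs ! j"
      using vs(2) by (metis in_set_conv_nth)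
    then show "x = y" using e pos by metis
  qed
  \<comment> \<open>Each face monomial of degree two is \<open>{#u, vs ! k#}\<close> for exactly one
    \<open>k\<close> and one \<open>u\<close> in \<open>C k\<close>, where \<open>k\<close> belongs
    to the later vertex.\<close>
  define C where "C k = insert (vs ! k) (N k)" for k
  have C_V: "C k \<subseteq> V" if "k < ?n" for k using that N_V V_nth by (auto simp: C_def)
  have finC: "finite (C k)" for k by (simp add: C_def finN)
  have cardC: "card (C k) = Suc (card (N k))" if "k < ?n" for k
  proof -
    have "vs ! k \<notin> N k" using N_pos[OF that, of "vs ! k"] pos[OF that] by auto
    then show ?thesis by (simp add: C_def finN)
  qed
  have "\<exists>P\<subseteq>C k. card P = min w (card (C k))" for k
    by (metis min.cobounded2 obtain_subset_with_card_n)
  then have "\<forall>k. \<exists>P. P \<subseteq> C k \<and> card P = min w (card (C k))" by blast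
  from choice[OF this] obtain P where P: "\<And>k. P k \<subseteq> C k" "\<And>k. card (P k) = min w (card (C k))" by blast
  have P_V: "P k \<subseteq> V" if "k < ?n" for k using P(1) C_V[OF that] by blast
  have finP: "finite (P k)" for k using P(1) finC finite_subset by blast
  define form where "form g v = (\<Sum>i<w. g i * a v ^ i)" for g :: "nat \<Rightarrow> 'k" and v
  define lag where "lag k p = (SOME g. \<forall>u\<in>P k. form g u = (if u = p then 1 else 0))" for k p
  have lag: "form (lag k p) u = (if u = p then 1 else 0)" if "k < ?n" "p \<in> P k" "u \<in> P k" for k p u
  proof -
    have "\<exists>g. \<forall>u\<in>P k. form g u = (if u = p then 1 else 0)"
      unfolding form_def using inj_on_subset[OF a P_V[OF that(1)]] P(2)[of k] that(2) finP
      by (intro lagrange_form) auto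
    from someI_ex[OF this] show ?thesis using that(3) unfolding lag_def by blast
  qed
  \<comment> \<open>Outside \<open>P k\<close> all \<open>w\<close> forms are required to vanish. On
    \<open>P k\<close> the interpolating forms are a dual basis, and the symmetry of the bilinear
    form makes one condition per unordered pair enough; this gives the summand
    \<open>min w b' * Suc (min w b')\<close> of the doubled count, with \<open>b'\<close> the size
    of \<open>C k\<close>.\<close>
  define I1 where "I1 = (SIGMA k:{..<?n}. {..<w} \<times> (C k - P k))"
  define I2 where "I2 = (SIGMA k:{..<?n}. {(p, q). p \<in> P k \<and> q \<in> P k \<and> pos p \<le> pos q})"
  define I where "I = I1 <+> I2"
  have fin2: "finite {(p, q). p \<in> P k \<and> q \<in> P k \<and> pos p \<le> pos q}" for k
    by (rule finite_subset[of _ "P k \<times> P k"]) (auto simp: finP)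
  have finI: "finite I1" "finite I2" by (auto simp: I1_def I2_def finC fin2)
  have card1: "card I1 = (\<Sum>k<?n. w * (card (C k) - card (P k)))"
    unfolding I1_def using finC finP P(1) by (subst card_SigmaI) (auto simp: card_cartesian_product card_Diff_subset)
  have card2: "2 * card I2 = (\<Sum>k<?n. card (P k) * Suc (card (P k)))"
    unfolding I2_def using fin2
    by (subst card_SigmaI) (auto simp: sum_distrib_left card_ordered_pairs[OF finP inj_on_subset[OF inj_pos P_V]])
  have cardI: "2 * card I = (\<Sum>k<?n. 2 * (w * (card (C k) - card (P k))) + card (P k) * Suc (card (P k)))"
    unfolding I_def card_Plus[OF finI] by (simp add: card1 card2 distrib_left sum.distrib sum_distrib_left)
  \<comment> \<open>The face monomials of degree three by size of support: cubes, two monomials for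
    each edge, and triangles.\<close>
  define S1 where "S1 = (\<lambda>v. {#v, v, v#}) ` V"
  define S2 where "S2 = (\<lambda>(k, u). {#u, u, vs ! k#}) ` Sigma {..<?n} N"
  define S3 where "S3 = (\<lambda>(k, u). {#vs ! k, vs ! k, u#}) ` Sigma {..<?n} N"
  define S4 where "S4 = mset_set ` triangles V E"
  have tri: "T \<subseteq> V" "card T = 3" "finite T" "T \<in> X" if "T \<in> triangles V E" for T
    using that finite_V finite_subset[of T V] by (auto simp: triangles_def cliques_def X)
  have fin_tri: "finite (triangles V E)"
    using tri(1) finite_V by (meson Pow_iff finite_Pow_iff finite_subset subsetI)
  have nth_inj: "k = k'" if "k < ?n" "k' < ?n" "vs ! k = vs ! k'" for k k'
    using that vs(1) by (simp add: nth_eq_iff_index_eq)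
  have N_ne: "u \<noteq> vs ! k" if "k < ?n" "u \<in> N k" for u k
    using N_pos[OF that] pos[OF that(1)] by auto
  have c1: "card S1 = ?n"
    unfolding S1_def by (subst card_image) (auto simp: inj_on_def vs(2)[symmetric] distinct_card[OF vs(1)] dest: arg_cong[where f = set_mset])
  have c2: "card S2 = (\<Sum>k<?n. card (N k))"
  proof -
    have "inj_on (\<lambda>(k, u). {#u, u, vs ! k#}) (Sigma {..<?n} N)"
    proof (rule inj_onI, clarify)
      fix k u k' u' assume a: "k < ?n" "u \<in> N k" "k' < ?n" "u' \<in> N k'" "{#u, u, vs ! k#} = {#u', u', vs ! k'#}"
      then show "k = k' \<and> u = u'" using pair_mset_eq[OF a(5)] N_ne nth_inj by blast
    qed
    then show ?thesis unfolding S2_def by (simp add: card_image finN)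
  qed
  have c3: "card S3 = (\<Sum>k<?n. card (N k))"
  proof -
    have "inj_on (\<lambda>(k, u). {#vs ! k, vs ! k, u#}) (Sigma {..<?n} N)"
    proof (rule inj_onI, clarify)
      fix k u k' u' assume a: "k < ?n" "u \<in> N k" "k' < ?n" "u' \<in> N k'" "{#vs ! k, vs ! k, u#} = {#vs ! k', vs ! k', u'#}"
      then show "k = k' \<and> u = u'" using pair_mset_eq[OF a(5)] N_ne nth_inj by metis
    qed
    then show ?thesis unfolding S3_def by (simp add: card_image finN)
  qed
  have c4: "card S4 = card (triangles V E)"
    unfolding S4_def by (rule card_image, rule inj_onI) (metis tri(3) finite_set_mset_mset_set)
  have size_set: "card (set_mset x) = 1" if "x \<in> S1" for x using that by (auto simp: S1_def)
  have size_set2: "card (set_mset x) = 2" if x: "x \<in> S2 \<union> S3" for x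
  proof -
    obtain k u where "k < ?n" "u \<in> N k" "set_mset x = {u, vs ! k}"
      using x by (fastforce simp: S2_def S3_def insert_commute)
    then show ?thesis using N_ne[of k u] by simp
  qed
  have size_set4: "card (set_mset x) = 3" if "x \<in> S4" for x
    using that tri by (auto simp: S4_def)
  have d23: "S2 \<inter> S3 = {}"
  proof (rule ccontr)
    assume "S2 \<inter> S3 \<noteq> {}"
    then obtain x where x: "x \<in> S2" "x \<in> S3" by blast
    from x(1) obtain k u where k: "k < ?n" "u \<in> N k" "x = {#u, u, vs ! k#}" by (auto simp: S2_def)
    from x(2) obtain k' u' where k': "k' < ?n" "u' \<in> N k'" "x = {#vs ! k', vs ! k', u'#}" by (auto simp: S3_def)
    have "u = vs ! k' \<and> vs ! k = u'"
      using pair_mset_eq[of u "vs ! k" "vs ! k'" u'] N_ne[OF k(1,2)] k(3) k'(3) by metis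
    then show False using N_pos[OF k(1,2)] N_pos[OF k'(1,2)] pos[OF k(1)] pos[OF k'(1)] by auto
  qed
  define S where "S = S1 \<union> (S2 \<union> S3) \<union> S4"
  have finS: "finite S1" "finite S2" "finite S3" "finite S4"
    using finite_V finN fin_tri by (auto simp: S1_def S2_def S3_def S4_def)
  have "S1 \<inter> (S2 \<union> S3) = {}"
  proof (rule ccontr)
    assume "S1 \<inter> (S2 \<union> S3) \<noteq> {}"
    then obtain x where "x \<in> S1" "x \<in> S2 \<union> S3" by blast
    then show False using size_set[of x] size_set2[of x] by simp
  qed
  moreover have "(S1 \<union> (S2 \<union> S3)) \<inter> S4 = {}"
  proof (rule ccontr)
    assume "(S1 \<union> (S2 \<union> S3)) \<inter> S4 \<noteq> {}"
    then obtain x where "x \<in> S1 \<or> x \<in> S2 \<union> S3" "x \<in> S4" by blast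
    then show False using size_set[of x] size_set2[of x] size_set4[of x] by auto
  qed
  ultimately have cardS: "card S = card (triangles V E) + ?n + 2 * (\<Sum>k<?n. card (N k))"
    unfolding S_def using finS d23 by (simp add: card_Un_disjoint c1 c2 c3 c4)
  have edge_ne: "u \<noteq> v" "u \<in> V" "v \<in> V" if "{u, v} \<in> E" for u v
    using that G by (auto simp: simple_graph_def)
  have pairX: "{u, v} \<in> X \<longleftrightarrow> u = v \<or> {u, v} \<in> E" if "u \<in> V" "v \<in> V" for u v
    using that by (auto simp: X cliques_def insert_commute)
  have SM: "x \<in> M \<and> size x = 3" if "x \<in> S" for x
  proof -
    have "{#v, v, v#} \<in> M" if "v \<in> V" for v
      using pairX[OF that that] by (simp add: face_monomials_def)
    moreover have "{#u, u, vs ! k#} \<in> M \<and> {#vs ! k, vs ! k, u#} \<in> M" if "k < ?n" "u \<in> N k" for k u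
      using pairX[of u "vs ! k"] that N_V[of k] V_nth[OF that(1)]
      by (auto simp: face_monomials_def N_def insert_commute)
    moreover have "mset_set T \<in> M" if "T \<in> triangles V E" for T
      using tri[OF that] by (simp add: face_monomials_def)
    ultimately show ?thesis
      using that tri by (auto simp: S_def S1_def S2_def S3_def S4_def)
  qed
  have "\<not> card I < card S"
  proof
    assume less: "card I < card S"
    define g where "g i v = (case i of Inl (k, j, u) \<Rightarrow> a v ^ j | Inr (k, p, q) \<Rightarrow> form (lag k p) v)"
      for i :: "(nat \<times> nat \<times> 'a) + (nat \<times> 'a \<times> 'a)" and v
    define h where "h i v = (case i of Inl (k, j, u) \<Rightarrow> {#v, u, vs ! k#} | Inr (k, p, q) \<Rightarrow> {#v, q, vs ! k#})"
      for i :: "(nat \<times> nat \<times> 'a) + (nat \<times> 'a \<times> 'a)" and v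
    have "finite I" "finite S" using finI finS by (auto simp: I_def S_def)
    from exists_nonzero_solution[OF this finite_V less, of g h]
    obtain \<phi> where "(\<exists>s. \<phi> s \<noteq> 0) \<and> (\<forall>s. \<phi> s \<noteq> 0 \<longrightarrow> s \<in> S) \<and> (\<forall>i\<in>I. (\<Sum>v\<in>V. g i v * \<phi> (h i v)) = 0)" ..
    note \<phi> = this[THEN conjunct1] this[THEN conjunct2, THEN conjunct1] this[THEN conjunct2, THEN conjunct2]
    have \<phi>M: "\<phi> \<in> funs_on M 3" using \<phi>(2) SM by (simp add: funs_on_def)
    define \<psi> where "\<psi> g = act V M (form g) \<phi>" for g
    have \<psi>_sum: "\<psi> g x = (\<Sum>i<w. g i * act V M (\<lambda>v. a v ^ i) \<phi> x)" for g x
    proof (cases "x \<in> M")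
      case True
      then have "\<psi> g x = (\<Sum>v\<in>V. \<Sum>i<w. g i * (a v ^ i * \<phi> (add_mset v x)))"
        by (simp add: \<psi>_def act_def form_def sum_distrib_right mult.assoc)
      also have "\<dots> = (\<Sum>i<w. \<Sum>v\<in>V. g i * (a v ^ i * \<phi> (add_mset v x)))" by (rule sum.swap)
      finally show ?thesis using True by (simp add: act_def sum_distrib_left)
    qed (simp add: \<psi>_def act_def)
    have \<psi>_out: "\<psi> g x = 0" if "x \<notin> M" for g x using that by (simp add: \<psi>_def act_def)
    have con1: "\<psi> g {#u, vs ! k#} = 0" if "k < ?n" "u \<in> C k - P k" for g k u
    proof (cases "{#u, vs ! k#} \<in> M")
      case True
      have "act V M (\<lambda>v. a v ^ i) \<phi> {#u, vs ! k#} = 0" if "i < w" for i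
      proof -
        have "Inl (k, i, u) \<in> I" using that \<open>k < ?n\<close> \<open>u \<in> C k - P k\<close> by (auto simp: I_def I1_def)
        from bspec[OF \<phi>(3) this] show ?thesis using True by (simp add: act_def g_def h_def)
      qed
      then show ?thesis by (simp add: \<psi>_sum)
    qed (rule \<psi>_out)
    have con2: "\<psi> (lag k p) {#q, vs ! k#} = 0" if "k < ?n" "p \<in> P k" "q \<in> P k" "pos p \<le> pos q" for k p q
    proof (cases "{#q, vs ! k#} \<in> M")
      case True
      have "Inr (k, p, q) \<in> I" using that by (auto simp: I_def I2_def)
      from bspec[OF \<phi>(3) this] show ?thesis using True by (simp add: \<psi>_def act_def g_def h_def)
    qed (rule \<psi>_out)
    have vanish: "\<forall>k u g. ?n - j \<le> k \<longrightarrow> k < ?n \<longrightarrow> u \<in> V \<longrightarrow> \<psi> g {#u, vs ! k#} = 0" if "j \<le> ?n" for j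
      using that
    proof (induction j)
      case (Suc j)
      define k where "k = ?n - Suc j"
      have k: "k < ?n" "Suc k = ?n - j" using Suc.prems by (auto simp: k_def)
      let ?v = "vs ! k"
      have IH: "\<psi> g {#u, vs ! i#} = 0" if "k < i" "i < ?n" "u \<in> V" for i u g
        using Suc.IH Suc.prems that k(2) by auto
      \<comment> \<open>Away from \<open>P k\<close> there are three cases: \<open>u\<close> is in
        \<open>C k\<close> and constrained by \<open>I1\<close>, or it comes later and was treated
        before, or it is an earlier nonneighbour and the monomial is not on a face.\<close>
      have out: "\<psi> g {#u, ?v#} = 0" if u: "u \<in> V" "u \<notin> P k" for u g
      proof (cases "u \<in> C k")
        case True
        then show ?thesis using con1[OF k(1)] u(2) by simp
      next
        case False
        obtain i where i: "i < ?n" "u = vs ! i" using u(1) vs(2) by (metis in_set_conv_nth)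
        have "i \<noteq> k" using False i(2) by (auto simp: C_def)
        show ?thesis
        proof (cases "k < i")
          case True
          have e: "{#u, ?v#} = {#?v, vs ! i#}" unfolding i(2) by (rule add_mset_commute)
          show ?thesis unfolding e by (rule IH[OF True i(1) V_nth[OF k(1)]])
        next
          case F: False
          then have "u \<in> set (take k vs)" using i \<open>i \<noteq> k\<close> k(1) by (auto simp: in_set_conv_nth intro!: exI[of _ i])
          then have "{u, ?v} \<notin> E" "u \<noteq> ?v" using False by (auto simp: C_def N_def)
          then have "{#u, ?v#} \<notin> M" using pairX[OF u(1) V_nth[OF k(1)]] by (simp add: face_monomials_def)
          then show ?thesis by (rule \<psi>_out)
        qed
      qed
      have vM: "{#?v#} \<in> M" using pairX[of ?v ?v] V_nth[OF k(1)] by (simp add: face_monomials_def)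
      \<comment> \<open>At \<open>?v\<close> only the values on \<open>P k\<close> enter, and the
        dual basis \<open>lag k p\<close> reads them off one by one.\<close>
      have S: "act V M (form f) (\<psi> g) {#?v#} = (\<Sum>u\<in>P k. form f u * \<psi> g {#u, ?v#})" for f g
        unfolding act_def using vM P_V[OF k(1)] finite_V out by (auto intro!: sum.mono_neutral_right)
      have sym: "act V M (form f) (\<psi> g) = act V M (form g) (\<psi> f)" for f g
        unfolding \<psi>_def using \<phi>M by (intro comm) auto
      have S_lag: "act V M (form (lag k p)) (\<psi> g) {#?v#} = \<psi> g {#p, ?v#}" if p: "p \<in> P k" for p g
      proof -
        have "(\<Sum>u\<in>P k. form (lag k p) u * \<psi> g {#u, ?v#}) = (\<Sum>u\<in>P k. if u = p then \<psi> g {#u, ?v#} else 0)"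
          by (rule sum.cong) (auto simp: lag[OF k(1) p])
        then show ?thesis using p finP by (simp add: S)
      qed
      have lag0: "\<psi> (lag k p) {#q, ?v#} = 0" if pq: "p \<in> P k" "q \<in> P k" for p q
      proof (cases "pos p \<le> pos q")
        case True
        then show ?thesis using con2[OF k(1)] pq by blast
      next
        case False
        have "\<psi> (lag k p) {#q, ?v#} = act V M (form (lag k q)) (\<psi> (lag k p)) {#?v#}"
          using S_lag[OF pq(2)] by simp
        also have "\<dots> = \<psi> (lag k q) {#p, ?v#}" unfolding sym[of "lag k q"] by (rule S_lag[OF pq(1)])
        also have "\<dots> = 0" using con2[OF k(1) pq(2,1)] False by simp
        finally show ?thesis .
      qed
      have "\<psi> g {#u, ?v#} = 0" if "u \<in> V" for u g
      proof (cases "u \<in> P k")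
        case True
        have "\<psi> g {#u, ?v#} = act V M (form g) (\<psi> (lag k u)) {#?v#}"
          unfolding sym[of g] using S_lag[OF True] by simp
        also have "\<dots> = 0" unfolding S by (rule sum.neutral) (simp add: lag0[OF True])
        finally show ?thesis .
      qed (rule out[OF that])
      note v0 = this
      show ?case
      proof (intro allI impI)
        fix k' u g assume k': "?n - Suc j \<le> k'" "k' < ?n" "u \<in> V"
        show "\<psi> g {#u, vs ! k'#} = 0"
        proof (cases "k' = k")
          case True
          then show ?thesis using v0[OF k'(3)] by simp
        next
          case False
          then show ?thesis using IH[of k' u g] k' by (simp add: k_def)
        qed
      qed
    qed simp
    have \<psi>0: "\<psi> g x = 0" for g x
    proof (cases "x \<in> M \<and> size x = 2")
      case True
      then have "size x = Suc (Suc 0)" by simp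
      then obtain u y where y: "x = add_mset u y" by (blast dest: size_eq_Suc_imp_eq_union)
      then have "size y = Suc 0" using True by simp
      then obtain v y' where "y = add_mset v y'" by (blast dest: size_eq_Suc_imp_eq_union)
      then have x: "x = {#u, v#}" using y True by simp
      have "set_mset x \<subseteq> V" using True X_sub by (simp add: face_monomials_def)
      then have uv: "u \<in> V" "v \<in> set vs" using x vs(2) by auto
      from uv(2) obtain k where k: "k < ?n" "vs ! k = v" unfolding in_set_conv_nth by blast
      show ?thesis
        using vanish[OF order_refl, rule_format, of k u g] k uv(1) x by simp
    next
      case False
      have "\<psi> g \<in> funs_on M 2" unfolding \<psi>_def by (rule op_mem) (use \<phi>M in \<open>auto simp: numeral_3_eq_3 numeral_2_eq_2\<close>)
      then show ?thesis using False by (auto simp: funs_on_def)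
    qed
    define fs where "fs = map (\<lambda>i v. a v ^ i) [0..<w]"
    have "spans_faces fs X"
      unfolding spans_faces_def
    proof (intro ballI)
      fix F v assume F: "F \<in> X" "v \<in> F"
      have "\<exists>g. \<forall>u\<in>F. (\<Sum>i<w. g i * a u ^ i) = (if u = v then 1 else 0)"
        using F X_sub[OF F(1)] finite_subset[OF X_sub[OF F(1)] finite_V] inj_on_subset[OF a] w[OF F(1)]
        by (intro lagrange_form) auto
      then show "\<exists>g. \<forall>u\<in>F. (\<Sum>i<length fs. g i * (fs ! i) u) = (if u = v then 1 else 0)"
        by (simp add: fs_def)
    qed
    moreover have "act V M f \<phi> = 0" if "f \<in> set fs" for f
    proof -
      obtain i where i: "i < w" "f = (\<lambda>v. a v ^ i)" using \<open>f \<in> set fs\<close> by (auto simp: fs_def)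
      have f: "form (\<lambda>j. if j = i then 1 else 0) = f"
        unfolding form_def i(2) using i(1) by (intro ext) (simp add: if_distrib[of "\<lambda>c. c * _"] cong: if_cong)
      show ?thesis
        using \<psi>0[of "\<lambda>j. if j = i then 1 else 0"] unfolding \<psi>_def f by (intro ext) simp
    qed
    ultimately have "\<phi> = 0" using degree_3_vanishing[OF acyclic _ \<phi>M] by blast
    then show False using \<phi>(1) by simp
  qed
  then have "2 * card S \<le> 2 * card I" by simp
  also have "2 * card I = (\<Sum>k<?n. 2 * (w * (Suc (card (N k)) - min w (Suc (card (N k))))) +
       min w (Suc (card (N k))) * Suc (min w (Suc (card (N k)))))"
    unfolding cardI by (rule sum.cong) (simp_all add: P(2) cardC)
  finally show ?thesis unfolding cardS .
qed

end

section \<open>The extremal inequality\<close>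

text \<open>For \<open>w \<ge> 2\<close> this is the sum of \<open>max 0 (b - s)\<close> over \<open>1 \<le> s \<le> w - 2\<close>.\<close>

definition triangle_weight :: "nat \<Rightarrow> nat \<Rightarrow> real" where
  "triangle_weight w b = (if b < w then real b * (real b - 1) / 2
     else (real w - 2) * real b - (real w - 1) * (real w - 2) / 2)"

text \<open>This is \<open>(n - 2) / 3\<close> times the coefficient of \<open>\<epsilon>\<close> in the theorem at \<open>\<kappa> = w / n\<close>.\<close>

definition edge_weight :: "real \<Rightarrow> real \<Rightarrow> real" where
  "edge_weight n w = (n - 2) * w * (3 * n\<^sup>2 - w\<^sup>2) / (3 * n * (n\<^sup>2 + 2 * n * w - w\<^sup>2))"

text \<open>The two places where the edge weight has to be large enough. The first says that
  \<open>U\<close> still decreases from \<open>w - 1\<close> to \<open>w\<close>; the second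
  compares \<open>U\<close> at \<open>w\<close> with \<open>U\<close> at
  \<open>(n + w - 1) / 2\<close>. Without its lower-order terms the second would be sharp up to the
  factor \<open>(n - 2) / n\<close>, which explains the formula for
  \<open>edge_weight\<close>.\<close>

lemma edge_weight_bounds:
  fixes n w :: real
  assumes w: "2 \<le> w" "w < n"
  shows "(w - 2) * (3 * n - 2 * w) \<le> edge_weight n w * (6 * n - 3 * w)"
    and "(w - 2) * (3 * n\<^sup>2 - w\<^sup>2 - (3 * n - w)) \<le> 3 * (edge_weight n w * (n\<^sup>2 + 2 * n * w - w\<^sup>2 - (3 * n - w)))"
proof -
  define A D F where "A = 3 * n\<^sup>2 - w\<^sup>2" and "D = n\<^sup>2 + 2 * n * w - w\<^sup>2" and "F = edge_weight n w"
  have n: "0 < n" using w by simp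
  have ww: "w\<^sup>2 \<le> n\<^sup>2" using w by (intro power_mono) auto
  have nw: "0 < n * w" using w n by simp
  have D: "0 < D" unfolding D_def using ww nw by linarith
  have A: "0 < A" unfolding A_def using ww n by (smt (verit) zero_less_power)
  have F: "F * (3 * n * D) = (n - 2) * w * A"
    using n D by (simp add: F_def edge_weight_def A_def D_def)
  have nD: "0 < 3 * n * D" using n D by simp
  have le1: "n * (w - 2) \<le> (n - 2) * w" using w by (simp add: algebra_simps)
  show "(w - 2) * (3 * n - 2 * w) \<le> edge_weight n w * (6 * n - 3 * w)"
  proof -
    have "A * (2 * n - w) - D * (3 * n - 2 * w) = (n - w)\<^sup>2 * (3 * n - w)"
      by (simp add: A_def D_def algebra_simps power2_eq_square)
    also have "\<dots> \<ge> 0" using w by simp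
    finally have le2: "D * (3 * n - 2 * w) \<le> A * (2 * n - w)" by simp
    have "n * (w - 2) * (D * (3 * n - 2 * w)) \<le> (n - 2) * w * (A * (2 * n - w))"
      by (rule mult_mono[OF le1 le2]) (use w n D in auto)
    then have "((w - 2) * (3 * n - 2 * w)) * (3 * n * D) \<le> (F * (3 * n * D)) * (6 * n - 3 * w)"
      unfolding F by (simp add: algebra_simps)
    then have "((w - 2) * (3 * n - 2 * w)) * (3 * n * D) \<le> (F * (6 * n - 3 * w)) * (3 * n * D)"
      by (simp only: mult_ac)
    then show ?thesis using nD unfolding F_def by (simp only: mult_le_cancel_right_pos)
  qed
  show "(w - 2) * (3 * n\<^sup>2 - w\<^sup>2 - (3 * n - w)) \<le> 3 * (edge_weight n w * (n\<^sup>2 + 2 * n * w - w\<^sup>2 - (3 * n - w)))"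
  proof -
    \<comment> \<open>\<open>s\<close> is the lower-order correction subtracted from both
      \<open>A\<close> and \<open>D\<close>. The estimates \<open>a\<close> and \<open>b\<close>
      show that the inequality between the main terms survives it.\<close>
    define s where "s = 3 * n - w"
    have s: "0 < s" using w by (simp add: s_def)
    have "A = s * n + w * (n - w)" by (simp add: A_def s_def algebra_simps power2_eq_square)
    then have a: "s * n \<le> A" using w by simp
    have "n * D - (n\<^sup>2 * w + n\<^sup>2 - w\<^sup>2) = n\<^sup>2 * (n - 1) + n * w * (n - w) + w\<^sup>2"
      by (simp add: D_def algebra_simps power2_eq_square)
    also have "\<dots> \<ge> 0" using w by simp
    finally have b: "n\<^sup>2 * w + n\<^sup>2 - w\<^sup>2 \<le> n * D" by simp
    have "s * (n\<^sup>2 * w + n\<^sup>2 - w\<^sup>2) \<le> s * (n * D)" using b s by simp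
    also have "\<dots> \<le> A * D" using mult_right_mono[OF a, of D] D by (simp add: mult_ac)
    finally have "0 \<le> 2 * (n - w) * (A * D - s * (n\<^sup>2 * w + n\<^sup>2 - w\<^sup>2))" using w by simp
    also have "\<dots> = (n - 2) * w * A * (D - s) - (w - 2) * n * D * (A - s)"
      by (simp add: A_def D_def algebra_simps power2_eq_square)
    finally have "(w - 2) * n * D * (A - s) \<le> (F * (3 * n * D)) * (D - s)" unfolding F by simp
    then have "((w - 2) * (A - s)) * (n * D) \<le> (3 * (F * (D - s))) * (n * D)" by (simp only: mult_ac)
    moreover have "0 < n * D" using n D by simp
    ultimately show ?thesis unfolding F_def A_def D_def s_def by (simp only: mult_le_cancel_right_pos)
  qed
qed

locale extremal_weights =
  fixes n w :: nat
  assumes w: "2 \<le> w" "w < n"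
begin

definition "F = edge_weight n w"
text \<open>The cost of a vertex with back-degree \<open>b\<close>: its bound on triangles minus an
  allowance of \<open>F\<close> for each edge. A clique of \<open>m\<close> vertices placed at the
  start of the order costs \<open>Q m\<close>, and an order of total cost at most 0 is
  wanted.\<close>

definition "p b = triangle_weight w b - F * real b"
definition "Q m = (\<Sum>z<m. p z)"

lemma Q_Suc: "Q (Suc m) = Q m + p m" by (simp add: Q_def)

lemma Q_low: "m \<le> w \<Longrightarrow> Q m = real m * (real m - 1) * (real m - 2) / 6 - F * (real m * (real m - 1) / 2)"
proof (induction m)
  case (Suc m)
  then show ?case by (simp add: Q_Suc p_def triangle_weight_def field_simps)
qed (simp add: Q_def)

lemma Q_high: "w \<le> m \<Longrightarrow> Q m = Q w + (real m - real w) *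
   ((real w - 2 - F) * (real m + real w - 1) / 2 - (real w - 1) * (real w - 2) / 2)"
proof (induction m rule: dec_induct)
  case (step m)
  then show ?case by (simp add: Q_Suc p_def triangle_weight_def field_simps)
qed simp

text \<open>Equivalent to a decrease of \<open>U\<close> from \<open>m\<close> to
  \<open>Suc m\<close>. With \<open>\<mu> = m + 1\<close> it bounds
  \<open>(\<mu> - 2) * (3 * n - 2 * \<mu>) / (2 * n - \<mu>)\<close> by \<open>3 * F\<close>; the
  quotient at \<open>\<mu>\<close> is at most its value at \<open>w\<close>, where the first bound
  on the edge weight applies.\<close>

lemma p_Q_bound:
  assumes "m < w"
  shows "(real n - real m) * p m + Q m \<le> 0"
proof (cases m)
  case 0
  then show ?thesis using w by (simp add: p_def triangle_weight_def Q_def)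
next
  case (Suc m')
  define N W \<mu> where "N = real n" and "W = real w" and "\<mu> = real m + 1"
  have bounds: "2 \<le> \<mu>" "\<mu> \<le> W" "W \<le> N" "2 \<le> W" using assms w Suc by (simp_all add: N_def W_def \<mu>_def)
  have "(W - 2) * (3 * N - 2 * W) * (2 * N - \<mu>) - (\<mu> - 2) * (3 * N - 2 * \<mu>) * (2 * N - W) =
      (W - \<mu>) * (2 * ((N - W) * (N - \<mu>) + N * ((N - W) + (N - \<mu>))) + 2 * N)"
    by (simp add: algebra_simps)
  also have "\<dots> \<ge> 0" using bounds by (intro mult_nonneg_nonneg add_nonneg_nonneg) auto
  finally have "(\<mu> - 2) * (3 * N - 2 * \<mu>) * (2 * N - W) \<le> (W - 2) * (3 * N - 2 * W) * (2 * N - \<mu>)" by simp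
  also have "\<dots> \<le> F * (6 * N - 3 * W) * (2 * N - \<mu>)"
    using edge_weight_bounds(1)[of "real w" "real n"] w bounds
    by (intro mult_right_mono) (simp_all add: F_def N_def W_def)
  also have "\<dots> = F * (6 * N - 3 * \<mu>) * (2 * N - W)" by (simp add: algebra_simps)
  finally have "(\<mu> - 2) * (3 * N - 2 * \<mu>) \<le> F * (6 * N - 3 * \<mu>)"
    using bounds w by (simp add: mult_le_cancel_right N_def W_def)
  then have "real m * ((\<mu> - 2) * (3 * N - 2 * \<mu>) - F * (6 * N - 3 * \<mu>)) \<le> 0"
    by (simp add: mult_nonneg_nonpos)
  moreover have eq: "6 * ((real n - real m) * p m + Q m) = real m * ((\<mu> - 2) * (3 * N - 2 * \<mu>) - F * (6 * N - 3 * \<mu>))"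
    using assms by (simp add: Q_low p_def triangle_weight_def N_def \<mu>_def field_simps)
  ultimately have "6 * ((real n - real m) * p m + Q m) \<le> 0" by (simp only: eq)
  moreover have "x \<le> 0" if "6 * x \<le> 0" for x :: real using that by linarith
  ultimately show ?thesis by blast
qed

text \<open>After an initial clique of \<open>m\<close> vertices, \<open>- U m\<close> is the mean
  cost that each of the other \<open>n - m\<close> vertices may have.\<close>

definition "U m = Q m / (real n - real m)"

lemma U_Suc:
  assumes "m < w"
  shows "U (Suc m) \<le> U m"
proof -
  have "Q (Suc m) * (real n - real m) \<le> Q m * (real n - real (Suc m))"
    using p_Q_bound[OF assms] by (simp add: Q_Suc algebra_simps)
  then show ?thesis using assms w by (simp add: U_def divide_simps)
qed

lemma U_antimono: "a \<le> m \<Longrightarrow> m \<le> w \<Longrightarrow> U m \<le> U a"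
proof (induction m rule: dec_induct)
  case (step m)
  then show ?case using U_Suc[of m] by simp
qed simp

text \<open>From \<open>w\<close> on the triangle weight is linear, so
  \<open>Q m = Q w + (m - w) * B\<close> with \<open>B\<close> affine in \<open>m\<close>, and the
  claim reduces to \<open>(n - w) * B + Q w \<le> 0\<close>.\<close>

lemma U_high:
  assumes "w \<le> m" "2 * m + 1 \<le> n + w"
  shows "U m \<le> U w"
proof -
  define c where "c = real w - 2 - F"
  define B where "B = c * (real m + real w - 1) / 2 - (real w - 1) * (real w - 2) / 2"
  have Qw: "Q w \<le> 0"
    using U_antimono[of 0 w] w by (simp add: U_def Q_def divide_le_0_iff)
  \<comment> \<open>If the slope \<open>c\<close> of the cost is nonnegative, \<open>B\<close> is
    largest at \<open>m = (n + w - 1) / 2\<close>, where the second bound on the edge weight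
    applies; otherwise \<open>B\<close> and \<open>Q w\<close> are both nonpositive.\<close>
  have bracket: "(real n - real w) * B + Q w \<le> 0"
  proof (cases "0 \<le> c")
    case True
    define N W where "N = real n" and "W = real w"
    have "B \<le> c * (N + 3 * W - 3) / 4 - (W - 1) * (W - 2) / 2"
    proof -
      have "c * (real m + real w - 1) \<le> c * ((N + 3 * W - 3) / 2)"
        using True assms(2) by (intro mult_left_mono) (auto simp: N_def W_def)
      then show ?thesis by (simp add: B_def W_def)
    qed
    then have le: "(N - W) * B \<le> (N - W) * (c * (N + 3 * W - 3) / 4 - (W - 1) * (W - 2) / 2)"
      using w by (intro mult_left_mono) (auto simp: N_def W_def)
    have eq: "12 * ((N - W) * (c * (N + 3 * W - 3) / 4 - (W - 1) * (W - 2) / 2) + Q w) =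
       (W - 2) * (3 * N\<^sup>2 - W\<^sup>2 - (3 * N - W)) - 3 * (F * (N\<^sup>2 + 2 * N * W - W\<^sup>2 - (3 * N - W)))"
      by (simp add: Q_low c_def N_def W_def field_simps power2_eq_square)
    have le': "(W - 2) * (3 * N\<^sup>2 - W\<^sup>2 - (3 * N - W)) \<le> 3 * (F * (N\<^sup>2 + 2 * N * W - W\<^sup>2 - (3 * N - W)))"
      using edge_weight_bounds(2)[of W N] w by (simp add: N_def W_def F_def)
    have "12 * ((N - W) * (c * (N + 3 * W - 3) / 4 - (W - 1) * (W - 2) / 2) + Q w) \<le> 0"
      unfolding eq using le' by (simp only: diff_le_0_iff_le)
    moreover have "x + y \<le> 0" if "12 * (z + y) \<le> 0" "x \<le> z" for x y z :: real
      using that by simp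
    ultimately have "(N - W) * B + Q w \<le> 0" using le by blast
    then show ?thesis unfolding N_def W_def .
  next
    case False
    then have "c * (real m + real w - 1) \<le> 0" using w by (intro mult_nonpos_nonneg) auto
    moreover have "0 \<le> (real w - 1) * (real w - 2)" using w by simp
    ultimately have "B \<le> 0" by (simp add: B_def)
    then have "(real n - real w) * B \<le> 0" using w by (intro mult_nonneg_nonpos) auto
    then show ?thesis using Qw by linarith
  qed
  have Qm: "Q m = Q w + (real m - real w) * B"
    using Q_high[OF assms(1)] by (simp add: B_def c_def)
  have "Q m * (real n - real w) - Q w * (real n - real m) = (real m - real w) * ((real n - real w) * B + Q w)"
    unfolding Qm by (simp add: algebra_simps)
  also have "\<dots> \<le> 0" using bracket assms(1) by (intro mult_nonneg_nonpos) auto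
  finally have "Q m * (real n - real w) \<le> Q w * (real n - real m)" by simp
  moreover have "real m < real n" using assms w by linarith
  ultimately show ?thesis using w by (simp add: U_def divide_simps)
qed

text \<open>Intended for an initial clique of size \<open>\<theta>\<close> and a vertex of degree
  \<open>m - 1\<close> with \<open>a\<close> neighbours in it. Writing \<open>Q\<close> through
  \<open>U\<close>, the estimate follows from \<open>U m \<le> U \<theta> \<le> U a\<close>, or from
  \<open>U \<theta> \<le> U m \<le> U a\<close> if \<open>m < \<theta>\<close>.\<close>

lemma interval_sum_le:
  assumes "a \<le> \<theta>" "\<theta> \<le> w" "a \<le> m" "2 * m + 1 \<le> n + w"
  shows "Q m - Q a \<le> - U \<theta> * (real m - real a)"
proof -
  have mn: "real m < real n" using assms(4) w by linarith
  have an: "real a < real n" using assms(1,2) w by linarith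
  have Qm: "Q m = U m * (real n - real m)" using mn by (simp add: U_def)
  have Qa: "Q a = U a * (real n - real a)" using an by (simp add: U_def)
  show ?thesis
  proof (cases "\<theta> \<le> m")
    case True
    have "U m \<le> U \<theta>"
    proof (cases "m \<le> w")
      case False
      then show ?thesis using U_high[of m] U_antimono[OF assms(2) order_refl] assms(4) by simp
    qed (use True in \<open>auto intro: U_antimono\<close>)
    then have "U m * (real n - real m) \<le> U \<theta> * (real n - real m)" using mn by (intro mult_right_mono) auto
    moreover have "U \<theta> * (real n - real a) \<le> U a * (real n - real a)"
      using an U_antimono[OF assms(1,2)] by (intro mult_right_mono) auto
    ultimately show ?thesis unfolding Qm Qa by (simp add: algebra_simps)
  next
    case False
    have "U m \<le> U a" "U \<theta> \<le> U m" using False assms U_antimono by auto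
    then have "U m * (real n - real a) \<le> U a * (real n - real a)" "U \<theta> * (real m - real a) \<le> U m * (real m - real a)"
      using an assms(3) by (auto intro!: mult_right_mono)
    then show ?thesis unfolding Qm Qa by (simp add: algebra_simps)
  qed
qed

end

section \<open>Counting triangles along a vertex order\<close>

text \<open>The cubes and the edge monomials contribute 2 + 4b for a vertex of back-degree b in the
  doubled count. Subtracting them leaves twice the \<open>triangle_weight\<close>.\<close>

lemma Leray_triangle_bound:
  fixes V :: "'a set"
  assumes G: "simple_graph V E" and L: "Leray TYPE('k::field) 2 V (clique_complex V E)"
    and w: "\<And>F. F \<in> cliques V E \<Longrightarrow> card F \<le> w" "1 \<le> w"
    and vs: "distinct vs" "set vs = V"
  shows "real (card (triangles V E)) \<le>
    (\<Sum>k<length vs. triangle_weight w (card {u \<in> set (take k vs). {u, vs ! k} \<in> E}))"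
proof -
  let ?X = "cliques V E" and ?n = "length vs"
  let ?b = "\<lambda>k. card {u \<in> set (take k vs). {u, vs ! k} \<in> E}"
  define pos where "pos = the_inv_into {..<?n} ((!) vs)"
  have inj: "inj_on ((!) vs) {..<?n}" using vs(1) by (simp add: inj_on_nth)
  have pos: "pos (vs ! k) = k" if "k < ?n" for k
    unfolding pos_def using that by (intro the_inv_into_f_f[OF inj]) auto
  have posV: "inj_on pos V"
  proof (rule inj_onI)
    fix x y assume "x \<in> V" "y \<in> V" and e: "pos x = pos y"
    then obtain i j where "i < ?n" "x = vs ! i" "j < ?n" "y = vs ! j"
      using vs(2) by (metis in_set_conv_nth)
    then show "x = y" using e pos by metis
  qed
  have sub: "F \<subseteq> V" if "F \<in> ?X" for F using that by (auto simp: cliques_def)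
  have down: "F' \<in> ?X" if "F \<in> ?X" "F' \<subseteq> F" for F F' using that by (auto simp: cliques_def)
  have single: "{v} \<in> ?X" if "v \<in> V" for v using that by (auto simp: cliques_def)
  interpret variable_koszul V vs pos ?X "TYPE('k fls)"
    by unfold_locales (use vs pos sub down in auto)
  \<comment> \<open>Distinct powers of the indeterminate are the parameters on the moment
    curve.\<close>
  define a where "a v = (fls_shift (- int (pos v)) 1 :: 'k fls)" for v
  have "inj_on a V"
  proof (rule inj_onI)
    fix x y assume xy: "x \<in> V" "y \<in> V" "a x = a y"
    have "fls_nth (a x) (int (pos x)) = 1" by (simp add: a_def)
    then have "fls_nth (a y) (int (pos x)) = 1" using xy(3) by simp
    then have "pos x = pos y" by (simp add: a_def split: if_splits)
    then show "x = y" using posV xy(1,2) by (auto dest: inj_onD)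
  qed
  moreover have "set_acyclic TYPE('k fls) pos ?X W m" if "W \<subseteq> V" "3 \<le> m" for W m
    using Leray_set_acyclic_fls[of V ?X pos W m, where 'k = 'k] L sub single finite_V posV that
    by (simp add: clique_complex_def)
  ultimately have "2 * (card (triangles V E) + ?n + 2 * (\<Sum>k<?n. ?b k)) \<le>
     (\<Sum>k<?n. 2 * (w * (Suc (?b k) - min w (Suc (?b k)))) + min w (Suc (?b k)) * Suc (min w (Suc (?b k))))"
    by (intro triangle_count[OF G refl _ _ w(1)])
  then have "real (2 * (card (triangles V E) + ?n + 2 * (\<Sum>k<?n. ?b k))) \<le>
     real (\<Sum>k<?n. 2 * (w * (Suc (?b k) - min w (Suc (?b k)))) + min w (Suc (?b k)) * Suc (min w (Suc (?b k))))"
    by (simp only: of_nat_le_iff)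
  also have "\<dots> = (\<Sum>k<?n. 2 * triangle_weight w (?b k) + 2 + 4 * real (?b k))"
    unfolding of_nat_sum
  proof (rule sum.cong)
    fix k
    have "real (2 * (w * (Suc b - min w (Suc b))) + min w (Suc b) * Suc (min w (Suc b))) =
       2 * triangle_weight w b + 2 + 4 * real b" for b
    proof (cases "b < w")
      case True
      then have "min w (Suc b) = Suc b" by simp
      then show ?thesis using True by (simp add: triangle_weight_def field_simps)
    next
      case False
      then have "min w (Suc b) = w" by simp
      moreover have "real (Suc b - w) = real b + 1 - real w" using False by (simp add: of_nat_diff)
      ultimately show ?thesis using False by (simp add: triangle_weight_def field_simps)
    qed
    then show "real (2 * (w * (Suc (?b k) - min w (Suc (?b k)))) + min w (Suc (?b k)) * Suc (min w (Suc (?b k)))) =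
       2 * triangle_weight w (?b k) + 2 + 4 * real (?b k)" .
  qed simp
  finally show ?thesis by (simp add: sum.distrib sum_distrib_left[symmetric])
qed

section \<open>Back-degrees in a vertex order and their averages\<close>

definition nbrs :: "'a set set \<Rightarrow> 'a set \<Rightarrow> 'a \<Rightarrow> 'a set" where
  "nbrs E S v = {u \<in> S. {u, v} \<in> E}"

text \<open>Each edge is counted at its later endpoint.\<close>

lemma card_edges_order:
  assumes G: "simple_graph V E" and vs: "distinct vs" "set vs = V"
  shows "card E = (\<Sum>k<length vs. card (nbrs E (set (take k vs)) (vs ! k)))"
proof -
  let ?n = "length vs" and ?N = "\<lambda>k. nbrs E (set (take k vs)) (vs ! k)"
  have take: "\<exists>i<k. u = vs ! i" if "u \<in> ?N k" "k < ?n" for u k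
    using that by (auto simp: nbrs_def in_set_conv_nth)
  have nth: "i = j" if "i < ?n" "j < ?n" "vs ! i = vs ! j" for i j
    using that vs(1) by (simp add: nth_eq_iff_index_eq)
  have "bij_betw (\<lambda>(k, u). {u, vs ! k}) (Sigma {..<?n} ?N) E"
    unfolding bij_betw_def
  proof
    show "inj_on (\<lambda>(k, u). {u, vs ! k}) (Sigma {..<?n} ?N)"
    proof (rule inj_onI, clarify)
      fix k u k' u' assume k: "k < ?n" "u \<in> ?N k" "k' < ?n" "u' \<in> ?N k'" and e: "{u, vs ! k} = {u', vs ! k'}"
      obtain i i' where i: "i < k" "u = vs ! i" "i' < k'" "u' = vs ! i'" using take k by metis
      show "k = k' \<and> u = u'"
      proof (cases "vs ! k = vs ! k'")
        case True
        then have "k = k'" using nth k by blast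
        then show ?thesis using e by (auto simp: doubleton_eq_iff)
      next
        case False
        then have "vs ! k = u'" "u = vs ! k'" using e by (auto simp: doubleton_eq_iff)
        then have "k = i'" "i = k'" using i k nth by auto
        then show ?thesis using i by simp
      qed
    qed
    show "(\<lambda>(k, u). {u, vs ! k}) ` (Sigma {..<?n} ?N) = E"
    proof (intro set_eqI iffI)
      fix e assume "e \<in> E"
      then have "e \<subseteq> V" "card e = 2" using G by (auto simp: simple_graph_def)
      then obtain x y where xy: "e = {x, y}" "x \<noteq> y" "x \<in> V" "y \<in> V" by (auto simp: card_2_iff)
      then obtain i j where ij: "i < ?n" "x = vs ! i" "j < ?n" "y = vs ! j"
        using vs(2) by (metis in_set_conv_nth)
      have "{vs ! l, vs ! k} \<in> (\<lambda>(k, u). {u, vs ! k}) ` (Sigma {..<?n} ?N)"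
        if "l < k" "k < ?n" "{vs ! l, vs ! k} \<in> E" for l k
      proof (rule image_eqI[where x = "(k, vs ! l)"])
        have "vs ! l \<in> set (take k vs)" using that by (auto simp: in_set_conv_nth intro!: exI[of _ l])
        then show "(k, vs ! l) \<in> Sigma {..<?n} ?N" using that by (simp add: nbrs_def)
      qed simp
      note * = this[of i j] this[of j i]
      have "i \<noteq> j" using xy ij by auto
      then show "e \<in> (\<lambda>(k, u). {u, vs ! k}) ` (Sigma {..<?n} ?N)"
        using * \<open>e \<in> E\<close> xy(1) ij by (cases "i < j") (auto simp: insert_commute)
    qed (auto simp: nbrs_def)
  qed
  then have "card E = card (Sigma {..<?n} ?N)" by (simp add: bij_betw_same_card)
  also have "\<dots> = (\<Sum>k<?n. card (?N k))" by (rule card_SigmaI) (auto simp: nbrs_def)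
  finally show ?thesis .
qed

text \<open>In a random order the number of earlier neighbours of a vertex with \<open>b\<close>
  neighbours is uniform on 0, ..., \<open>b\<close>; here \<open>a\<close> further neighbours always
  come earlier.\<close>

definition interval_avg :: "(nat \<Rightarrow> real) \<Rightarrow> nat \<Rightarrow> nat \<Rightarrow> real" where
  "interval_avg p a b = (\<Sum>j\<le>b. p (a + j)) / (real b + 1)"

lemma interval_avg_step:
  assumes "0 < b"
  shows "real b * interval_avg p a (b - 1) + p (a + b) = (real b + 1) * interval_avg p a b"
proof -
  obtain c where "b = Suc c" using assms by (cases b) auto
  moreover have "1 + real c \<noteq> 0" by linarith
  ultimately show ?thesis by (simp add: interval_avg_def add.commute)
qed

text \<open>Averaging over the last vertex replaces the expectation over a random order.\<close>

lemma good_order: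
  assumes "finite S" "\<And>v. {v} \<notin> E"
  shows "\<exists>ss. distinct ss \<and> set ss = S \<and>
    (\<Sum>k<length ss. p (A (ss ! k) + card (nbrs E (set (take k ss)) (ss ! k)))) \<le>
    (\<Sum>v\<in>S. interval_avg p (A v) (card (nbrs E S v)))"
  using assms(1)
proof (induction "card S" arbitrary: S)
  case 0
  then show ?case by (intro exI[where x = "[]"]) simp
next
  case (Suc m)
  let ?d = "\<lambda>S v. card (nbrs E S v)"
  let ?avg = "\<lambda>S v. interval_avg p (A v) (?d S v)"
  have finS: "finite S" by fact
  have dS: "?d (S - {w}) v = ?d S v - (if w \<in> nbrs E S v then 1 else 0)" if "v \<in> S" for v w
  proof -
    have "nbrs E (S - {w}) v = nbrs E S v - {w}" by (auto simp: nbrs_def)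
    then show ?thesis using finS by (simp add: card_Diff_singleton_if nbrs_def)
  qed
  \<comment> \<open>\<open>?f w\<close> bounds the total if \<open>w\<close> comes last and the
    other vertices are ordered by the induction hypothesis. Its mean over \<open>S\<close> equals
    the desired bound, so some \<open>w\<close> attains it.\<close>
  let ?f = "\<lambda>w. p (A w + ?d S w) + (\<Sum>v\<in>S - {w}. ?avg (S - {w}) v)"
  have "(\<Sum>w\<in>S. \<Sum>v\<in>S - {w}. ?avg (S - {w}) v) = (\<Sum>v\<in>S. \<Sum>w\<in>S - {v}. ?avg (S - {w}) v)"
  proof -
    have "(\<Sum>w\<in>S. \<Sum>v\<in>S - {w}. ?avg (S - {w}) v) = (\<Sum>w\<in>S. \<Sum>v\<in>S. if v = w then 0 else ?avg (S - {w}) v)"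
      using finS by (intro sum.cong sum.mono_neutral_cong_left) auto
    also have "\<dots> = (\<Sum>v\<in>S. \<Sum>w\<in>S. if v = w then 0 else ?avg (S - {w}) v)" by (rule sum.swap)
    also have "\<dots> = (\<Sum>v\<in>S. \<Sum>w\<in>S - {v}. ?avg (S - {w}) v)"
      using finS by (intro sum.cong sum.mono_neutral_cong_right) auto
    finally show ?thesis .
  qed
  note swap = this
  \<comment> \<open>Putting a neighbour of \<open>v\<close> last lowers the degree of
    \<open>v\<close> by one, and putting a nonneighbour last leaves it unchanged. The case where
    \<open>v\<close> itself is last supplies the missing endpoint of the interval.\<close>
  have single: "p (A v + ?d S v) + (\<Sum>w\<in>S - {v}. ?avg (S - {w}) v) = real (card S) * ?avg S v" if v: "v \<in> S" for v
  proof -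
    let ?N = "nbrs E S v"
    have N: "?N \<subseteq> S - {v}" "finite ?N" using assms(2)[of v] finS by (auto simp: nbrs_def)
    have "(\<Sum>w\<in>S - {v}. ?avg (S - {w}) v) = (\<Sum>w\<in>?N. ?avg (S - {w}) v) + (\<Sum>w\<in>S - {v} - ?N. ?avg (S - {w}) v)"
      using N finS by (simp add: sum.subset_diff add.commute)
    also have "(\<Sum>w\<in>?N. ?avg (S - {w}) v) = real (card ?N) * interval_avg p (A v) (?d S v - 1)"
      using v by (simp add: dS)
    also have "(\<Sum>w\<in>S - {v} - ?N. ?avg (S - {w}) v) = real (card (S - {v} - ?N)) * ?avg S v"
      using v by (simp add: dS)
    also have "real (card (S - {v} - ?N)) = real (card S) - 1 - real (card ?N)"
    proof -
      have "card (S - {v} - ?N) = card (S - {v}) - card ?N" using N by (simp add: card_Diff_subset)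
      moreover have "card ?N \<le> card (S - {v})" using N finS by (intro card_mono) auto
      moreover have "card (S - {v}) = card S - 1" "1 \<le> card S" using v finS by (auto simp: card_gt_0_iff Suc_le_eq)
      ultimately show ?thesis by linarith
    qed
    finally have e: "(\<Sum>w\<in>S - {v}. ?avg (S - {w}) v) =
      real (card ?N) * interval_avg p (A v) (?d S v - 1) + (real (card S) - 1 - real (card ?N)) * ?avg S v" .
    show ?thesis
    proof (cases "card ?N = 0")
      case True
      then show ?thesis unfolding e by (simp add: interval_avg_def algebra_simps)
    next
      case False
      then show ?thesis unfolding e using interval_avg_step[of "card ?N" p "A v"] by (simp add: algebra_simps)
    qed
  qed
  have total: "(\<Sum>w\<in>S. ?f w) = (\<Sum>v\<in>S. real (card S) * ?avg S v)"
    unfolding sum.distrib swap unfolding sum.distrib[symmetric] by (rule sum.cong) (simp_all only: single)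
  have "\<exists>w\<in>S. ?f w \<le> (\<Sum>v\<in>S. ?avg S v)"
  proof (rule ccontr)
    assume "\<not> ?thesis"
    then have "(\<Sum>v\<in>S. ?avg S v) < ?f w" if "w \<in> S" for w using that by (simp add: not_le)
    then have "(\<Sum>w\<in>S. \<Sum>v\<in>S. ?avg S v) < (\<Sum>w\<in>S. ?f w)"
      using finS Suc.hyps(2) by (intro sum_strict_mono) auto
    then show False unfolding total by (simp add: sum_distrib_left)
  qed
  then obtain w where w: "w \<in> S" "?f w \<le> (\<Sum>v\<in>S. ?avg S v)" by blast
  have "m = card (S - {w})" using Suc.hyps(2) w(1) finS by simp
  from Suc.hyps(1)[OF this] finS
  obtain ss where ss: "distinct ss" "set ss = S - {w}"
    "(\<Sum>k<length ss. p (A (ss ! k) + card (nbrs E (set (take k ss)) (ss ! k)))) \<le> (\<Sum>v\<in>S - {w}. ?avg (S - {w}) v)"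
    by auto
  have "nbrs E (S - {w}) w = nbrs E S w" using assms(2)[of w] by (auto simp: nbrs_def)
  then have "(\<Sum>k<length (ss @ [w]). p (A ((ss @ [w]) ! k) + card (nbrs E (set (take k (ss @ [w]))) ((ss @ [w]) ! k)))) =
     (\<Sum>k<length ss. p (A (ss ! k) + card (nbrs E (set (take k ss)) (ss ! k)))) + p (A w + ?d S w)"
    using ss(2) by (simp add: nth_append)
  then show ?case using ss w by (intro exI[where x = "ss @ [w]"]) auto
qed

section \<open>Degrees of nonadjacent vertices in a graph without induced four-cycles\<close>

lemma common_nbrs_clique:
  assumes G: "simple_graph V E" and C4: "C4_free V E"
    and xy: "x \<in> V" "y \<in> V" "x \<noteq> y" "{x, y} \<notin> E"
  shows "insert x (nbrs E V x \<inter> nbrs E V y) \<in> cliques V E"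
proof -
  have E: "u \<noteq> v \<and> u \<in> V \<and> v \<in> V" if "{u, v} \<in> E" for u v
    using G that by (auto simp: simple_graph_def)
  have "{a, b} \<in> E" if a: "a \<in> nbrs E V x \<inter> nbrs E V y" and b: "b \<in> nbrs E V x \<inter> nbrs E V y" and ab: "a \<noteq> b" for a b
  proof (rule ccontr)
    assume n: "{a, b} \<notin> E"
    have e: "{a, x} \<in> E" "{a, y} \<in> E" "{b, x} \<in> E" "{b, y} \<in> E" using a b by (auto simp: nbrs_def)
    have ne: "a \<noteq> x" "a \<noteq> y" "b \<noteq> x" "b \<noteq> y" using E e by blast+
    have s: "{v} \<notin> E" for v using E[of v v] by auto
    \<comment> \<open>The four-cycle in cyclic order; the missing edges \<open>{x, y}\<close> and
      \<open>{a, b}\<close> are its diagonals.\<close>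
    let ?W = "{x, a, y, b}"
    define f :: "'a \<Rightarrow> nat" where "f v = (if v = x then 0 else if v = a then 1 else if v = y then 2 else 3)" for v
    have f: "f x = 0" "f a = 1" "f y = 2" "f b = 3" using ne xy ab by (auto simp: f_def)
    have bij: "bij_betw f ?W C4_verts"
      unfolding bij_betw_def by (auto simp: inj_on_def f C4_verts_def)
    have iso: "{u, v} \<in> induced_edges E ?W \<longleftrightarrow> {f u, f v} \<in> C4_edges" if "u \<in> ?W" "v \<in> ?W" for u v
    proof -
      have "{u, v} \<in> induced_edges E ?W \<longleftrightarrow> {u, v} \<in> E" using that by (auto simp: induced_edges_def)
      moreover have "{u, v} \<in> E \<longleftrightarrow> {f u, f v} \<in> C4_edges"
      proof -
        have sw: "{x, a} \<in> E" "{y, a} \<in> E" "{x, b} \<in> E" "{y, b} \<in> E" "{b, a} \<notin> E" "{y, x} \<notin> E"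
          using e n xy(4) by (simp_all add: insert_commute)
        have "u = x \<or> u = a \<or> u = y \<or> u = b" "v = x \<or> v = a \<or> v = y \<or> v = b" using that by simp_all
        then show ?thesis
          by (elim disjE; simp only: f e n xy(4) sw s; simp add: C4_edges_def doubleton_eq_iff s)
      qed
      ultimately show ?thesis by simp
    qed
    have "graph_isomorphic ?W (induced_edges E ?W) C4_verts C4_edges"
      unfolding graph_isomorphic_def by (intro exI[where x = f] conjI ballI bij iso)
    moreover have "?W \<subseteq> V" using xy E e by blast
    ultimately show False using C4 by (simp add: C4_free_def)
  qed
  moreover have "{u, x} \<in> E \<and> {x, u} \<in> E \<and> u \<in> V" if "u \<in> nbrs E V x" for u
    using that by (simp add: nbrs_def insert_commute)
  ultimately show ?thesis using xy(1) unfolding cliques_def by blast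
qed

text \<open>Inclusion-exclusion: the union of the neighbourhoods misses \<open>x\<close> and
  \<open>y\<close>, and their intersection has at most \<open>w - 1\<close> elements because
  \<open>x\<close> can be added to that clique.\<close>

lemma degree_sum_le:
  assumes G: "simple_graph V E" and C4: "C4_free V E"
    and w: "\<And>F. F \<in> cliques V E \<Longrightarrow> card F \<le> w"
    and xy: "x \<in> V" "y \<in> V" "x \<noteq> y" "{x, y} \<notin> E"
  shows "card (nbrs E V x) + card (nbrs E V y) + 3 \<le> card V + w"
proof -
  let ?A = "nbrs E V x" and ?B = "nbrs E V y"
  have fin: "finite V" using G by (simp add: simple_graph_def)
  have s: "{v} \<notin> E" for v using G by (auto simp: simple_graph_def)
  have finAB: "finite ?A" "finite ?B" using fin by (auto simp: nbrs_def)
  have "x \<notin> ?A" "x \<notin> ?B" "y \<notin> ?A" "y \<notin> ?B"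
    using xy(4) s by (simp_all add: nbrs_def insert_commute)
  then have n: "x \<notin> ?A \<inter> ?B" "?A \<union> ?B \<subseteq> V - {x, y}" unfolding nbrs_def by blast+
  have "card (insert x (?A \<inter> ?B)) \<le> w" by (rule w[OF common_nbrs_clique[OF G C4 xy]])
  then have 1: "Suc (card (?A \<inter> ?B)) \<le> w" using n(1) finAB by simp
  have 2: "card (?A \<union> ?B) \<le> card (V - {x, y})" by (rule card_mono[OF _ n(2)]) (simp add: fin)
  have sub: "{x, y} \<subseteq> V" using xy(1,2) by simp
  have "card {x, y} \<le> card V" by (rule card_mono[OF fin sub])
  moreover have "card (V - {x, y}) = card V - card {x, y}" by (rule card_Diff_subset[OF _ sub]) simp
  ultimately have 3: "card V = card (V - {x, y}) + 2" using xy(3) by simp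
  have arith: "a + b + 3 \<le> n + w" if "Suc i \<le> w" "u \<le> d" "n = d + 2" "a + b = u + i" for a b i u d n :: nat
    using that by linarith
  show ?thesis by (rule arith[OF 1 2 3 card_Un_Int[OF finAB]])
qed

lemma triangles_le_edges:
  fixes V :: "'a set"
  assumes G: "simple_graph V E" and L: "Leray TYPE('k::field) 2 V (clique_complex V E)"
    and C4: "C4_free V E"
    and cl: "\<And>F. F \<in> cliques V E \<Longrightarrow> card F \<le> w" and wn: "2 \<le> w" "w < card V"
  shows "real (card (triangles V E)) \<le> edge_weight (card V) w * real (card E)"
proof -
  interpret extremal_weights "card V" w by unfold_locales (rule wn)+
  have fin: "finite V" using G by (simp add: simple_graph_def)
  have s: "{v} \<notin> E" for v using G by (auto simp: simple_graph_def)
  let ?d = "\<lambda>v. card (nbrs E V v)"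
  \<comment> \<open>Two vertices of \<open>T\<close> have degree sum above \<open>n + w - 3\<close>.
    Outside \<open>T\<close>, the number \<open>m = d + 1\<close> for a degree \<open>d\<close>
    satisfies \<open>2 * m + 1 \<le> n + w\<close>, as \<open>interval_sum_le\<close>
    demands.\<close>
  define T where "T = {v \<in> V. card V + w < 2 * ?d v + 3}"
  have T: "T \<subseteq> V" by (auto simp: T_def)
  have clique: "{u, v} \<in> E" if "u \<in> T" "v \<in> T" "u \<noteq> v" for u v
  proof (rule ccontr)
    assume "{u, v} \<notin> E"
    then have "?d u + ?d v + 3 \<le> card V + w" using that T degree_sum_le[OF G C4 cl] by blast
    then show False using that by (auto simp: T_def)
  qed
  then have "T \<in> cliques V E" using T by (auto simp: cliques_def)
  then have cT: "card T \<le> w" by (rule cl)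
  have finT: "finite T" using T fin finite_subset by auto
  define S where "S = V - T"
  have S: "finite S" "card S = card V - card T" using fin T finT by (auto simp: S_def card_Diff_subset)
  \<comment> \<open>\<open>T\<close> precedes \<open>S\<close>, so the back-degree of a vertex
    \<open>v\<close> of \<open>S\<close> lies between \<open>A v\<close> and its full
    degree.\<close>
  define A where "A v = card (nbrs E T v)" for v
  obtain ts where ts: "set ts = T" "distinct ts" using finite_distinct_list[OF finT] by auto
  have lt: "length ts = card T" using ts distinct_card by metis
  from good_order[OF S(1) s, of p A]
  obtain ss where ss: "distinct ss" "set ss = S"
    "(\<Sum>k<length ss. p (A (ss ! k) + card (nbrs E (set (take k ss)) (ss ! k)))) \<le>
     (\<Sum>v\<in>S. interval_avg p (A v) (card (nbrs E S v)))"
    by (elim exE conjE)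
  define vs where "vs = ts @ ss"
  have vs: "distinct vs" "set vs = V" using ts ss T by (auto simp: vs_def S_def)
  let ?b = "\<lambda>k. card (nbrs E (set (take k vs)) (vs ! k))"
  have "(\<Sum>k<length vs. p (?b k)) = (\<Sum>k<length ts. p (?b k)) + (\<Sum>k<length ss. p (?b (k + length ts)))"
  proof -
    have "(\<Sum>k<length vs. p (?b k)) = (\<Sum>k\<in>{0..<length ts + length ss}. p (?b k))"
      by (simp add: vs_def atLeast0LessThan)
    also have "\<dots> = (\<Sum>k\<in>{0..<length ts}. p (?b k)) + (\<Sum>k\<in>{length ts..<length ts + length ss}. p (?b k))"
      by (simp add: sum.atLeastLessThan_concat)
    also have "(\<Sum>k\<in>{length ts..<length ts + length ss}. p (?b k)) = (\<Sum>k\<in>{0..<length ss}. p (?b (k + length ts)))"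
      using sum.shift_bounds_nat_ivl[of "\<lambda>k. p (?b k)" 0 "length ts" "length ss"] by (simp add: add.commute)
    finally show ?thesis by (simp add: atLeast0LessThan)
  qed
  also have "(\<Sum>k<length ts. p (?b k)) = Q (card T)"
    unfolding Q_def lt[symmetric]
  proof (rule sum.cong)
    fix k assume "k \<in> {..<length ts}"
    then have k: "k < length ts" by simp
    have "nbrs E (set (take k vs)) (vs ! k) = set (take k ts)"
    proof -
      have "{u, ts ! k} \<in> E" if u: "u \<in> set (take k ts)" for u
      proof (rule clique)
        show "u \<in> T" using u ts(1) set_take_subset by fastforce
        show "ts ! k \<in> T" using k ts(1) by auto
        show "u \<noteq> ts ! k" using u k ts(2) by (auto simp: in_set_conv_nth nth_eq_iff_index_eq)
      qed
      then show ?thesis using k by (auto simp: nbrs_def vs_def nth_append)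
    qed
    also have "card (set (take k ts)) = k" using k ts(2) by (simp add: distinct_card)
    finally show "p (?b k) = p k" by simp
  qed simp
  also have "(\<Sum>k<length ss. p (?b (k + length ts))) =
    (\<Sum>k<length ss. p (A (ss ! k) + card (nbrs E (set (take k ss)) (ss ! k))))"
  proof (rule sum.cong)
    fix k assume "k \<in> {..<length ss}"
    then have k: "k < length ss" by simp
    have "nbrs E (set (take (k + length ts) vs)) (vs ! (k + length ts)) =
       nbrs E T (ss ! k) \<union> nbrs E (set (take k ss)) (ss ! k)"
      using ts(1) by (auto simp: nbrs_def vs_def nth_append)
    moreover have "nbrs E T (ss ! k) \<inter> nbrs E (set (take k ss)) (ss ! k) = {}"
      using ss(2) set_take_subset[of k ss] by (auto simp: nbrs_def S_def)
    moreover have "finite (nbrs E T (ss ! k))" "finite (nbrs E (set (take k ss)) (ss ! k))"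
      using finT by (auto simp: nbrs_def)
    ultimately show "p (?b (k + length ts)) = p (A (ss ! k) + card (nbrs E (set (take k ss)) (ss ! k)))"
      by (simp add: card_Un_disjoint A_def)
  qed simp
  also have "Q (card T) + \<dots> \<le> Q (card T) + (\<Sum>v\<in>S. interval_avg p (A v) (card (nbrs E S v)))"
    using ss(3) by simp
  also have "(\<Sum>v\<in>S. interval_avg p (A v) (card (nbrs E S v))) \<le> (\<Sum>v\<in>S. - U (card T))"
  proof (rule sum_mono)
    fix v assume v: "v \<in> S"
    define a b where "a = A v" and "b = card (nbrs E S v)"
    have ab: "a + b = ?d v"
    proof -
      have "nbrs E V v = nbrs E T v \<union> nbrs E S v" using T by (auto simp: nbrs_def S_def)
      moreover have "nbrs E T v \<inter> nbrs E S v = {}" by (auto simp: nbrs_def S_def)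
      moreover have "finite (nbrs E T v)" "finite (nbrs E S v)" using finT S(1) by (auto simp: nbrs_def)
      ultimately show ?thesis by (simp add: card_Un_disjoint a_def b_def A_def)
    qed
    have "2 * (a + b + 1) + 1 \<le> card V + w"
      using v ab by (auto simp: S_def T_def)
    moreover have "a \<le> card T" unfolding a_def A_def using finT by (intro card_mono) (auto simp: nbrs_def)
    ultimately have "Q (a + b + 1) - Q a \<le> - U (card T) * (real (a + b + 1) - real a)"
      using cT by (intro interval_sum_le) auto
    moreover have "Q (a + b + 1) - Q a = (\<Sum>j\<le>b. p (a + j))"
    proof -
      have "Q (a + c) = Q a + (\<Sum>j<c. p (a + j))" for c
        by (induction c) (simp_all add: Q_Suc)
      from this[of "Suc b"] show ?thesis by (simp add: lessThan_Suc_atMost)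
    qed
    ultimately show "interval_avg p (A v) (card (nbrs E S v)) \<le> - U (card T)"
      unfolding interval_avg_def a_def[symmetric] b_def[symmetric] by (simp add: pos_divide_le_eq add.commute)
  qed
  \<comment> \<open>By the choice of \<open>U\<close> the allowance of the vertices in
    \<open>S\<close> balances the cost of the clique \<open>T\<close> exactly.\<close>
  also have "Q (card T) + (\<Sum>v\<in>S. - U (card T)) = 0"
    using cT wn(2) by (simp add: S(2) U_def of_nat_diff)
  finally have "(\<Sum>k<length vs. p (?b k)) \<le> 0" by simp
  moreover have "(\<Sum>k<length vs. p (?b k)) = (\<Sum>k<length vs. triangle_weight w (?b k)) - F * real (card E)"
    by (simp add: p_def sum_subtractf card_edges_order[OF G vs] sum_distrib_left)
  moreover have "real (card (triangles V E)) \<le> (\<Sum>k<length vs. triangle_weight w (?b k))"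
    using Leray_triangle_bound[OF G L cl _ vs] wn(1) by (simp add: nbrs_def)
  ultimately show ?thesis by (simp add: F_def)
qed

theorem theorem2:
  fixes V :: "'a set" and E :: "'a set set" and \<epsilon> \<tau> \<kappa> :: real
  assumes "simple_graph V E"
    and "card V \<ge> 3"
    and "\<epsilon> = edge_density V E"
    and "\<tau> = triangle_density V E"
    and "\<kappa> = clique_number_density V E"
    and "C4_free V E"
    and "Leray TYPE('k::field) 2 V (clique_complex V E)"
  shows "\<tau> \<le> (3 - \<kappa>\<^sup>2) * \<kappa> * \<epsilon> / (1 + 2 * \<kappa> - \<kappa>\<^sup>2)"
proof -
  let ?n = "card V" and ?w = "clique_number V E"
  have fin: "finite V" using assms(1) by (simp add: simple_graph_def)
  have finC: "finite (cliques V E)" by (rule finite_subset[of _ "Pow V"]) (auto simp: cliques_def fin)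
  have w: "card F \<le> ?w" if "F \<in> cliques V E" for F
    unfolding clique_number_def using finC that by (intro Max_ge) auto
  have "{} \<in> cliques V E" by (auto simp: cliques_def)
  then have "?w \<in> card ` cliques V E" unfolding clique_number_def using finC by (intro Max_in) auto
  then obtain F where F: "F \<in> cliques V E" "card F = ?w" by auto
  have FV: "F \<subseteq> V" using F(1) by (auto simp: cliques_def)
  have wn: "?w \<le> ?n" using card_mono[OF fin FV] F(2) by simp
  have n: "0 < real ?n" "real ?n - 1 > 0" "real ?n - 2 > 0" using assms(2) by auto
  have k: "0 \<le> \<kappa>" "\<kappa> \<le> 1" using wn n by (auto simp: assms(5) clique_number_density_def divide_simps)
  have k2: "\<kappa>\<^sup>2 \<le> 1" using k by (simp add: power_le_one)
  have den: "0 < 1 + 2 * \<kappa> - \<kappa>\<^sup>2"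
    using k k2 by (cases "\<kappa> = 0") auto
  have choose2: "real (m choose 2) = real m * (real m - 1) / 2" for m
  proof -
    have "2 * (m choose 2) = m * (m - 1)"
      using binomial_absorption[of 1 m] by (simp add: numeral_2_eq_2)
    then have "2 * real (m choose 2) = real m * real (m - 1)"
      by (metis of_nat_mult of_nat_numeral)
    then show ?thesis by (cases m) simp_all
  qed
  have choose3: "real (?n choose 3) = real ?n * (real ?n - 1) * (real ?n - 2) / 6"
  proof -
    have "3 * (?n choose 3) = ?n * ((?n - 1) choose 2)"
      using binomial_absorption[of 2 "?n"] by (simp add: numeral_3_eq_3 numeral_2_eq_2)
    then have "3 * real (?n choose 3) = real ?n * real ((?n - 1) choose 2)"
      by (metis of_nat_mult of_nat_numeral)
    then show ?thesis using assms(2) by (simp add: choose2 of_nat_diff)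
  qed
  \<comment> \<open>The extremal estimate divides by \<open>n - w\<close>, so complete graphs are
    separate; for them the claimed bound is 1. With \<open>w < 2\<close> there are no
    triangles.\<close>
  consider "?w = ?n" | "?w < 2" | "2 \<le> ?w" "?w < ?n" using wn by linarith
  then show ?thesis
  proof cases
    case 1
    then have "F = V" using card_subset_eq[OF fin FV] F(2) by simp
    then have all: "{u, v} \<in> E" if "u \<in> V" "v \<in> V" "u \<noteq> v" for u v
      using F(1) that by (auto simp: cliques_def)
    have "E = {e. e \<subseteq> V \<and> card e = 2}"
    proof (intro set_eqI iffI)
      fix e assume "e \<in> {e. e \<subseteq> V \<and> card e = 2}"
      then obtain u v where "e = {u, v}" "u \<noteq> v" "u \<in> V" "v \<in> V" by (auto simp: card_2_iff)
      then show "e \<in> E" using all by simp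
    qed (use assms(1) in \<open>auto simp: simple_graph_def\<close>)
    then have "card E = ?n choose 2" using n_subsets[OF fin, of 2] by simp
    then have "\<epsilon> = 1" using choose2 n by (simp add: assms(3) edge_density_def)
    moreover have "triangles V E \<subseteq> {e. e \<subseteq> V \<and> card e = 3}" by (auto simp: triangles_def cliques_def)
    then have "card (triangles V E) \<le> ?n choose 3"
      using n_subsets[OF fin, of 3] fin card_mono[of "{e. e \<subseteq> V \<and> card e = 3}"] by simp
    then have "\<tau> \<le> 1" using choose3 n by (simp add: assms(4) triangle_density_def divide_simps)
    moreover have "\<kappa> = 1" using 1 n by (simp add: assms(5) clique_number_density_def)
    ultimately show ?thesis by simp
  next
    case 2
    then have "triangles V E = {}" using w by (force simp: triangles_def)
    then have "\<tau> = 0" by (simp add: assms(4) triangle_density_def)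
    moreover have "0 \<le> \<epsilon>" by (simp add: assms(3) edge_density_def)
    then have "0 \<le> (3 - \<kappa>\<^sup>2) * \<kappa> * \<epsilon> / (1 + 2 * \<kappa> - \<kappa>\<^sup>2)" using k k2 den by simp
    ultimately show ?thesis by simp
  next
    case 3
    define N W e where "N = real ?n" and "W = real ?w" and "e = real (card E)"
    have N: "0 < N" "N - 1 \<noteq> 0" "N - 2 \<noteq> 0" using n by (auto simp: N_def)
    have "real (card (triangles V E)) \<le> edge_weight ?n ?w * real (card E)"
      using triangles_le_edges[OF assms(1,7,6) w 3] .
    then have "\<tau> \<le> edge_weight N W * e / real (?n choose 3)"
      unfolding assms(4) triangle_density_def by (simp add: divide_right_mono N_def W_def e_def)
    also have "\<dots> = (3 - \<kappa>\<^sup>2) * \<kappa> * \<epsilon> / (1 + 2 * \<kappa> - \<kappa>\<^sup>2)"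
    proof -
      define D where "D = N\<^sup>2 + 2 * N * W - W\<^sup>2"
      have kap: "\<kappa> = W / N" by (simp add: assms(5) clique_number_density_def N_def W_def)
      have eps: "\<epsilon> = e / (N * (N - 1) / 2)"
        unfolding assms(3) edge_density_def choose2 by (simp add: N_def e_def)
      have D: "1 + 2 * \<kappa> - \<kappa>\<^sup>2 = D / N\<^sup>2"
        using N(1) by (simp add: kap D_def field_simps power2_eq_square)
      then have D0: "D \<noteq> 0" using den by auto
      have ew: "edge_weight N W = (N - 2) * W * (3 * N\<^sup>2 - W\<^sup>2) / (3 * N * D)"
        by (simp add: edge_weight_def D_def)
      have ch: "real (?n choose 3) = N * (N - 1) * (N - 2) / 6" unfolding choose3 N_def ..
      have num: "(3 - \<kappa>\<^sup>2) * \<kappa> = (3 * N\<^sup>2 - W\<^sup>2) * W / (N\<^sup>2 * N)"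
        using N(1) by (simp add: kap field_simps power2_eq_square)
      define A N1 N2 where "A = 3 * N\<^sup>2 - W\<^sup>2" and "N1 = N - 1" and "N2 = N - 2"
      have "N \<noteq> 0" "N1 \<noteq> 0" "N2 \<noteq> 0" using N by (simp_all add: N1_def N2_def)
      then show ?thesis
        unfolding ew ch D num eps A_def[symmetric] N1_def[symmetric] N2_def[symmetric]
        using D0 by (simp add: field_simps power2_eq_square)
    qed
    finally show ?thesis .
  qed
qed

end
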